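(* Let $\alpha_1,\alpha_2,\gamma_1,\gamma_2,\Gamma$ be real constants with $\Gamma>0$, $\alpha_1\neq 0$ and $\frac{2\alpha_2}{3\alpha_1}\notin\mathbf{Z}$, and consider $$\partial_t u=\alpha_1\partial_x^3u+i\alpha_2\partial_x^2u+i\gamma_1|u|^2u+\gamma_2\partial_x(|u|^2u)-i\Gamma u\,\partial_x(|u|^2),\quad x\in\mathbf{T}.\qquad (E)$$ (i) Let $s\ge1$. Then for any $\varepsilon,\tau>0$ there exists a real analytic function $\phi_{\varepsilon,\tau}$ on $\mathbf{T}$ satisfying $\|\phi_{\varepsilon,\tau}\|_{H^s}\le\varepsilon$ such that the following holds. Let $T>0$ and let $u^*\in C([-T,T];H^1(\mathbf{T}))$ be a solution to (E) on $[-T,T]$. Let $\varepsilon,\tau>0$ be such that $0<\tau\le T$, $\sup_{t\in[-\tau,\tau]}\|u^*(t)\|_{H^1}\le\varepsilon^{-1}$, and such that $2\varepsilon\le\|u^*(0)\|_{L^2}$ if $u^*(0)\neq0$. Then, if there exists a solution $u\in C([-\tau,\tau];H^1(\mathbf{T}))$ to (E) on $[-\tau,\tau]$ with the initial condition $u(0)=u^*(0)+\phi_{\varepsilon,\tau}$, it holds that $$\sup_{t\in[-\tau,\tau]}\|u(t)-u^*(t)\|_{H^1}\ge\varepsilon^{-1}.$$ (ii) Let $1\le s_1\le s<s_1+1$. Then for any $\varepsilon,\tau>0$ there exists a real analytic function $\tilde\phi_{\varepsilon,\tau}$ on $\mathbf{T}$ satisfying $\|\tilde\phi_{\varepsilon,\tau}\|_{H^s}\le\varepsilon$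 such that the following holds. Let $T>0$ and let $u^*\in C([0,T];H^1(\mathbf{T}))$ be a solution to (E) on $[0,T]$. Let $\varepsilon,\tau>0$ be such that $0<\tau\le T$, $\sup_{t\in[0,\tau]}\|u^*(t)\|_{H^{s_1}}\le\varepsilon^{-1}$, and such that $2\varepsilon\le\|u^*(0)\|_{L^2}$ if $u^*(0)\neq0$. Then, if there exists a solution $u\in C([0,\tau];H^{s_1}(\mathbf{T}))$ to (E) on $[0,\tau]$ with the initial condition $u(0)=u^*(0)+\tilde\phi_{\varepsilon,\tau}$, it holds that $$\sup_{t\in[0,\tau]}\|u(t)-u^*(t)\|_{H^{s_1}}\ge\varepsilon^{-1}.$$ The same is true for the negative time direction (i.e. with $[0,T],[0,\tau]$ replaced by $[-T,0],[-\tau,0]$).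
   Context: The families $\phi_{\varepsilon,\tau}$ and $\tilde\phi_{\varepsilon,\tau}$ are chosen before $T$ and $u^*$ (they do not depend on $T$, $u^*$); the assertions are for all $T$, $u^*$ and all pairs $(\varepsilon,\tau)$ satisfying the listed conditions. Notation: $\mathbf{T}=\mathbf{R}/2\pi\mathbf{Z}$; functions are complex-valued; $\hat f(k)=\frac1{\sqrt{2\pi}}\int_{\mathbf{T}}e^{-ikx}f(x)\,dx$ for $k\in\mathbf{Z}$; $\langle\xi\rangle=1+|\xi|$; $\|f\|_{H^s}=\|\langle k\rangle^s\hat f(k)\|_{\ell^2(\mathbf{Z})}$. Notion of solution: Let $T>0$, $s\ge0$, $u_0\in H^s(\mathbf{T})$. A function $u$ is a solution of (E) with $u(0)=u_0$ on $[0,T)$ if $u\in L^\infty_{loc}([0,T);H^s(\mathbf{T}))\cap L^3_{loc}([0,T)\times\mathbf{T})$, $\partial_x(|u|^2)\in L^1_{loc}([0,T);H^{-s}(\mathbf{T}))$, and for every $\phi\in C_0^\infty([0,T)\times\mathbf{T})$, $$-\int_0^T\!\!\int_{\mathbf{T}}u\,\partial_t\phi\,dx\,dt-\int_{\mathbf{T}}u_0\phi(0,\cdot)\,dx=\int_0^T\!\!\int_{\mathbf{T}}\big[u(-\alpha_1\partial_x^3\phi+i\alpha_2\partial_x^2\phi)+|u|^2u(i\gamma_1\phi-\gamma_2\partial_x\phi)\big]dx\,dt-i\Gamma\int_0^T\langle\partial_x(|u|^2)(t),u(t)\phi(t)\rangle_{H^{-s},H^s}\,dt .$$ A function $u$ is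 a solution on the closed interval $[0,T]$ if $u\in C([0,T];H^{s}(\mathbf{T}))$ for some $s>1/2$ and $u|_{[0,T)}$ is a solution on $[0,T)$, that is, $u|_{[0,T)}\in L^\infty_{loc}([0,T);H^s(\mathbf{T}))\cap L^3_{loc}([0,T)\times\mathbf{T})$, $\partial_x(|u|^2)\in L^1_{loc}([0,T);H^{-s}(\mathbf{T}))$, and the displayed integral identity holds for every $\phi\in C_0^\infty([0,T)\times\mathbf{T})$. Solutions on $(-T,0]$ and $[-T,0]$ are defined in a similar manner (with test functions in $C_0^\infty((-T,0]\times\mathbf{T})$, time integrals over $(-T,0)$, and the term $-\int_{\mathbf{T}}u_0\phi(0,\cdot)\,dx$ replaced by $+\int_{\mathbf{T}}u_0\phi(0,\cdot)\,dx$). A solution on $[-T,T]$ is a function whose restrictions to $[0,T]$ and $[-T,0]$ are solutions there with the same $u_0$. *)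

theory Defs
  imports "HOL-Analysis.Analysis"
begin

text \<open>Functions on \<open>T = R / 2 pi Z\<close> are \<open>2 pi\<close>-periodic functions on the real line, with integrals
  over one period.  Elements of function spaces are represented by functions, so that equality in
  these spaces is equality almost everywhere.\<close>

definition periodic :: "(real \<Rightarrow> complex) \<Rightarrow> bool" where
  "periodic f \<longleftrightarrow> (\<forall>x. f (x + 2 * pi) = f x)"

definition torus_integral :: "(real \<Rightarrow> complex) \<Rightarrow> complex" where
  "torus_integral f = set_lebesgue_integral lebesgue {0..2 * pi} f"

definition square_integrable :: "(real \<Rightarrow> complex) \<Rightarrow> bool" where
  "square_integrable f \<longleftrightarrow> set_borel_measurable lebesgue {0..2 * pi} f \<and>
     set_integrable lebesgue {0..2 * pi} (\<lambda>x. (cmod (f x))\<^sup>2)"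

definition L2_norm :: "(real \<Rightarrow> complex) \<Rightarrow> real" where
  "L2_norm f = sqrt (set_lebesgue_integral lebesgue {0..2 * pi} (\<lambda>x. (cmod (f x))\<^sup>2))"

definition fourier :: "(real \<Rightarrow> complex) \<Rightarrow> int \<Rightarrow> complex" where
  "fourier f k = torus_integral (\<lambda>x. exp (- \<i> * of_int k * of_real x) * f x) / of_real (sqrt (2 * pi))"

definition bracket :: "real \<Rightarrow> real" where
  "bracket \<xi> = 1 + \<bar>\<xi>\<bar>"

text \<open>Periodic distributions (needed for \<open>H\<^sup>r(T)\<close> with \<open>r < 0\<close>) are represented by their
  sequences of Fourier coefficients.  Norms take values in \<^typ>\<open>ennreal\<close>; they are infinite
  exactly outside the space.\<close>

definition weighted_norm :: "real \<Rightarrow> (int \<Rightarrow> complex) \<Rightarrow> ennreal" where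
  "weighted_norm r c =
     (if (\<lambda>k. (bracket (of_int k) powr r * cmod (c k))\<^sup>2) summable_on UNIV
      then ennreal (sqrt (\<Sum>\<^sub>\<infinity>k. (bracket (of_int k) powr r * cmod (c k))\<^sup>2))
      else \<infinity>)"

text \<open>For \<open>s \<ge> 0\<close>.  The case distinction is needed because \<^const>\<open>fourier\<close> has the junk value 0 on
  functions that are not integrable.\<close>

definition sobolev_norm :: "real \<Rightarrow> (real \<Rightarrow> complex) \<Rightarrow> ennreal" where
  "sobolev_norm s f = (if square_integrable f then weighted_norm s (fourier f) else \<infinity>)"

definition sobolev :: "real \<Rightarrow> (real \<Rightarrow> complex) set" where
  "sobolev s = {f. periodic f \<and> sobolev_norm s f < \<infinity>}"

definition continuous_sobolev :: "real set \<Rightarrow> real \<Rightarrow> (real \<Rightarrow> real \<Rightarrow> complex) \<Rightarrow> bool" where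
  "continuous_sobolev I s u \<longleftrightarrow> (\<forall>t\<in>I. u t \<in> sobolev s) \<and>
     (\<forall>t\<^sub>0\<in>I. ((\<lambda>t. sobolev_norm s (\<lambda>x. u t x - u t\<^sub>0 x)) \<longlongrightarrow> 0) (at t\<^sub>0 within I))"

text \<open>Bochner measurability of an \<open>H\<^sup>r\<close>-valued map: almost everywhere limit of simple functions.\<close>

definition strongly_measurable :: "real set \<Rightarrow> real \<Rightarrow> (real \<Rightarrow> int \<Rightarrow> complex) \<Rightarrow> bool" where
  "strongly_measurable J r c \<longleftrightarrow>
     (\<exists>S :: nat \<Rightarrow> real \<Rightarrow> int \<Rightarrow> complex.
        (\<forall>n. finite (range (S n)) \<and> (\<forall>t. weighted_norm r (S n t) < \<infinity>) \<and>
             (\<forall>v. S n -` {v} \<in> sets lebesgue)) \<and>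
        (AE t in lebesgue. t \<in> J \<longrightarrow>
           ((\<lambda>n. weighted_norm r (\<lambda>k. S n t k - c t k)) \<longlongrightarrow> 0) sequentially))"

definition Linf_loc_sobolev :: "real set \<Rightarrow> real \<Rightarrow> (real \<Rightarrow> real \<Rightarrow> complex) \<Rightarrow> bool" where
  "Linf_loc_sobolev J s u \<longleftrightarrow> strongly_measurable J s (\<lambda>t. fourier (u t)) \<and>
     (\<forall>K. compact K \<and> K \<subseteq> J \<longrightarrow>
        (\<exists>C::real. AE t in lebesgue. t \<in> K \<longrightarrow> sobolev_norm s (u t) \<le> ennreal C))"

definition L3_loc :: "real set \<Rightarrow> (real \<Rightarrow> real \<Rightarrow> complex) \<Rightarrow> bool" where
  "L3_loc J u \<longleftrightarrow> set_borel_measurable lebesgue (J \<times> {0..2 * pi}) (\<lambda>(t, x). u t x) \<and>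
     (\<forall>K. compact K \<and> K \<subseteq> J \<longrightarrow>
        set_integrable lebesgue (K \<times> {0..2 * pi}) (\<lambda>(t, x). (cmod (u t x)) ^ 3))"

definition L1_loc_distr :: "real set \<Rightarrow> real \<Rightarrow> (real \<Rightarrow> int \<Rightarrow> complex) \<Rightarrow> bool" where
  "L1_loc_distr J r c \<longleftrightarrow> strongly_measurable J r c \<and>
     (\<forall>K. compact K \<and> K \<subseteq> J \<longrightarrow> (\<integral>\<^sup>+t\<in>K. weighted_norm r (c t) \<partial>lebesgue) < \<infinity>)"

text \<open>The distributional derivative of \<open>|f|\<^sup>2\<close>; its \<open>k\<close>-th Fourier coefficient is obtained by
  testing with \<open>exp (- i k x)\<close>.\<close>

definition dx_abs_sq :: "(real \<Rightarrow> complex) \<Rightarrow> int \<Rightarrow> complex" where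
  "dx_abs_sq f k = \<i> * of_int k * fourier (\<lambda>x. of_real ((cmod (f x))\<^sup>2)) k"

text \<open>The bilinear (not sesquilinear) duality pairing of \<open>H\<^sup>-\<^sup>s\<close> and \<open>H\<^sup>s\<close>, which extends
  \<open>\<integral> f g dx\<close>.\<close>

definition pairing :: "(int \<Rightarrow> complex) \<Rightarrow> (real \<Rightarrow> complex) \<Rightarrow> complex" where
  "pairing c g = (\<Sum>\<^sub>\<infinity>k. c k * fourier g (- k))"

text \<open>Test functions in \<open>C\<^sub>0\<^sup>\<infinity>(J \<times> T)\<close> for an interval \<open>J\<close> that may contain an endpoint, where time
  derivatives are one-sided; \<open>D i j\<close> is the partial derivative of order \<open>i\<close> in \<open>t\<close> and \<open>j\<close>
  in \<open>x\<close>.\<close>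

definition smooth_on :: "real set \<Rightarrow> (real \<Rightarrow> real \<Rightarrow> complex) \<Rightarrow> bool" where
  "smooth_on J \<phi> \<longleftrightarrow>
     (\<exists>D :: nat \<Rightarrow> nat \<Rightarrow> real \<Rightarrow> real \<Rightarrow> complex. D 0 0 = \<phi> \<and>
        (\<forall>i j. continuous_on (J \<times> UNIV) (\<lambda>(t, x). D i j t x) \<and>
           (\<forall>t\<in>J. \<forall>x.
              ((\<lambda>t'. D i j t' x) has_vector_derivative D (Suc i) j t x) (at t within J) \<and>
              (D i j t has_vector_derivative D i (Suc j) t x) (at x))))"

definition test_function :: "real set \<Rightarrow> (real \<Rightarrow> real \<Rightarrow> complex) \<Rightarrow> bool" where
  "test_function J \<phi> \<longleftrightarrow> smooth_on J \<phi> \<and> (\<forall>t\<in>J. periodic (\<phi> t)) \<and>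
     (\<exists>K. compact K \<and> K \<subseteq> J \<and> (\<forall>t\<in>J - K. \<forall>x. \<phi> t x = 0))"

definition dt :: "real set \<Rightarrow> (real \<Rightarrow> real \<Rightarrow> complex) \<Rightarrow> real \<Rightarrow> real \<Rightarrow> complex" where
  "dt J \<phi> t x = vector_derivative (\<lambda>t'. \<phi> t' x) (at t within J)"

definition dx :: "(real \<Rightarrow> real \<Rightarrow> complex) \<Rightarrow> real \<Rightarrow> real \<Rightarrow> complex" where
  "dx \<phi> t x = vector_derivative (\<phi> t) (at x)"

definition spacetime_integral :: "real set \<Rightarrow> (real \<Rightarrow> real \<Rightarrow> complex) \<Rightarrow> complex" where
  "spacetime_integral J f = set_lebesgue_integral lebesgue (J \<times> {0..2 * pi}) (\<lambda>(t, x). f t x)"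

text \<open>\<open>\<sigma> = 1\<close> is used for \<open>J = [0, T)\<close> and \<open>\<sigma> = -1\<close> for \<open>J = (-T, 0]\<close>.\<close>

definition weak_identity ::
  "real \<Rightarrow> real \<Rightarrow> real \<Rightarrow> real \<Rightarrow> real \<Rightarrow> real \<Rightarrow> real set \<Rightarrow>
   (real \<Rightarrow> complex) \<Rightarrow> (real \<Rightarrow> real \<Rightarrow> complex) \<Rightarrow> (real \<Rightarrow> real \<Rightarrow> complex) \<Rightarrow> bool" where
  "weak_identity \<alpha>\<^sub>1 \<alpha>\<^sub>2 \<gamma>\<^sub>1 \<gamma>\<^sub>2 \<Gamma> \<sigma> J u\<^sub>0 u \<phi> \<longleftrightarrow>
     - spacetime_integral J (\<lambda>t x. u t x * dt J \<phi> t x)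
       - of_real \<sigma> * torus_integral (\<lambda>x. u\<^sub>0 x * \<phi> 0 x)
     = spacetime_integral J (\<lambda>t x.
         u t x * (- of_real \<alpha>\<^sub>1 * (dx ^^ 3) \<phi> t x + \<i> * of_real \<alpha>\<^sub>2 * (dx ^^ 2) \<phi> t x)
         + of_real ((cmod (u t x))\<^sup>2) * u t x *
             (\<i> * of_real \<gamma>\<^sub>1 * \<phi> t x - of_real \<gamma>\<^sub>2 * dx \<phi> t x))
       - \<i> * of_real \<Gamma> *
         set_lebesgue_integral lebesgue J (\<lambda>t. pairing (dx_abs_sq (u t)) (\<lambda>x. u t x * \<phi> t x))"

definition weak_solution ::
  "real \<Rightarrow> real \<Rightarrow> real \<Rightarrow> real \<Rightarrow> real \<Rightarrow> real \<Rightarrow> real set \<Rightarrow> real \<Rightarrow>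
   (real \<Rightarrow> complex) \<Rightarrow> (real \<Rightarrow> real \<Rightarrow> complex) \<Rightarrow> bool" where
  "weak_solution \<alpha>\<^sub>1 \<alpha>\<^sub>2 \<gamma>\<^sub>1 \<gamma>\<^sub>2 \<Gamma> \<sigma> J s u\<^sub>0 u \<longleftrightarrow>
     u\<^sub>0 \<in> sobolev s \<and> (\<forall>t\<in>J. periodic (u t)) \<and>
     Linf_loc_sobolev J s u \<and> L3_loc J u \<and>
     L1_loc_distr J (- s) (\<lambda>t. dx_abs_sq (u t)) \<and>
     (\<forall>\<phi>. test_function J \<phi> \<longrightarrow> weak_identity \<alpha>\<^sub>1 \<alpha>\<^sub>2 \<gamma>\<^sub>1 \<gamma>\<^sub>2 \<Gamma> \<sigma> J u\<^sub>0 u \<phi>)"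

definition solution_forward ::
  "real \<Rightarrow> real \<Rightarrow> real \<Rightarrow> real \<Rightarrow> real \<Rightarrow> real \<Rightarrow>
   (real \<Rightarrow> complex) \<Rightarrow> (real \<Rightarrow> real \<Rightarrow> complex) \<Rightarrow> bool" where
  "solution_forward \<alpha>\<^sub>1 \<alpha>\<^sub>2 \<gamma>\<^sub>1 \<gamma>\<^sub>2 \<Gamma> T u\<^sub>0 u \<longleftrightarrow>
     (\<exists>s>1/2. continuous_sobolev {0..T} s u \<and>
        weak_solution \<alpha>\<^sub>1 \<alpha>\<^sub>2 \<gamma>\<^sub>1 \<gamma>\<^sub>2 \<Gamma> 1 {0..<T} s u\<^sub>0 u)"

definition solution_backward ::
  "real \<Rightarrow> real \<Rightarrow> real \<Rightarrow> real \<Rightarrow> real \<Rightarrow> real \<Rightarrow>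
   (real \<Rightarrow> complex) \<Rightarrow> (real \<Rightarrow> real \<Rightarrow> complex) \<Rightarrow> bool" where
  "solution_backward \<alpha>\<^sub>1 \<alpha>\<^sub>2 \<gamma>\<^sub>1 \<gamma>\<^sub>2 \<Gamma> T u\<^sub>0 u \<longleftrightarrow>
     (\<exists>s>1/2. continuous_sobolev {-T..0} s u \<and>
        weak_solution \<alpha>\<^sub>1 \<alpha>\<^sub>2 \<gamma>\<^sub>1 \<gamma>\<^sub>2 \<Gamma> (- 1) {-T<..0} s u\<^sub>0 u)"

definition solution_both ::
  "real \<Rightarrow> real \<Rightarrow> real \<Rightarrow> real \<Rightarrow> real \<Rightarrow> real \<Rightarrow>
   (real \<Rightarrow> complex) \<Rightarrow> (real \<Rightarrow> real \<Rightarrow> complex) \<Rightarrow> bool" where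
  "solution_both \<alpha>\<^sub>1 \<alpha>\<^sub>2 \<gamma>\<^sub>1 \<gamma>\<^sub>2 \<Gamma> T u\<^sub>0 u \<longleftrightarrow>
     solution_forward \<alpha>\<^sub>1 \<alpha>\<^sub>2 \<gamma>\<^sub>1 \<gamma>\<^sub>2 \<Gamma> T u\<^sub>0 u \<and>
     solution_backward \<alpha>\<^sub>1 \<alpha>\<^sub>2 \<gamma>\<^sub>1 \<gamma>\<^sub>2 \<Gamma> T u\<^sub>0 u"

definition real_analytic_torus :: "(real \<Rightarrow> complex) \<Rightarrow> bool" where
  "real_analytic_torus f \<longleftrightarrow> periodic f \<and>
     (\<forall>x\<^sub>0. \<exists>(a :: nat \<Rightarrow> complex) r. r > 0 \<and>
        (\<forall>x. \<bar>x - x\<^sub>0\<bar> < r \<longrightarrow> (\<lambda>n. a n * of_real ((x - x\<^sub>0) ^ n)) sums f x))"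

end

theory Submission
  imports Defs
begin

text \<open>In Fourier coefficients the equation reads \<open>a\<^sub>k' = i \<omega>\<^sub>k a\<^sub>k + \<N>\<^sub>k(a)\<close> with a trilinear sum
  \<open>\<N>\<^sub>k\<close>. The interactions of the Raman term that involve \<open>a\<^sub>k\<close> itself contribute a real growth rate close to
  \<open>\<Gamma> k \<parallel>u\<parallel>\<^sup>2 / 2\<pi>\<close>, of Cauchy-Riemann type. All others oscillate with the phase
  \<open>3 \<alpha>\<^sub>1 (k - p) (k - r) (p + r + 2\<alpha>\<^sub>2 / 3\<alpha>\<^sub>1)\<close>, which is bounded below because \<open>2\<alpha>\<^sub>2 / 3\<alpha>\<^sub>1\<close> is not an
  integer; a normal form transformation gains a derivative and turns them into a bounded forcing. Solving the
  remaining linear equation backwards from the end of the time interval shows that a solution bounded in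
  \<open>H\<^sup>s\<close> with mass bounded below satisfies \<open>a\<^sub>k(0) = O(k\<^sup>-\<^sup>s\<^sup>-\<^sup>1)\<close> for the modes growing in that time
  direction. If the solution exists in both directions, this holds for all modes at interior times, and iteration
  gives arbitrary smoothness at time \<open>0\<close>. When the data of a bounded solution are perturbed by a small multiple of
  \<open>1 + \<langle>N\<rangle>\<^sup>-\<^sup>s e\<^sup>i\<^sup>N\<^sup>x\<close> with \<open>\<bar>N\<bar>\<close> large, the perturbed data violate this decay, so the
  perturbed solution cannot stay close.\<close>

section \<open>Weighted square-summable sequences\<close>

text \<open>The perturbation is fixed before T and u* are known, so every constant must be uniform
  over all coefficient sequences in a ball with mass bounded below. Hence the lemmas say that one
  constant works for all \<open>a\<close>, and convergence arguments take the form of tail bounds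
  uniform on balls. The radius is 2/\<epsilon>: u* contributes 1/\<epsilon>, and the negated
  conclusion bounds u - u* by another 1/\<epsilon>. The mass threshold \<epsilon>^2/4 is reached by
  u(0) whether or not u*(0) vanishes. The gain of a full derivative is a balance: after the normal
  form the forcing of mode k is O(k^(-s)), and solving against a growth rate of order k divides by
  k. The condition s < \<open>s\<^sub>1\<close> + 1 says that the resulting decay beats N^(-s), the
  size of the mode N planted by the perturbation. With two time directions the gain can be repeated,
  which is why part (i) admits every s. Existence of u is assumed, so only a priori estimates occur.
  They use nothing but the differential equations of the coefficients; extracting these from the
  weak formulation is a separate task.\<close>

definition jp :: "int \<Rightarrow> real" where "jp k = 1 + \<bar>of_int k\<bar>"

lemma jp_ge1: "1 \<le> jp k" and jp_pos: "0 < jp k" and jp_nonneg: "0 \<le> jp k"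
  by (auto simp: jp_def)

lemma jp_minus [simp]: "jp (- k) = jp k"
  by (simp add: jp_def)

lemma jp_diff: "jp (j - k) \<le> jp j + jp k"
  by (simp add: jp_def)

lemma jp_add_mult: "jp (j + k) \<le> jp j * jp k"
proof -
  have "0 \<le> \<bar>real_of_int j\<bar> * \<bar>real_of_int k\<bar>" by simp
  moreover have "jp j * jp k = 1 + \<bar>of_int j\<bar> + \<bar>of_int k\<bar> + \<bar>of_int j\<bar> * \<bar>of_int k\<bar>"
    by (simp add: jp_def algebra_simps)
  moreover have "jp (j + k) \<le> 1 + \<bar>of_int j\<bar> + \<bar>of_int k\<bar>" by (simp add: jp_def)
  ultimately show ?thesis by linarith
qed

text \<open>The factors of a cubic interaction feeding mode k have the frequencies p, p + r - k and
  r, and k = p - (p + r - k) + r. Submultiplicativity distributes the weight at k over them.\<close>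

lemma jp_triple: "jp k \<le> jp p * jp (p + r - k) * jp r"
proof -
  have "jp k = jp ((p + r) + (- (p + r - k)))" by simp
  also have "\<dots> \<le> jp (p + r) * jp (p + r - k)" by (metis jp_add_mult jp_minus)
  also have "\<dots> \<le> (jp p * jp r) * jp (p + r - k)"
    by (intro mult_right_mono jp_add_mult jp_nonneg)
  finally show ?thesis by (simp add: algebra_simps)
qed

lemma jp_triple_sum: "jp k \<le> jp p + jp (p + r - k) + jp r"
  by (simp add: jp_def)

text \<open>Bounding all finite partial sums keeps the estimates free of summability side
  conditions; infinite sums appear only once a bound is available. Nonnegativity is built in so that
  products can be estimated monotonically.\<close>

definition l2_bounded :: "(int \<Rightarrow> real) \<Rightarrow> real \<Rightarrow> bool" where
  "l2_bounded f F \<longleftrightarrow> (\<forall>k. 0 \<le> f k) \<and> 0 \<le> F \<and> (\<forall>X. finite X \<longrightarrow> (\<Sum>k\<in>X. (f k)\<^sup>2) \<le> F\<^sup>2)"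

lemma l2_boundedD:
  assumes "l2_bounded f F"
  shows "0 \<le> f k" "0 \<le> F" "finite X \<Longrightarrow> (\<Sum>k\<in>X. (f k)\<^sup>2) \<le> F\<^sup>2"
  using assms by (auto simp: l2_bounded_def)

lemma l2_bounded_le:
  assumes "l2_bounded f F"
  shows "f k \<le> F"
  using l2_boundedD(2)[OF assms] l2_boundedD(3)[OF assms, of "{k}"]
  by (auto intro: power2_le_imp_le)

lemma l2_bounded_reindex: "l2_bounded f F \<Longrightarrow> inj h \<Longrightarrow> l2_bounded (\<lambda>k. f (h k)) F"
  unfolding l2_bounded_def
proof safe
  fix X :: "int set"
  assume "\<forall>X. finite X \<longrightarrow> (\<Sum>k\<in>X. (f k)\<^sup>2) \<le> F\<^sup>2" "inj h" "finite X"
  moreover from this have "(\<Sum>k\<in>X. (f (h k))\<^sup>2) = (\<Sum>k\<in>h ` X. (f k)\<^sup>2)"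
    by (subst sum.reindex) (auto simp: inj_on_def inj_def)
  ultimately show "(\<Sum>k\<in>X. (f (h k))\<^sup>2) \<le> F\<^sup>2" by auto
qed auto

lemma l2_bounded_mono:
  assumes "l2_bounded f F" "\<And>k. 0 \<le> g k" "\<And>k. g k \<le> f k"
  shows "l2_bounded g F"
  unfolding l2_bounded_def
proof (intro conjI allI impI)
  fix X :: "int set" assume X: "finite X"
  have "(\<Sum>k\<in>X. (g k)\<^sup>2) \<le> (\<Sum>k\<in>X. (f k)\<^sup>2)" using assms by (intro sum_mono power_mono) auto
  also have "\<dots> \<le> F\<^sup>2" using assms X by (auto simp: l2_bounded_def)
  finally show "(\<Sum>k\<in>X. (g k)\<^sup>2) \<le> F\<^sup>2" .
qed (use assms in \<open>auto simp: l2_bounded_def\<close>)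

lemma l2_bounded_mono_const: "l2_bounded f F \<Longrightarrow> F \<le> G \<Longrightarrow> l2_bounded f G"
  unfolding l2_bounded_def
proof (intro conjI allI impI; elim conjE)
  fix X :: "int set"
  assume X: "finite X" "0 \<le> F" "F \<le> G" "\<forall>X. finite X \<longrightarrow> (\<Sum>k\<in>X. (f k)\<^sup>2) \<le> F\<^sup>2"
  from X(1,4) have "(\<Sum>k\<in>X. (f k)\<^sup>2) \<le> F\<^sup>2" by blast
  also have "\<dots> \<le> G\<^sup>2" using X by (intro power_mono) auto
  finally show "(\<Sum>k\<in>X. (f k)\<^sup>2) \<le> G\<^sup>2" .
qed auto

lemma l2_bounded_CS:
  assumes "l2_bounded f F" "l2_bounded g G" "finite X"
  shows "(\<Sum>k\<in>X. f k * g k) \<le> F * G"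
proof -
  have "(\<Sum>k\<in>X. f k * g k)\<^sup>2 \<le> (\<Sum>k\<in>X. (f k)\<^sup>2) * (\<Sum>k\<in>X. (g k)\<^sup>2)"
    by (rule Cauchy_Schwarz_ineq_sum)
  also have "\<dots> \<le> F\<^sup>2 * G\<^sup>2"
    using assms by (intro mult_mono) (auto simp: l2_bounded_def intro: sum_nonneg)
  finally have "(\<Sum>k\<in>X. f k * g k)\<^sup>2 \<le> (F * G)\<^sup>2" by (simp add: power_mult_distrib)
  then show ?thesis using assms by (auto simp: l2_bounded_def intro: power2_le_imp_le)
qed

lemma jp_power_sum_bound:
  assumes "finite X"
  shows "(\<Sum>k\<in>X. jp k powr (-3/2)) \<le> 9"
proof -
  \<comment> \<open>Mean value theorem for -2 x^(-1/2), whose derivative is x^(-3/2): the terms are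
    dominated by a telescoping sum.\<close>
  have step: "(2 + real n) powr (-3/2) \<le> 2 * (1 + real n) powr (-1/2) - 2 * (2 + real n) powr (-1/2)" for n
  proof -
    define f where "f = (\<lambda>x. - 2 * x powr (-1/2 :: real))"
    have "\<exists>z>1 + real n. z < 2 + real n \<and> f (2 + real n) - f (1 + real n) = (2 + real n - (1 + real n)) * z powr (-3/2)"
      unfolding f_def
      by (rule MVT2) (auto intro!: derivative_eq_intros simp: field_simps)
    then obtain z where z: "z > 1 + real n" "z < 2 + real n" "f (2 + real n) - f (1 + real n) = z powr (-3/2)"
      by auto
    have "(2 + real n) powr (-3/2) \<le> z powr (-3/2)"
      using z by (intro powr_mono2') auto
    then show ?thesis using z(3) by (simp add: f_def)
  qed
  \<comment> \<open>The correction term absorbs \<open>step\<close> once for each of the new modes n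
    + 1 and -n - 1. The constant 9 is a square, so that 1/\<open>jp\<close> has l2 norm at most
    3.\<close>
  have sym: "(\<Sum>k\<in>{-int n..int n}. jp k powr (-3/2)) \<le> 9 - 4 * (1 + real n) powr (-1/2)" for n
  proof (induction n)
    case (Suc n)
    have eq: "{-int (Suc n)..int (Suc n)} = insert (int (Suc n)) (insert (- int (Suc n)) {-int n..int n})"
      by auto
    have "(\<Sum>k\<in>{-int (Suc n)..int (Suc n)}. jp k powr (-3/2))
        = 2 * (2 + real n) powr (-3/2) + (\<Sum>k\<in>{-int n..int n}. jp k powr (-3/2))"
      unfolding eq by (subst sum.insert) (auto simp: jp_def)
    then show ?case using Suc.IH step[of n] by (simp add: algebra_simps)
  qed (auto simp: jp_def)
  obtain n where n: "X \<subseteq> {-int n..int n}"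
  proof -
    have "X \<subseteq> {-int (nat (Max (insert 0 (abs ` X))))..int (nat (Max (insert 0 (abs ` X))))}"
    proof
      fix x assume "x \<in> X"
      then have "\<bar>x\<bar> \<le> Max (insert 0 (abs ` X))" using assms by (intro Max_ge) auto
      then show "x \<in> {-int (nat (Max (insert 0 (abs ` X))))..int (nat (Max (insert 0 (abs ` X))))}"
        by auto
    qed
    then show ?thesis using that by blast
  qed
  have "(\<Sum>k\<in>X. jp k powr (-3/2)) \<le> (\<Sum>k\<in>{-int n..int n}. jp k powr (-3/2))"
    using n by (intro sum_mono2) auto
  also have "\<dots> \<le> 9" using sym[of n] by (smt (verit) powr_ge_zero)
  finally show ?thesis .
qed

lemma l2_bounded_inverse_jp: "l2_bounded (\<lambda>k. 1 / jp k) 3"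
  unfolding l2_bounded_def
proof (intro conjI allI impI)
  fix X :: "int set" assume X: "finite X"
  have "(\<Sum>k\<in>X. (1 / jp k)\<^sup>2) \<le> (\<Sum>k\<in>X. jp k powr (-3/2))"
  proof (rule sum_mono)
    fix k
    have "(1 / jp k)\<^sup>2 = jp k powr (-2)"
      using jp_pos[of k] by (simp add: powr_minus powr_numeral power_divide divide_simps)
    also have "\<dots> \<le> jp k powr (-3/2)" using jp_ge1 by (intro powr_mono) auto
    finally show "(1 / jp k)\<^sup>2 \<le> jp k powr (-3/2)" .
  qed
  also have "\<dots> \<le> 9" using X by (rule jp_power_sum_bound)
  finally show "(\<Sum>k\<in>X. (1 / jp k)\<^sup>2) \<le> 3\<^sup>2" by simp
qed (use jp_pos in \<open>auto simp: less_imp_le\<close>)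

section \<open>Multilinear convolution sums with l2 factors\<close>

text \<open>Enlarging S to the product of its projections keeps the sum finite and permits iterated
  summation, so arbitrary finite index sets can be handled.\<close>

lemma sum_pairs_le:
  fixes w :: "'a \<Rightarrow> real" and v :: "'a \<Rightarrow> 'b \<Rightarrow> real"
  assumes S: "finite S" and w0: "\<And>x. 0 \<le> w x" and v0: "\<And>x y. 0 \<le> v x y" and V: "0 \<le> V"
    and W: "\<And>X. finite X \<Longrightarrow> sum w X \<le> W"
    and vV: "\<And>x Y. finite Y \<Longrightarrow> sum (v x) Y \<le> V"
  shows "(\<Sum>(x, y)\<in>S. w x * v x y) \<le> W * V"
proof -
  have "(\<Sum>(x, y)\<in>S. w x * v x y) \<le> (\<Sum>(x, y)\<in>fst ` S \<times> snd ` S. w x * v x y)"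
    
  proof (rule sum_mono2)
    show "S \<subseteq> fst ` S \<times> snd ` S" by (rule subset_fst_snd)
  qed (use S w0 v0 in auto)
  also have "\<dots> = (\<Sum>x\<in>fst ` S. w x * (\<Sum>y\<in>snd ` S. v x y))"
    by (simp add: sum.cartesian_product[symmetric] sum_distrib_left)
  also have "\<dots> \<le> (\<Sum>x\<in>fst ` S. w x * V)"
    using S w0 vV by (intro sum_mono mult_left_mono) auto
  also have "\<dots> = sum w (fst ` S) * V" by (simp add: sum_distrib_right)
  also have "\<dots> \<le> W * V" using S V by (intro mult_right_mono W) auto
  finally show ?thesis .
qed

lemma sum_pairs_le':
  fixes w :: "'a \<Rightarrow> real" and v :: "'a \<times> 'b \<Rightarrow> real"
  assumes "finite S" "\<And>x. 0 \<le> w x" "\<And>x. 0 \<le> v x" "0 \<le> V"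
    and "\<And>X. finite X \<Longrightarrow> sum w X \<le> W"
    and "\<And>x Y. finite Y \<Longrightarrow> (\<Sum>y\<in>Y. v (x, y)) \<le> V"
  shows "(\<Sum>x\<in>S. w (fst x) * v x) \<le> W * V"
  using sum_pairs_le[of S w "\<lambda>x y. v (x, y)" V W] assms by (simp add: case_prod_beta)

text \<open>Three l2 factors on two free indices do not suffice: Cauchy-Schwarz in r uses up two of
  them and leaves f, which would have to be l1 in p. The fourth factor w supplies this. The next two
  lemmas attach w to the other frequencies by a change of variables.\<close>

lemma trilinear_first:
  assumes "l2_bounded f F" "l2_bounded g G" "l2_bounded h H" "l2_bounded w W" "finite S"
  shows "(\<Sum>(p, r)\<in>S. f p * g (p + r - k) * h r * w p) \<le> F * G * H * W"
proof -
  have "(\<Sum>(p, r)\<in>S. (f p * w p) * (g (p + r - k) * h r)) \<le> (F * W) * (G * H)"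
  proof (rule sum_pairs_le)
    fix p :: int and Y :: "int set" assume "finite Y"
    moreover have "l2_bounded (\<lambda>r. g (p + r - k)) G"
      by (rule l2_bounded_reindex[OF assms(2)]) (auto simp: inj_def)
    ultimately show "(\<Sum>r\<in>Y. g (p + r - k) * h r) \<le> G * H"
      using assms(3) by (intro l2_bounded_CS)
  qed (use assms in \<open>auto simp: l2_bounded_def intro!: l2_bounded_CS\<close>)
  then show ?thesis by (simp add: mult_ac)
qed

lemma trilinear_last:
  assumes "l2_bounded f F" "l2_bounded g G" "l2_bounded h H" "l2_bounded w W" "finite S"
  shows "(\<Sum>(p, r)\<in>S. f p * g (p + r - k) * h r * w r) \<le> F * G * H * W"
proof -
  have "(\<Sum>(p, r)\<in>S. f p * g (p + r - k) * h r * w r)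
      = (\<Sum>(r, p)\<in>prod.swap ` S. h r * g (r + p - k) * f p * w r)"
    by (subst sum.reindex) (auto simp: inj_on_def case_prod_beta algebra_simps)
  also have "\<dots> \<le> H * G * F * W" using assms by (intro trilinear_first) auto
  finally show ?thesis by (simp add: mult_ac)
qed

lemma trilinear_middle:
  assumes "l2_bounded f F" "l2_bounded g G" "l2_bounded h H" "l2_bounded w W" "finite S"
  shows "(\<Sum>(p, r)\<in>S. f p * g (p + r - k) * h r * w (p + r - k)) \<le> F * G * H * W"
proof -
  have "(\<Sum>(p, r)\<in>S. f p * g (p + r - k) * h r * w (p + r - k))
      = (\<Sum>(m, r)\<in>(\<lambda>(p, r). (p + r - k, r)) ` S. (g m * w m) * (f (m - r + k) * h r))"
    by (subst sum.reindex) (auto simp: inj_on_def case_prod_beta algebra_simps)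
  also have "\<dots> \<le> (G * W) * (F * H)"
  proof (rule sum_pairs_le)
    fix m :: int and Y :: "int set" assume "finite Y"
    moreover have "l2_bounded (\<lambda>r. f (m - r + k)) F"
      by (rule l2_bounded_reindex[OF assms(1)]) (auto simp: inj_def)
    ultimately show "(\<Sum>r\<in>Y. f (m - r + k) * h r) \<le> F * H"
      using assms(3) by (intro l2_bounded_CS)
  qed (use assms in \<open>auto simp: l2_bounded_def intro!: l2_bounded_CS\<close>)
  finally show ?thesis by (simp add: mult_ac)
qed

text \<open>Here k is summed too, against a dual sequence d, at the price of two extra weights on
  different factors. For fixed p the sum over the other two indices is a trilinear sum shifted by p;
  the leftover \<open>f p * v p\<close> is then summed in p.\<close>

lemma quadrilinear_first:
  assumes d: "l2_bounded d D" and f: "l2_bounded f F" and g: "l2_bounded g G" and h: "l2_bounded h H"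
    and v: "l2_bounded v V" and w: "l2_bounded w W" and Z: "finite Z"
  shows "(\<Sum>(k, p, r)\<in>Z. d k * f p * g (p + r - k) * h r * v p * w r) \<le> D * F * G * H * V * W"
    and "(\<Sum>(k, p, r)\<in>Z. d k * f p * g (p + r - k) * h r * v p * w (p + r - k)) \<le> D * F * G * H * V * W"
proof -
  note nn = l2_boundedD(1)[OF d] l2_boundedD(1)[OF f] l2_boundedD(1)[OF g] l2_boundedD(1)[OF h]
    l2_boundedD(1)[OF v] l2_boundedD(1)[OF w] l2_boundedD(2)[OF d] l2_boundedD(2)[OF f]
    l2_boundedD(2)[OF g] l2_boundedD(2)[OF h] l2_boundedD(2)[OF v] l2_boundedD(2)[OF w]
  \<comment> \<open>Puts p outermost, followed by k and m = p + r - k. The old r is recovered as k +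
    m - p, the middle index of a trilinear sum shifted by p.\<close>
  define t where "t = (\<lambda>(k :: int, p :: int, r). (p, k, p + r - k))"
  have eq: "k + (p + r - k) - p = r" for k p r :: int by simp
  have inj: "inj_on t Z" by (auto simp: t_def inj_on_def)
  have "(\<Sum>(k, p, r)\<in>Z. d k * f p * g (p + r - k) * h r * v p * w r)
      = (\<Sum>x\<in>t ` Z. (f (fst x) * v (fst x)) *
          (d (fst (snd x)) * h (fst (snd x) + snd (snd x) - fst x) * g (snd (snd x)) * w (fst (snd x) + snd (snd x) - fst x)))"
    by (subst sum.reindex[OF inj], rule sum.cong[OF refl])
      (simp only: t_def prod.case_eq_if fst_conv snd_conv eq mult_ac o_def)
  also have "\<dots> \<le> (F * V) * (D * H * G * W)"
  proof (rule sum_pairs_le')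
    fix p :: int and Y :: "(int \<times> int) set" assume "finite Y"
    from trilinear_middle[OF d h g w this, of p]
    show "(\<Sum>y\<in>Y. d (fst (snd (p, y))) * h (fst (snd (p, y)) + snd (snd (p, y)) - fst (p, y)) *
       g (snd (snd (p, y))) * w (fst (snd (p, y)) + snd (snd (p, y)) - fst (p, y))) \<le> D * H * G * W"
      by (simp add: case_prod_beta)
  next
    fix X :: "int set" assume "finite X"
    then show "(\<Sum>p\<in>X. f p * v p) \<le> F * V" using f v by (rule l2_bounded_CS[rotated 2])
  qed (use Z nn in auto)
  finally show "(\<Sum>(k, p, r)\<in>Z. d k * f p * g (p + r - k) * h r * v p * w r) \<le> D * F * G * H * V * W"
    by (simp add: mult_ac)
  have "(\<Sum>(k, p, r)\<in>Z. d k * f p * g (p + r - k) * h r * v p * w (p + r - k))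
      = (\<Sum>x\<in>t ` Z. (f (fst x) * v (fst x)) *
          (d (fst (snd x)) * h (fst (snd x) + snd (snd x) - fst x) * g (snd (snd x)) * w (snd (snd x))))"
    by (subst sum.reindex[OF inj], rule sum.cong[OF refl])
      (simp only: t_def prod.case_eq_if fst_conv snd_conv eq mult_ac o_def)
  also have "\<dots> \<le> (F * V) * (D * H * G * W)"
  proof (rule sum_pairs_le')
    fix p :: int and Y :: "(int \<times> int) set" assume "finite Y"
    from trilinear_last[OF d h g w this, of p]
    show "(\<Sum>y\<in>Y. d (fst (snd (p, y))) * h (fst (snd (p, y)) + snd (snd (p, y)) - fst (p, y)) *
       g (snd (snd (p, y))) * w (snd (snd (p, y)))) \<le> D * H * G * W"
      by (simp add: case_prod_beta)
  next
    fix X :: "int set" assume "finite X"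
    then show "(\<Sum>p\<in>X. f p * v p) \<le> F * V" using f v by (rule l2_bounded_CS[rotated 2])
  qed (use Z nn in auto)
  finally show "(\<Sum>(k, p, r)\<in>Z. d k * f p * g (p + r - k) * h r * v p * w (p + r - k)) \<le> D * F * G * H * V * W"
    by (simp add: mult_ac)
qed

lemma quadrilinear_last:
  assumes "l2_bounded d D" "l2_bounded f F" "l2_bounded g G" "l2_bounded h H"
    and "l2_bounded v V" "l2_bounded w W" "finite Z"
  shows "(\<Sum>(k, p, r)\<in>Z. d k * f p * g (p + r - k) * h r * v r * w (p + r - k)) \<le> D * F * G * H * V * W"
proof -
  have eq: "r + p - k = p + r - k" for k p r :: int by simp
  have "(\<Sum>(k, p, r)\<in>Z. d k * f p * g (p + r - k) * h r * v r * w (p + r - k))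
    = (\<Sum>(k, p, r)\<in>(\<lambda>(k, p, r). (k, r, p)) ` Z. d k * h p * g (p + r - k) * f r * v p * w (p + r - k))"
    by (subst sum.reindex, force simp: inj_on_def, rule sum.cong[OF refl])
      (simp only: prod.case_eq_if fst_conv snd_conv eq mult_ac o_def)
  also have "\<dots> \<le> D * H * G * F * V * W" by (intro quadrilinear_first(2) assms finite_imageI)
  finally show ?thesis by (simp add: mult_ac)
qed

declare jp_pos [simp] jp_nonneg [simp]

lemma jp_nonzero [simp]: "jp k \<noteq> 0"
  by (metis jp_pos less_irrefl)

section \<open>Balls of H^s on the Fourier side\<close>

definition h_bounded :: "real \<Rightarrow> real \<Rightarrow> (int \<Rightarrow> complex) \<Rightarrow> bool" where
  "h_bounded s R a \<longleftrightarrow> l2_bounded (\<lambda>k. jp k powr s * cmod (a k)) R"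

text \<open>The square of the L2 norm, by \<open>parseval\<close>; the growth rate of a mode is
  proportional to it.\<close>

definition mass :: "(int \<Rightarrow> complex) \<Rightarrow> real" where
  "mass a = (\<Sum>\<^sub>\<infinity>k. (cmod (a k))\<^sup>2)"

lemma jp_powr_mono: "s \<le> s' \<Longrightarrow> jp k powr s \<le> jp k powr s'"
  using jp_ge1[of k] by (intro powr_mono)

lemma h_bounded_mono: "h_bounded s' R a \<Longrightarrow> s \<le> s' \<Longrightarrow> h_bounded s R a"
  unfolding h_bounded_def by (erule l2_bounded_mono) (auto intro!: mult_right_mono jp_powr_mono)

lemma h_bounded_nonneg: "h_bounded s R a \<Longrightarrow> 0 \<le> R"
  by (simp add: h_bounded_def l2_bounded_def)

lemma h_bounded_coeff: "h_bounded s R a \<Longrightarrow> 0 \<le> s \<Longrightarrow> cmod (a k) \<le> R"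
  using h_bounded_mono[of s R a 0] l2_bounded_le[of "\<lambda>k. jp k powr 0 * cmod (a k)" R k]
  by (simp add: h_bounded_def)

lemma h_bounded_l2: "h_bounded s R a \<Longrightarrow> 0 \<le> s \<Longrightarrow> l2_bounded (\<lambda>k. cmod (a k)) R"
  using h_bounded_mono[of s R a 0] by (simp add: h_bounded_def)

lemma h_bounded_deriv: "h_bounded s R a \<Longrightarrow> h_bounded (s - 1) R (\<lambda>k. of_real (jp k) * a k)"
  unfolding h_bounded_def by (simp add: norm_mult powr_diff)

lemma l2_bounded_summable:
  assumes "l2_bounded f F"
  shows "(\<lambda>k. (f k)\<^sup>2) summable_on A" "(\<Sum>\<^sub>\<infinity>k\<in>A. (f k)\<^sup>2) \<le> F\<^sup>2"
proof -
  show *: "(\<lambda>k. (f k)\<^sup>2) summable_on A"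
    using assms by (intro nonneg_bdd_above_summable_on bdd_aboveI[of _ "F\<^sup>2"]) (auto simp: l2_bounded_def)
  show "(\<Sum>\<^sub>\<infinity>k\<in>A. (f k)\<^sup>2) \<le> F\<^sup>2"
    using assms by (intro infsum_le_finite_sums[OF *]) (auto simp: l2_bounded_def)
qed

lemma h_bounded_mass:
  assumes "h_bounded s R a" "0 \<le> s"
  shows "(\<lambda>k. (cmod (a k))\<^sup>2) summable_on A" "(\<Sum>\<^sub>\<infinity>k\<in>A. (cmod (a k))\<^sup>2) \<le> R\<^sup>2"
  using l2_bounded_summable[OF h_bounded_l2[OF assms]] by auto

lemma abs_summable_bounded:
  fixes f :: "'a \<Rightarrow> 'b :: banach"
  assumes "\<And>S. finite S \<Longrightarrow> S \<subseteq> A \<Longrightarrow> (\<Sum>x\<in>S. norm (f x)) \<le> B"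
  shows "(\<lambda>x. norm (f x)) summable_on A" "f summable_on A" "norm (infsum f A) \<le> B"
proof -
  show *: "(\<lambda>x. norm (f x)) summable_on A"
    using assms by (intro nonneg_bdd_above_summable_on bdd_aboveI[of _ B]) auto
  then show "f summable_on A" by (rule abs_summable_summable)
  have "norm (infsum f A) \<le> (\<Sum>\<^sub>\<infinity>x\<in>A. norm (f x))" using * by (rule norm_infsum_bound)
  also have "\<dots> \<le> B" using assms by (intro infsum_le_finite_sums[OF *]) auto
  finally show "norm (infsum f A) \<le> B" .
qed

section \<open>A growing linear equation and two scalar estimates\<close>

text \<open>For Y = |c|^2 the equation gives Y' \<ge> l Y - H^2/l, so exp(-l t) (Y - (H/l)^2)
  increases. Comparing the ends of the interval controls the initial value: a solution that is still
  bounded at time \<tau> must have started with size about H/l.\<close>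

lemma exp_growth_backward:
  fixes c :: "real \<Rightarrow> complex"
  assumes \<tau>: "0 < \<tau>" and l: "0 < l"
    and der: "\<And>t. t \<in> {0..\<tau>} \<Longrightarrow> (c has_vector_derivative (g t * c t + h t)) (at t within {0..\<tau>})"
    and g: "\<And>t. t \<in> {0..\<tau>} \<Longrightarrow> l \<le> Re (g t)" and h: "\<And>t. t \<in> {0..\<tau>} \<Longrightarrow> cmod (h t) \<le> H"
  shows "(cmod (c 0))\<^sup>2 \<le> (H / l)\<^sup>2 + exp (- l * \<tau>) * (cmod (c \<tau>))\<^sup>2"
proof -
  define Y where "Y = (\<lambda>t. (cmod (c t))\<^sup>2)"
  define Z where "Z = (\<lambda>t. exp (- l * t) * (Y t - (H / l)\<^sup>2))"
  define Y' where "Y' = (\<lambda>t. 2 * (c t \<bullet> (g t * c t + h t)))"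
  have Yd: "(Y has_real_derivative Y' t) (at t within {0..\<tau>})" if t: "t \<in> {0..\<tau>}" for t
  proof -
    have "((\<lambda>t. c t \<bullet> c t) has_derivative (\<lambda>x. c t \<bullet> (x *\<^sub>R (g t * c t + h t)) + (x *\<^sub>R (g t * c t + h t)) \<bullet> c t)) (at t within {0..\<tau>})"
      using der[OF t] unfolding has_vector_derivative_def by (intro has_derivative_inner)
    then show ?thesis
      unfolding Y_def Y'_def has_field_derivative_def power2_norm_eq_inner
      by (rule has_derivative_eq_rhs) (auto simp: fun_eq_iff inner_commute)
  qed
  have Y': "l * Y t - H\<^sup>2 / l \<le> Y' t" if t: "t \<in> {0..\<tau>}" for t
  proof -
    have "c t \<bullet> (g t * c t + h t) = Re (g t) * Y t + c t \<bullet> h t"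
      unfolding Y_def cmod_power2 by (simp add: inner_complex_def algebra_simps power2_eq_square)
    moreover have "l * Y t \<le> Re (g t) * Y t" using g[OF t] by (intro mult_right_mono) (auto simp: Y_def)
    moreover have "- (cmod (c t) * H) \<le> c t \<bullet> h t"
    proof -
      have "\<bar>c t \<bullet> h t\<bar> \<le> cmod (c t) * cmod (h t)" by (rule Cauchy_Schwarz_ineq2)
      also have "\<dots> \<le> cmod (c t) * H" using h[OF t] by (intro mult_left_mono) auto
      finally show ?thesis by linarith
    qed
    \<comment> \<open>Young's inequality: half of the growth 2 l Y pays for the forcing.\<close>
    moreover have "2 * (cmod (c t) * H) \<le> l * Y t + H\<^sup>2 / l"
    proof -
      have "0 \<le> (l * cmod (c t) - H)\<^sup>2 / l" using l by simp
      also have "\<dots> = l * Y t + H\<^sup>2 / l - 2 * (cmod (c t) * H)"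
        using l by (simp add: Y_def power2_eq_square field_simps)
      finally show ?thesis by simp
    qed
    ultimately show ?thesis unfolding Y'_def by linarith
  qed
  have Zd: "(Z has_real_derivative exp (- l * t) * (Y' t - l * (Y t - (H / l)\<^sup>2))) (at t within {0..\<tau>})"
    if t: "t \<in> {0..\<tau>}" for t
    unfolding Z_def
    by (auto intro!: derivative_eq_intros Yd[OF t] simp: algebra_simps)
  have "Z 0 \<le> Z \<tau>"
  proof (rule DERIV_nonneg_imp_increasing_open[of 0 \<tau> Z])
    show "0 \<le> \<tau>" using \<tau> by simp
    show "continuous_on {0..\<tau>} Z"
      by (rule DERIV_continuous_on[OF Zd])
  next
    fix t :: real assume t: "0 < t" "t < \<tau>"
    have "(Z has_real_derivative exp (- l * t) * (Y' t - l * (Y t - (H / l)\<^sup>2))) (at t)"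
      using Zd[of t] t by (simp add: at_within_Icc_at)
    moreover have "0 \<le> exp (- l * t) * (Y' t - l * (Y t - (H / l)\<^sup>2))"
    proof -
      have "l * (Y t - (H / l)\<^sup>2) = l * Y t - H\<^sup>2 / l" using l by (simp add: field_simps power2_eq_square)
      then show ?thesis using Y'[of t] t by simp
    qed
    ultimately show "\<exists>y. (Z has_real_derivative y) (at t) \<and> 0 \<le> y" by blast
  qed
  then have "Y 0 - (H / l)\<^sup>2 \<le> exp (- l * \<tau>) * (Y \<tau> - (H / l)\<^sup>2)" by (simp add: Z_def)
  also have "\<dots> \<le> exp (- l * \<tau>) * Y \<tau>" by (intro mult_left_mono) auto
  finally show ?thesis by (simp add: Y_def)
qed

text \<open>From exp x \<ge> (1 + x/n)^n \<ge> (x/n)^n with n above the exponent b. It makes the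
  end-time term of \<open>exp_growth_backward\<close> smaller than every power of the
  frequency.\<close>

lemma powr_times_exp_bounded:
  fixes b \<kappa> :: real
  assumes "0 < \<kappa>"
  shows "\<exists>C\<ge>0. \<forall>y\<ge>1. y powr b * exp (- \<kappa> * y) \<le> C"
proof -
  define n where "n = Suc (nat \<lceil>b\<rceil>)"
  have "y powr b * exp (- \<kappa> * y) \<le> (real n / \<kappa>) ^ n" if y: "1 \<le> y" for y
  proof -
    have "y powr b \<le> y powr real n" using y by (intro powr_mono) (auto simp: n_def, linarith)
    also have "\<dots> = y ^ n" using y by (simp add: powr_realpow)
    finally have 1: "y powr b \<le> y ^ n" .
    have "(\<kappa> * y / real n) ^ n \<le> (1 + \<kappa> * y / real n) ^ n"
      using assms y by (intro power_mono) auto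
    also have "\<dots> \<le> exp (\<kappa> * y)"
      using assms y by (intro exp_ge_one_plus_x_over_n_power_n)
        (auto simp: n_def, smt (verit) mult_nonneg_nonneg of_nat_0_le_iff)
    finally have 2: "(\<kappa> * y / real n) ^ n \<le> exp (\<kappa> * y)" .
    have "y ^ n = (real n / \<kappa>) ^ n * (\<kappa> * y / real n) ^ n"
      using assms by (simp add: power_mult_distrib[symmetric] n_def)
    also have "\<dots> \<le> (real n / \<kappa>) ^ n * exp (\<kappa> * y)"
      using 2 assms by (intro mult_left_mono) auto
    finally have "y powr b \<le> (real n / \<kappa>) ^ n * exp (\<kappa> * y)" using 1 by simp
    then have "y powr b * exp (- \<kappa> * y) \<le> (real n / \<kappa>) ^ n * exp (\<kappa> * y) * exp (- \<kappa> * y)"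
      by (intro mult_right_mono) auto
    then show ?thesis by (simp add: mult.assoc exp_add[symmetric])
  qed
  moreover have "0 \<le> (real n / \<kappa>) ^ n" using assms by simp
  ultimately show ?thesis by blast
qed

text \<open>Quantitative nonresonance: q keeps a positive distance d from the integers, which
  handles small j, while |j + q| grows like |j| for large j. The third factor of the phase thereby
  yields a full weight \<open>jp (p + r)\<close>.\<close>

lemma int_shift_lower_bound:
  fixes q :: real
  assumes "q \<notin> \<int>"
  shows "\<exists>c>0. \<forall>j :: int. c * jp j \<le> \<bar>of_int j + q\<bar>"
proof -
  define d where "d = min (frac q) (1 - frac q)"
  have d: "0 < d" using assms frac_lt_1[of q] by (auto simp: d_def frac_gt_0_iff)
  have low: "d \<le> \<bar>of_int j + q\<bar>" for j :: int
  proof -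
    have "of_int j + q = of_int (j + \<lfloor>q\<rfloor>) + frac q" by (simp add: frac_def)
    moreover have "j + \<lfloor>q\<rfloor> \<ge> 0 \<or> j + \<lfloor>q\<rfloor> \<le> -1" by linarith
    then have "of_int (j + \<lfloor>q\<rfloor>) \<ge> (0 :: real) \<or> of_int (j + \<lfloor>q\<rfloor>) \<le> (-1 :: real)"
      by (metis of_int_0_le_iff of_int_le_iff of_int_minus of_int_1)
    moreover have "0 \<le> frac q" "frac q < 1" by (auto simp: frac_lt_1)
    ultimately show ?thesis unfolding d_def by linarith
  qed
  \<comment> \<open>From jp j \<le> (1 + |q|) + |j + q| and 1 + |q| \<le> ((1 + |q|)/d) |j +
    q|.\<close>
  define c where "c = 1 / ((1 + \<bar>q\<bar>) / d + 1)"
  have den: "0 < (1 + \<bar>q\<bar>) / d + 1" using d by (intro add_nonneg_pos) auto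
  have "c * jp j \<le> \<bar>of_int j + q\<bar>" for j
  proof -
    have "jp j \<le> (1 + \<bar>q\<bar>) + \<bar>of_int j + q\<bar>" by (simp add: jp_def)
    also have "1 + \<bar>q\<bar> = (1 + \<bar>q\<bar>) / d * d" using d by simp
    also have "\<dots> \<le> (1 + \<bar>q\<bar>) / d * \<bar>of_int j + q\<bar>"
      using d low by (intro mult_left_mono) auto
    finally have "jp j \<le> ((1 + \<bar>q\<bar>) / d + 1) * \<bar>of_int j + q\<bar>" by (simp add: algebra_simps)
    then show ?thesis using den by (simp add: c_def field_simps)
  qed
  moreover have "0 < c" using den by (simp add: c_def)
  ultimately show ?thesis by blast
qed

section \<open>The equation for the Fourier coefficients\<close>

text \<open>If \<open>a k\<close> are the Fourier coefficients of \<open>u\<close>, then \<open>\<bar>u\<bar>\<^sup>2 u\<close> has the coefficients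
  \<open>(\<Sum>p r. a p * cnj (a (p + r - k)) * a r) / (2 * pi)\<close>, and in \<open>u * \<partial>x (\<bar>u\<bar>\<^sup>2)\<close> each summand
  carries in addition the frequency \<open>k - r\<close> of the factor \<open>\<bar>u\<bar>\<^sup>2\<close>. Hence the symbol \<open>mu\<close>, whose real part
  comes from the Raman term alone, and the dispersion relation \<open>om\<close>.\<close>

locale raman =
  fixes \<alpha>\<^sub>1 \<alpha>\<^sub>2 \<gamma>\<^sub>1 \<gamma>\<^sub>2 \<Gamma> :: real
  assumes Gamma_pos: "0 < \<Gamma>" and alpha_nonzero: "\<alpha>\<^sub>1 \<noteq> 0"
    and nonresonant: "2 * \<alpha>\<^sub>2 / (3 * \<alpha>\<^sub>1) \<notin> \<int>"
begin

definition om :: "int \<Rightarrow> real" where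
  "om k = - (\<alpha>\<^sub>1 * of_int k ^ 3 + \<alpha>\<^sub>2 * of_int k ^ 2)"

definition mu :: "int \<Rightarrow> int \<Rightarrow> complex" where
  "mu k r = Complex (\<Gamma> * of_int (k - r) / (2 * pi)) ((\<gamma>\<^sub>1 + \<gamma>\<^sub>2 * of_int k) / (2 * pi))"

definition nlt :: "(int \<Rightarrow> complex) \<Rightarrow> int \<Rightarrow> int \<times> int \<Rightarrow> complex" where
  "nlt a k = (\<lambda>(p, r). mu k r * (a p * cnj (a (p + r - k)) * a r))"

definition nl :: "(int \<Rightarrow> complex) \<Rightarrow> int \<Rightarrow> complex" where
  "nl a k = infsum (nlt a k) UNIV"

text \<open>Differentiability is required coefficient by coefficient, one-sided at the end points of
  I; bounds in H^s are always stated separately.\<close>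

definition fsol :: "real set \<Rightarrow> (real \<Rightarrow> int \<Rightarrow> complex) \<Rightarrow> bool" where
  "fsol I a \<longleftrightarrow> (\<forall>t\<in>I. \<forall>k. ((\<lambda>t. a t k) has_vector_derivative
     (\<i> * of_real (om k) * a t k + nl (a t) k)) (at t within I))"

definition C0 :: real where "C0 = \<Gamma> + \<bar>\<gamma>\<^sub>1\<bar> + \<bar>\<gamma>\<^sub>2\<bar>"

lemma C0_nonneg: "0 \<le> C0"
  using Gamma_pos by (simp add: C0_def)

lemma mu_bound: "cmod (mu k r) \<le> C0 * (jp k + jp (k - r))"
proof -
  have "cmod (mu k r) \<le> \<bar>\<Gamma> * of_int (k - r) / (2 * pi)\<bar> + \<bar>(\<gamma>\<^sub>1 + \<gamma>\<^sub>2 * of_int k) / (2 * pi)\<bar>"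
    using cmod_le[of "mu k r"] by (simp add: mu_def)
  also have "\<dots> \<le> \<bar>\<Gamma> * of_int (k - r)\<bar> + \<bar>\<gamma>\<^sub>1 + \<gamma>\<^sub>2 * of_int k\<bar>"
  proof -
    have *: "\<bar>x / (2 * pi)\<bar> \<le> \<bar>x\<bar>" for x
    proof -
      have "\<bar>x\<bar> * 1 \<le> \<bar>x\<bar> * (2 * pi)" using pi_ge_two by (intro mult_left_mono) auto
      then show ?thesis by (simp add: abs_divide divide_le_eq abs_mult)
    qed
    show ?thesis by (intro add_mono *)
  qed
  also have "\<bar>\<Gamma> * of_int (k - r)\<bar> \<le> C0 * jp (k - r)"
    unfolding abs_mult using Gamma_pos by (intro mult_mono) (auto simp: C0_def jp_def)
  also have "\<bar>\<gamma>\<^sub>1 + \<gamma>\<^sub>2 * of_int k\<bar> \<le> \<bar>\<gamma>\<^sub>1\<bar> * jp k + \<bar>\<gamma>\<^sub>2\<bar> * jp k"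
  proof -
    have "\<bar>\<gamma>\<^sub>1 + \<gamma>\<^sub>2 * of_int k\<bar> \<le> \<bar>\<gamma>\<^sub>1\<bar> * 1 + \<bar>\<gamma>\<^sub>2\<bar> * \<bar>of_int k\<bar>"
      by (simp add: abs_mult[symmetric])
    also have "\<dots> \<le> \<bar>\<gamma>\<^sub>1\<bar> * jp k + \<bar>\<gamma>\<^sub>2\<bar> * jp k"
      by (intro add_mono mult_left_mono) (auto simp: jp_def)
    finally show ?thesis .
  qed
  also have "\<bar>\<gamma>\<^sub>1\<bar> * jp k + \<bar>\<gamma>\<^sub>2\<bar> * jp k \<le> C0 * jp k"
    using Gamma_pos jp_nonneg[of k] unfolding distrib_right[symmetric]
    by (intro mult_right_mono) (auto simp: C0_def)
  finally show ?thesis by (simp add: algebra_simps)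
qed

lemma mu_bound_sum: "cmod (mu k r) \<le> 2 * C0 * (jp p + jp (p + r - k) + jp r)"
proof -
  have "jp k \<le> jp p + jp (p + r - k) + jp r" by (rule jp_triple_sum)
  moreover have "jp (k - r) \<le> jp p + jp (p + r - k) + jp r"
  proof -
    have "p - (p + r - k) = k - r" by simp
    then have "jp (k - r) \<le> jp p + jp (p + r - k)" using jp_diff[of p "p + r - k"] by (simp only:)
    also have "\<dots> \<le> jp p + jp (p + r - k) + jp r" by simp
    finally show ?thesis .
  qed
  ultimately have "jp k + jp (k - r) \<le> 2 * (jp p + jp (p + r - k) + jp r)"
    unfolding mult_2 by (rule add_mono)
  then have "C0 * (jp k + jp (k - r)) \<le> C0 * (2 * (jp p + jp (p + r - k) + jp r))"
    using C0_nonneg by (rule mult_left_mono)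
  with mu_bound[of k r] show ?thesis by (simp only: mult_ac)
qed

text \<open>The weight s - 1 is distributed over the three factors by \<open>jp_triple\<close>, and
  the one derivative in \<open>mu\<close> falls on one of them. That factor then carries its full
  weight s, while the other two have a power -1 to spare, which makes the sums converge.\<close>

lemma nlt_bound:
  assumes "1 \<le> s"
  defines "A \<equiv> \<lambda>a k. jp k powr s * cmod (a k)"
  shows "jp k powr (s - 1) * cmod (nlt a k (p, r)) \<le> 2 * C0 * (A a p * A a (p + r - k) * A a r *
    (1 / (jp (p + r - k) * jp r) + 1 / (jp p * jp r) + 1 / (jp p * jp (p + r - k))))"
proof -
  define m where "m = p + r - k"
  have s: "x powr s = x powr (s - 1) * x" if "0 < x" for x :: real
    using that by (simp add: powr_diff)
  have 1: "jp k powr (s - 1) \<le> (jp p * jp m * jp r) powr (s - 1)"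
    using assms jp_triple[of k p r] jp_nonneg[of k] unfolding m_def by (intro powr_mono2) auto
  have "jp k powr (s - 1) * cmod (nlt a k (p, r))
      = jp k powr (s - 1) * (cmod (mu k r) * (cmod (a p) * cmod (a m) * cmod (a r)))"
    by (simp add: nlt_def norm_mult m_def)
  also have "\<dots> \<le> (jp p * jp m * jp r) powr (s - 1) *
      (2 * C0 * (jp p + jp m + jp r) * (cmod (a p) * cmod (a m) * cmod (a r)))"
    using 1 mu_bound_sum[of k r p] by (intro mult_mono mult_nonneg_nonneg) (auto simp: m_def C0_nonneg)
  also have "\<dots> = 2 * C0 * (A a p * A a m * A a r *
    (1 / (jp m * jp r) + 1 / (jp p * jp r) + 1 / (jp p * jp m)))"
    using jp_pos[of p] jp_pos[of m] jp_pos[of r]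
    unfolding A_def by (simp add: s powr_mult less_imp_le) (simp add: field_simps)
  finally show ?thesis by (simp add: m_def)
qed


lemma trilinear_pair_weights:
  assumes f: "l2_bounded f F" and S: "finite S"
  shows "(\<Sum>(p, r)\<in>S. f p * f (p + r - k) * f r *
    (1 / jp p + 1 / jp (p + r - k) + 1 / jp r)) \<le> 9 * F ^ 3"
proof -
  note b = f f f l2_bounded_inverse_jp S
  have "(\<Sum>(p, r)\<in>S. f p * f (p + r - k) * f r * (1 / jp p + 1 / jp (p + r - k) + 1 / jp r))
    = (\<Sum>(p, r)\<in>S. f p * f (p + r - k) * f r * (1 / jp p))
    + (\<Sum>(p, r)\<in>S. f p * f (p + r - k) * f r * (1 / jp (p + r - k)))
    + (\<Sum>(p, r)\<in>S. f p * f (p + r - k) * f r * (1 / jp r))"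
    by (simp only: split_def distrib_left sum.distrib)
  also have "\<dots> \<le> F * F * F * 3 + F * F * F * 3 + F * F * F * 3"
    by (intro add_mono trilinear_first[OF b] trilinear_middle[OF b] trilinear_last[OF b])
  finally show ?thesis by (simp add: power3_eq_cube)
qed

text \<open>For fixed k a single inverse weight makes the double sum converge, so one of the two in
  \<open>nlt_bound\<close> is given away here; the tail bound below turns it into smallness.\<close>

lemma nlt_sum_bound:
  assumes "h_bounded 1 R a" "finite S"
  shows "(\<Sum>x\<in>S. cmod (nlt a k x)) \<le> 18 * C0 * R ^ 3"
proof -
  define A where "A = (\<lambda>k. jp k * cmod (a k))"
  have A: "l2_bounded A R" using assms(1) by (simp add: h_bounded_def A_def)
  have "cmod (nlt a k (p, r)) \<le> 2 * C0 * (A p * A (p + r - k) * A r *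
      (1 / jp p + 1 / jp (p + r - k) + 1 / jp r))" for p r
  proof -
    have le: "1 / (jp i * jp j) \<le> 1 / jp j" for i j
      using jp_ge1[of i] by (simp add: divide_simps)
    have "cmod (nlt a k (p, r)) \<le> 2 * C0 * (A p * A (p + r - k) * A r *
        (1 / (jp (p + r - k) * jp r) + 1 / (jp p * jp r) + 1 / (jp p * jp (p + r - k))))"
      using nlt_bound[of 1 k a p r] by (simp add: A_def)
    also have "\<dots> = 2 * C0 * (A p * A (p + r - k) * A r *
        (1 / (jp r * jp p) + 1 / (jp p * jp (p + r - k)) + 1 / (jp (p + r - k) * jp r)))"
      by (simp add: mult.commute add.commute add.left_commute)
    also have "\<dots> \<le> 2 * C0 * (A p * A (p + r - k) * A r * (1 / jp p + 1 / jp (p + r - k) + 1 / jp r))"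
      using C0_nonneg by (intro mult_left_mono add_mono le) (auto simp: A_def)
    finally show ?thesis .
  qed
  then have "(\<Sum>x\<in>S. cmod (nlt a k x)) \<le> (\<Sum>(p, r)\<in>S. 2 * C0 * (A p * A (p + r - k) * A r *
      (1 / jp p + 1 / jp (p + r - k) + 1 / jp r)))"
    by (intro sum_mono) (auto simp: case_prod_beta)
  also have "\<dots> = 2 * C0 * (\<Sum>(p, r)\<in>S. A p * A (p + r - k) * A r *
      (1 / jp p + 1 / jp (p + r - k) + 1 / jp r))"
    by (simp add: sum_distrib_left case_prod_beta)
  also have "\<dots> \<le> 2 * C0 * (9 * R ^ 3)"
    using C0_nonneg by (intro mult_left_mono trilinear_pair_weights A assms) auto
  finally show ?thesis by simp
qed

text \<open>Since p + r = (p + r - k) + k, a frequency beyond 2 L + |k| forces a second one beyond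
  L. Hence every pair among the three contains a large one, and the product of two inverse weights
  in \<open>nlt_bound\<close> yields 1/L. The bound is uniform on the ball, so one finite truncation
  serves all sequences and all times.\<close>

lemma nlt_tail_bound:
  assumes "h_bounded 1 R a" "finite S" and L: "0 < L" "2 * L + \<bar>of_int k\<bar> \<le> K"
    and S: "\<And>p r. (p, r) \<in> S \<Longrightarrow> K < \<bar>of_int p\<bar> \<or> K < \<bar>of_int r\<bar>"
  shows "(\<Sum>x\<in>S. cmod (nlt a k x)) \<le> 36 * C0 * R ^ 3 / L"
proof -
  define A where "A = (\<lambda>k. jp k * cmod (a k))"
  have A: "l2_bounded A R" using assms(1) by (simp add: h_bounded_def A_def)
  have "cmod (nlt a k (p, r)) \<le> 4 * C0 / L * (A p * A (p + r - k) * A r *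
      (1 / jp p + 1 / jp (p + r - k) + 1 / jp r))" if x: "(p, r) \<in> S" for p r
  proof -
    define m where "m = p + r - k"
    have m: "of_int p + of_int r = of_int m + (of_int k :: real)" by (simp add: m_def)
    have large: "L \<le> jp m \<or> L \<le> jp r" "L \<le> jp p \<or> L \<le> jp r" "L \<le> jp p \<or> L \<le> jp m"
      using S[OF x] m L by (auto simp: jp_def)
    have le: "1 / (jp i * jp j) \<le> 1 / L * (1 / jp i + 1 / jp j)" if "L \<le> jp i \<or> L \<le> jp j" for i j
    proof -
      have "L \<le> jp j + jp i" using that jp_nonneg[of i] jp_nonneg[of j] by linarith
      then show ?thesis using L by (simp add: divide_simps)
    qed
    have "cmod (nlt a k (p, r)) \<le> 2 * C0 * (A p * A m * A r *
        (1 / (jp m * jp r) + 1 / (jp p * jp r) + 1 / (jp p * jp m)))"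
      using nlt_bound[of 1 k a p r] by (simp add: A_def m_def)
    also have "\<dots> \<le> 2 * C0 * (A p * A m * A r *
        (1 / L * (1 / jp m + 1 / jp r) + 1 / L * (1 / jp p + 1 / jp r) + 1 / L * (1 / jp p + 1 / jp m)))"
      using C0_nonneg large by (intro mult_left_mono add_mono le) (auto simp: A_def)
    also have "\<dots> = 4 * C0 / L * (A p * A m * A r * (1 / jp p + 1 / jp m + 1 / jp r))"
      by (simp add: algebra_simps)
    finally show ?thesis by (simp add: m_def)
  qed
  then have "(\<Sum>x\<in>S. cmod (nlt a k x)) \<le> (\<Sum>(p, r)\<in>S. 4 * C0 / L * (A p * A (p + r - k) * A r *
      (1 / jp p + 1 / jp (p + r - k) + 1 / jp r)))"
    by (intro sum_mono) (auto simp: case_prod_beta)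
  also have "\<dots> = 4 * C0 / L * (\<Sum>(p, r)\<in>S. A p * A (p + r - k) * A r *
      (1 / jp p + 1 / jp (p + r - k) + 1 / jp r))"
    by (simp add: sum_distrib_left case_prod_beta)
  also have "\<dots> \<le> 4 * C0 / L * (9 * R ^ 3)"
    using C0_nonneg L by (intro mult_left_mono trilinear_pair_weights A assms) auto
  finally show ?thesis by simp
qed

lemma nlt_summable:
  assumes "h_bounded 1 R a"
  shows "nlt a k summable_on A" "(\<lambda>x. cmod (nlt a k x)) summable_on A"
  using abs_summable_bounded[of A "nlt a k" "18 * C0 * R ^ 3"] nlt_sum_bound[OF assms] by auto

lemma nl_bound: "h_bounded 1 R a \<Longrightarrow> cmod (nl a k) \<le> 18 * C0 * R ^ 3"
  unfolding nl_def by (rule abs_summable_bounded(3)) (auto intro: nlt_sum_bound)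

text \<open>Duality, first for finitely many k and finitely many interactions, then with a limit in
  the interactions. The constant 54 is the 2 of \<open>nlt_bound\<close> times three terms times 3 *
  3 for two inverse weights.\<close>

lemma nl_l2:
  assumes s: "1 \<le> s" and a: "h_bounded s R a"
  shows "h_bounded (s - 1) (54 * C0 * R ^ 3) (nl a)"
proof -
  define A where "A = (\<lambda>k. jp k powr s * cmod (a k))"
  have A: "l2_bounded A R" using a by (simp add: h_bounded_def A_def)
  define M where "M = 54 * C0 * R ^ 3"
  have R: "0 \<le> R" using a by (rule h_bounded_nonneg)
  have M: "0 \<le> M" using R C0_nonneg by (simp add: M_def)
  define D where "D = (\<lambda>S k. jp k powr (s - 1) * (\<Sum>x\<in>S. cmod (nlt a k x)))"
  have D0: "0 \<le> D S k" for S k by (auto simp: D_def intro!: mult_nonneg_nonneg sum_nonneg)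
  have fin: "(\<Sum>k\<in>X. (D S k)\<^sup>2) \<le> M\<^sup>2" if X: "finite X" and S: "finite S" for X S
  proof -
    define Q where "Q = (\<Sum>k\<in>X. (D S k)\<^sup>2)"
    have Q0: "0 \<le> Q" by (auto simp: Q_def intro: sum_nonneg)
    \<comment> \<open>The dual sequence is \<open>D S\<close> itself, cut off to X. The multilinear
      bound then reads Q \<le> sqrt Q * M, that is, sqrt Q \<le> M.\<close>
    define d where "d = (\<lambda>k. if k \<in> X then D S k else 0)"
    have d: "l2_bounded d (sqrt Q)"
      unfolding l2_bounded_def
    proof (intro conjI allI impI)
      fix Y :: "int set" assume Y: "finite Y"
      have "(\<Sum>k\<in>Y. (d k)\<^sup>2) = (\<Sum>k\<in>Y \<inter> X. (D S k)\<^sup>2)"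
        using Y by (subst sum.inter_restrict) (auto simp: d_def intro!: sum.cong)
      also have "\<dots> \<le> Q" unfolding Q_def using X by (intro sum_mono2) auto
      finally show "(\<Sum>k\<in>Y. (d k)\<^sup>2) \<le> (sqrt Q)\<^sup>2" using Q0 by simp
    qed (auto simp: d_def D0 Q0)
    note b = d A A A l2_bounded_inverse_jp l2_bounded_inverse_jp finite_cartesian_product[OF X S]
    have "Q = (\<Sum>(k, x)\<in>X \<times> S. d k * (jp k powr (s - 1) * cmod (nlt a k x)))"
      unfolding Q_def sum.cartesian_product[symmetric] power2_eq_square
      by (intro sum.cong refl) (auto simp: d_def D_def sum_distrib_left mult.assoc)
    also have "\<dots> \<le> (\<Sum>(k, p, r)\<in>X \<times> S. 2 * C0 *
       (d k * A p * A (p + r - k) * A r * (1 / jp r) * (1 / jp (p + r - k))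
      + d k * A p * A (p + r - k) * A r * (1 / jp p) * (1 / jp r)
      + d k * A p * A (p + r - k) * A r * (1 / jp p) * (1 / jp (p + r - k))))"
    proof (intro sum_mono, clarify)
      fix k p r assume "k \<in> X" "(p, r) \<in> S"
      have "d k * (jp k powr (s - 1) * cmod (nlt a k (p, r)))
        \<le> d k * (2 * C0 * (A p * A (p + r - k) * A r *
        (1 / (jp (p + r - k) * jp r) + 1 / (jp p * jp r) + 1 / (jp p * jp (p + r - k)))))"
        using nlt_bound[OF s, of k a p r] l2_boundedD(1)[OF d, of k]
        by (intro mult_left_mono) (auto simp: A_def)
      also have "\<dots> = 2 * C0 *
       (d k * A p * A (p + r - k) * A r * (1 / jp r) * (1 / jp (p + r - k))
      + d k * A p * A (p + r - k) * A r * (1 / jp p) * (1 / jp r)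
      + d k * A p * A (p + r - k) * A r * (1 / jp p) * (1 / jp (p + r - k)))"
        by (simp add: algebra_simps)
      finally show "d k * (jp k powr (s - 1) * cmod (nlt a k (p, r))) \<le> 2 * C0 *
       (d k * A p * A (p + r - k) * A r * (1 / jp r) * (1 / jp (p + r - k))
      + d k * A p * A (p + r - k) * A r * (1 / jp p) * (1 / jp r)
      + d k * A p * A (p + r - k) * A r * (1 / jp p) * (1 / jp (p + r - k)))" .
    qed
    also have "\<dots> = 2 * C0 *
       ((\<Sum>(k, p, r)\<in>X \<times> S. d k * A p * A (p + r - k) * A r * (1 / jp r) * (1 / jp (p + r - k)))
      + (\<Sum>(k, p, r)\<in>X \<times> S. d k * A p * A (p + r - k) * A r * (1 / jp p) * (1 / jp r))
      + (\<Sum>(k, p, r)\<in>X \<times> S. d k * A p * A (p + r - k) * A r * (1 / jp p) * (1 / jp (p + r - k))))"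
      by (simp only: split_def sum.distrib sum_distrib_left[symmetric])
    also have "\<dots> \<le> 2 * C0 * (sqrt Q * R * R * R * 3 * 3 + sqrt Q * R * R * R * 3 * 3 + sqrt Q * R * R * R * 3 * 3)"
      using C0_nonneg
      by (intro mult_left_mono add_mono quadrilinear_first[OF b] quadrilinear_last[OF b]) auto
    also have "\<dots> = sqrt Q * M" by (simp add: M_def power3_eq_cube)
    finally have "sqrt Q * sqrt Q \<le> sqrt Q * M" using Q0 by simp
    then have "sqrt Q \<le> M" using Q0 M
      by (cases "Q = 0") (auto simp del: real_sqrt_mult_self)
    then have "(sqrt Q)\<^sup>2 \<le> M\<^sup>2" using Q0 by (intro power_mono) auto
    then show ?thesis using Q0 by (simp add: Q_def)
  qed
  show ?thesis
    unfolding h_bounded_def l2_bounded_def M_def[symmetric]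
  proof (intro conjI allI impI)
    fix X :: "int set" assume X: "finite X"
    have a1: "h_bounded 1 R a" using a s by (rule h_bounded_mono)
    have "((\<lambda>S. \<Sum>k\<in>X. (D S k)\<^sup>2) \<longlongrightarrow>
        (\<Sum>k\<in>X. (jp k powr (s - 1) * (\<Sum>\<^sub>\<infinity>x. cmod (nlt a k x)))\<^sup>2)) (finite_subsets_at_top UNIV)"
      unfolding D_def
      by (intro tendsto_intros infsum_tendsto nlt_summable(2)[OF a1])
    moreover have "\<forall>\<^sub>F S in finite_subsets_at_top UNIV. (\<Sum>k\<in>X. (D S k)\<^sup>2) \<le> M\<^sup>2"
      by (rule eventually_finite_subsets_at_top_weakI) (auto intro: fin X)
    ultimately have le: "(\<Sum>k\<in>X. (jp k powr (s - 1) * (\<Sum>\<^sub>\<infinity>x. cmod (nlt a k x)))\<^sup>2) \<le> M\<^sup>2"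
      by (rule tendsto_upperbound) auto
    have "(\<Sum>k\<in>X. (jp k powr (s - 1) * cmod (nl a k))\<^sup>2)
        \<le> (\<Sum>k\<in>X. (jp k powr (s - 1) * (\<Sum>\<^sub>\<infinity>x. cmod (nlt a k x)))\<^sup>2)"
      unfolding nl_def
      by (intro sum_mono power_mono mult_left_mono norm_infsum_bound nlt_summable(2)[OF a1]) auto
    with le show "(\<Sum>k\<in>X. (jp k powr (s - 1) * cmod (nl a k))\<^sup>2) \<le> M\<^sup>2" by simp
  qed (auto simp: M)
qed

end

section \<open>Normal form reduction\<close>

context raman
begin

section \<open>The phase of an interaction and the normal form coefficient\<close>

definition Phi :: "int \<Rightarrow> int \<Rightarrow> int \<Rightarrow> real" where
  "Phi k p r = om p - om (p + r - k) + om r - om k"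

text \<open>Integrating an oscillation exp(i Phi t) in time divides by i Phi. Where Phi vanishes the
  value is 0, by the convention for division.\<close>

definition cf :: "int \<Rightarrow> int \<times> int \<Rightarrow> complex" where
  "cf k = (\<lambda>(p, r). mu k r / (\<i> * of_real (Phi k p r)))"

text \<open>The cubic resonance function splits into linear factors. The first two vanish exactly at
  the resonant pairs; the last is an integer translate of the number assumed not to be an
  integer.\<close>

lemma Phi_factor:
  "Phi k p r = 3 * \<alpha>\<^sub>1 * of_int (k - p) * of_int (k - r) * (of_int (p + r) + 2 * \<alpha>\<^sub>2 / (3 * \<alpha>\<^sub>1))"
  using alpha_nonzero by (simp add: Phi_def om_def field_simps power2_eq_square power3_eq_cube)

lemma Phi_nonzero: "p \<noteq> k \<Longrightarrow> r \<noteq> k \<Longrightarrow> Phi k p r \<noteq> 0"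
proof -
  assume "p \<noteq> k" "r \<noteq> k"
  moreover have "of_int (p + r) + 2 * \<alpha>\<^sub>2 / (3 * \<alpha>\<^sub>1) \<noteq> 0"
  proof
    assume "of_int (p + r) + 2 * \<alpha>\<^sub>2 / (3 * \<alpha>\<^sub>1) = 0"
    then have "2 * \<alpha>\<^sub>2 / (3 * \<alpha>\<^sub>1) = of_int (- (p + r))" by simp
    then show False using nonresonant Ints_of_int by metis
  qed
  ultimately show ?thesis unfolding Phi_factor using alpha_nonzero by (simp del: of_int_diff of_int_add)
qed

text \<open>This is (XY + YZ + ZX)/(XYZ) for the weights X, Y, Z of the three factors of the phase:
  what remains of the gain in \<open>cf_bound\<close>, an l2 weight in p, in r or in p + r.\<close>

definition K :: "int \<Rightarrow> int \<Rightarrow> int \<Rightarrow> real" where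
  "K k p r = 1 / jp (k - p) + 1 / jp (k - r) + 1 / jp (p + r)"

lemma K_nonneg: "0 \<le> K k p r"
  by (simp add: K_def)

text \<open>The phase is worth three weights, \<open>mu\<close> costs one, and the factor in front
  costs another. Splitting k into an input frequency and a factor of the phase trades weights at k
  for weights at the inputs. Each of the three versions charges only two inputs, so the remaining
  one may be rougher by a derivative.\<close>

lemma cf_bound:
  "\<exists>C\<ge>0. \<forall>k p r. jp k * cmod (cf k (p, r)) \<le> C * (jp p * jp (p + r - k)) * K k p r
     \<and> jp k * cmod (cf k (p, r)) \<le> C * (jp (p + r - k) * jp r) * K k p r
     \<and> jp k * cmod (cf k (p, r)) \<le> C * (jp p * jp r) * K k p r"
proof -
  obtain c where c: "0 < c" "\<And>j :: int. c * jp j \<le> \<bar>of_int j + 2 * \<alpha>\<^sub>2 / (3 * \<alpha>\<^sub>1)\<bar>"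
    using int_shift_lower_bound[OF nonresonant] by blast
  \<comment> \<open>Off resonance k - p and k - r are nonzero integers, hence at least half their
    weights, which gives the 1/4; c serves the third factor.\<close>
  define c1 where "c1 = 3 * \<bar>\<alpha>\<^sub>1\<bar> * c / 4"
  have c1: "0 < c1" using c alpha_nonzero by (simp add: c1_def)
  define C where "C = 2 * C0 / c1"
  have C: "0 \<le> C" using C0_nonneg c1 by (simp add: C_def)
  \<comment> \<open>Reduces the claim to two polynomial inequalities, one for each term of |mu|
    \<le> C0 (jp k + jp (k - r)).\<close>
  have main: "jp k * cmod (cf k (p, r)) \<le> C * W * K k p r"
    if W: "0 \<le> W" "jp k * jp k \<le> W * (jp (k - p) * jp (k - r) + jp (k - r) * jp (p + r) + jp (p + r) * jp (k - p))"
      "jp k * jp (k - r) \<le> W * (jp (k - p) * jp (k - r) + jp (k - r) * jp (p + r) + jp (p + r) * jp (k - p))"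
    for W k p r
  proof (cases "p = k \<or> r = k")
    case True
    then have "Phi k p r = 0" by (auto simp: Phi_factor)
    then show ?thesis using C W K_nonneg by (simp add: cf_def)
  next
    case False
    define X Y Z where "X = jp (k - p)" and "Y = jp (k - r)" and "Z = jp (p + r)"
    have pos: "0 < X" "0 < Y" "0 < Z" by (auto simp: X_def Y_def Z_def)
    have half: "jp j / 2 \<le> \<bar>of_int j\<bar>" if "j \<noteq> 0" for j :: int
    proof -
      have "1 \<le> \<bar>j\<bar>" using that by linarith
      then have "1 \<le> \<bar>real_of_int j\<bar>" by (metis of_int_1_le_iff of_int_abs)
      then show ?thesis by (simp add: jp_def)
    qed
    have "c1 * (X * Y * Z) = 3 * \<bar>\<alpha>\<^sub>1\<bar> * (X / 2) * (Y / 2) * (c * Z)"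
      by (simp add: c1_def)
    also have "\<dots> \<le> 3 * \<bar>\<alpha>\<^sub>1\<bar> * \<bar>of_int (k - p)\<bar> * \<bar>of_int (k - r)\<bar> * \<bar>of_int (p + r) + 2 * \<alpha>\<^sub>2 / (3 * \<alpha>\<^sub>1)\<bar>"
      unfolding X_def Y_def Z_def using False c
      by (intro mult_mono half mult_nonneg_nonneg) (auto simp del: of_int_diff of_int_add)
    also have "\<dots> = \<bar>Phi k p r\<bar>" unfolding Phi_factor by (simp add: abs_mult)
    finally have lower: "c1 * (X * Y * Z) \<le> \<bar>Phi k p r\<bar>" .
    have "cmod (cf k (p, r)) = cmod (mu k r) / \<bar>Phi k p r\<bar>"
      by (simp add: cf_def norm_divide norm_mult)
    also have "\<dots> \<le> C0 * (jp k + Y) / (c1 * (X * Y * Z))"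
      using mu_bound[of k r] lower c1 pos C0_nonneg unfolding Y_def[symmetric]
      by (intro frac_le) auto
    finally have "jp k * cmod (cf k (p, r)) \<le> jp k * (C0 * (jp k + Y) / (c1 * (X * Y * Z)))"
      by (intro mult_left_mono) auto
    also have "\<dots> = C0 / c1 * (jp k * jp k + jp k * Y) / (X * Y * Z)"
      using pos c1 by (simp add: field_simps)
    also have "\<dots> \<le> C0 / c1 * (W * (X * Y + Y * Z + Z * X) + W * (X * Y + Y * Z + Z * X)) / (X * Y * Z)"
      using W(2,3) C0_nonneg c1 pos unfolding X_def[symmetric] Y_def[symmetric] Z_def[symmetric]
      by (intro divide_right_mono mult_left_mono add_mono) auto
    also have "\<dots> = C * W * K k p r"
      unfolding K_def X_def[symmetric] Y_def[symmetric] Z_def[symmetric] C_def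
      using pos c1 by (simp add: field_simps)
    finally show ?thesis .
  qed
  \<comment> \<open>From k = p + (k - p) = r + (k - r) = -(p + r - k) + (p + r).\<close>
  have *: "jp k \<le> jp p * jp (k - p)" "jp k \<le> jp r * jp (k - r)" "jp k \<le> jp (p + r - k) * jp (p + r)" for k p r
  proof -
    show "jp k \<le> jp p * jp (k - p)" "jp k \<le> jp r * jp (k - r)"
      using jp_add_mult[of p "k - p"] jp_add_mult[of r "k - r"] by auto
    have "k = - (p + r - k) + (p + r)" by simp
    then have "jp k \<le> jp (- (p + r - k)) * jp (p + r)" using jp_add_mult by metis
    then show "jp k \<le> jp (p + r - k) * jp (p + r)" by (simp only: jp_minus)
  qed
  show ?thesis
  proof (intro exI[of _ C] conjI allI C)
    fix k p r :: int
    define m where "m = p + r - k"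
    define X Y Z where "X = jp (k - p)" and "Y = jp (k - r)" and "Z = jp (p + r)"
    define P M Q N where "P = jp p" and "M = jp m" and "Q = jp r" and "N = jp k"
    have b: "N \<le> P * X" "N \<le> Q * Y" "N \<le> M * Z"
      unfolding X_def Y_def Z_def P_def M_def Q_def N_def m_def by (rule *)+
    have nn: "0 \<le> X" "0 \<le> Y" "0 \<le> Z" "0 \<le> P" "0 \<le> Q" "0 \<le> M" "0 \<le> N"
      by (auto simp: X_def Y_def Z_def P_def M_def Q_def N_def)
    have one: "1 \<le> X" "1 \<le> Y" "1 \<le> Z" "1 \<le> P" "1 \<le> Q" "1 \<le> M"
      by (auto simp: X_def Y_def Z_def P_def M_def Q_def N_def jp_ge1)
    have dom: "W * (X * Y) \<le> W * (X * Y + Y * Z + Z * X)" "W * (Y * Z) \<le> W * (X * Y + Y * Z + Z * X)"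
      "W * (Z * X) \<le> W * (X * Y + Y * Z + Z * X)" if "0 \<le> W" for W
      using nn that by (auto intro!: mult_left_mono)
    have nn2: "0 \<le> P * M" "0 \<le> M * Q" "0 \<le> P * Q" using nn by auto
    have "N * N \<le> (P * X) * (M * Z)" using b nn by (intro mult_mono) auto
    also have "\<dots> = P * M * (Z * X)" by simp
    finally have 1: "N * N \<le> P * M * (X * Y + Y * Z + Z * X)"
      using dom(3)[OF nn2(1)] by linarith
    have "N * Y \<le> (P * X) * Y" using b nn by (intro mult_right_mono) auto
    also have "\<dots> \<le> (P * X) * Y * M" using mult_left_mono[OF one(6), of "(P * X) * Y"] nn by simp
    also have "\<dots> = P * M * (X * Y)" by simp
    finally have 2: "N * Y \<le> P * M * (X * Y + Y * Z + Z * X)"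
      using dom(1)[OF nn2(1)] by linarith
    have "N * N \<le> (M * Z) * (Q * Y)" using b nn by (intro mult_mono) auto
    also have "\<dots> = M * Q * (Y * Z)" by simp
    finally have 3: "N * N \<le> M * Q * (X * Y + Y * Z + Z * X)"
      using dom(2)[OF nn2(2)] by linarith
    have "N * Y \<le> (M * Z) * Y" using b nn by (intro mult_right_mono) auto
    also have "\<dots> \<le> (M * Z) * Y * Q" using mult_left_mono[OF one(5), of "(M * Z) * Y"] nn by simp
    also have "\<dots> = M * Q * (Y * Z)" by simp
    finally have 4: "N * Y \<le> M * Q * (X * Y + Y * Z + Z * X)"
      using dom(2)[OF nn2(2)] by linarith
    have "N * N \<le> (P * X) * (Q * Y)" using b nn by (intro mult_mono) auto
    also have "\<dots> = P * Q * (X * Y)" by simp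
    finally have 5: "N * N \<le> P * Q * (X * Y + Y * Z + Z * X)"
      using dom(1)[OF nn2(3)] by linarith
    have "N * Y \<le> (P * X) * Y" using b nn by (intro mult_right_mono) auto
    also have "\<dots> \<le> (P * X) * Y * Q" using mult_left_mono[OF one(5), of "(P * X) * Y"] nn by simp
    also have "\<dots> = P * Q * (X * Y)" by simp
    finally have 6: "N * Y \<le> P * Q * (X * Y + Y * Z + Z * X)"
      using dom(1)[OF nn2(3)] by linarith
    note defs = X_def Y_def Z_def P_def M_def Q_def N_def m_def
    show "jp k * cmod (cf k (p, r)) \<le> C * (jp p * jp (p + r - k)) * K k p r"
      by (rule main) (use 1 2 in \<open>simp_all add: defs\<close>)
    show "jp k * cmod (cf k (p, r)) \<le> C * (jp (p + r - k) * jp r) * K k p r"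
      by (rule main) (use 3 4 in \<open>simp_all add: defs\<close>)
    show "jp k * cmod (cf k (p, r)) \<le> C * (jp p * jp r) * K k p r"
      by (rule main) (use 5 6 in \<open>simp_all add: defs\<close>)
  qed
qed

lemma trilinear_K:
  assumes f: "l2_bounded f F" and g: "l2_bounded g G" and h: "l2_bounded h H" and S: "finite S"
  shows "(\<Sum>(p, r)\<in>S. f p * g (p + r - k) * h r * K k p r) \<le> 9 * (F * G * H)"
proof -
  have w1: "l2_bounded (\<lambda>p. 1 / jp (k - p)) 3"
    using l2_bounded_reindex[OF l2_bounded_inverse_jp, of "\<lambda>p. k - p"] by (auto simp: inj_def)
  \<comment> \<open>The sum p + r is the middle frequency shifted by k.\<close>
  have w2: "l2_bounded (\<lambda>m. 1 / jp (m + k)) 3"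
    using l2_bounded_reindex[OF l2_bounded_inverse_jp, of "\<lambda>m. m + k"] by (auto simp: inj_def)
  have "(\<Sum>(p, r)\<in>S. f p * g (p + r - k) * h r * K k p r)
    = (\<Sum>(p, r)\<in>S. f p * g (p + r - k) * h r * (1 / jp (k - p)))
    + (\<Sum>(p, r)\<in>S. f p * g (p + r - k) * h r * (1 / jp (k - r)))
    + (\<Sum>(p, r)\<in>S. f p * g (p + r - k) * h r * (1 / jp ((p + r - k) + k)))"
    by (simp only: split_def distrib_left sum.distrib K_def diff_add_cancel)
  also have "\<dots> \<le> F * G * H * 3 + F * G * H * 3 + F * G * H * 3"
    by (intro add_mono trilinear_first[OF f g h w1 S] trilinear_last[OF f g h w1 S]
        trilinear_middle[OF f g h w2 S])
  finally show ?thesis by simp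
qed

text \<open>One of the three factors may have one derivative less than the others; this costs exactly the
  factor \<open>jp k\<close> gained from the phase.\<close>

lemma normal_form_bound:
  "\<exists>C\<ge>0. \<forall>k S s R D x y z. finite S \<longrightarrow> 1 \<le> s \<longrightarrow>
    (h_bounded (s - 1) D x \<and> h_bounded s R y \<and> h_bounded s R z \<or>
     h_bounded s R x \<and> h_bounded (s - 1) D y \<and> h_bounded s R z \<or>
     h_bounded s R x \<and> h_bounded s R y \<and> h_bounded (s - 1) D z) \<longrightarrow>
    jp k powr s * (\<Sum>(p, r)\<in>S. cmod (cf k (p, r)) * (cmod (x p) * cmod (y (p + r - k)) * cmod (z r)))
      \<le> C * (D * R\<^sup>2)"
proof -
  obtain C where C: "0 \<le> C"
    "\<And>k p r. jp k * cmod (cf k (p, r)) \<le> C * (jp p * jp (p + r - k)) * K k p r"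
    "\<And>k p r. jp k * cmod (cf k (p, r)) \<le> C * (jp (p + r - k) * jp r) * K k p r"
    "\<And>k p r. jp k * cmod (cf k (p, r)) \<le> C * (jp p * jp r) * K k p r"
    using cf_bound by blast
  \<comment> \<open>The weights \<open>wx\<close>, \<open>wy\<close>, \<open>wz\<close> are
    \<open>jp\<close>, except for a constant 1 at the factor with the missing derivative; so one
    argument covers its three positions.\<close>
  have key: "jp k powr s * (\<Sum>(p, r)\<in>S. cmod (cf k (p, r)) * (cmod (x p) * cmod (y (p + r - k)) * cmod (z r)))
      \<le> 9 * C * (F * G * H)"
    if S: "finite S" and s: "1 \<le> s" and ws: "\<And>k p r. jp k * cmod (cf k (p, r)) \<le> C * (wx p * wy (p + r - k) * wz r) * K k p r"
      and wn: "\<And>k. 0 \<le> wx k" "\<And>k. 0 \<le> wy k" "\<And>k. 0 \<le> wz k"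
      and f: "l2_bounded (\<lambda>k. jp k powr (s - 1) * (wx k * cmod (x k))) F"
      and g: "l2_bounded (\<lambda>k. jp k powr (s - 1) * (wy k * cmod (y k))) G"
      and h: "l2_bounded (\<lambda>k. jp k powr (s - 1) * (wz k * cmod (z k))) H"
    for k s x y z wx wy wz F G H and S :: "(int \<times> int) set"
  proof -
    define f g h where "f = (\<lambda>k. jp k powr (s - 1) * (wx k * cmod (x k)))"
      and "g = (\<lambda>k. jp k powr (s - 1) * (wy k * cmod (y k)))"
      and "h = (\<lambda>k. jp k powr (s - 1) * (wz k * cmod (z k)))"
    have "jp k powr s * (cmod (cf k (p, r)) * (cmod (x p) * cmod (y (p + r - k)) * cmod (z r)))
      \<le> C * (f p * g (p + r - k) * h r * K k p r)" for p r
    proof -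
      define m where "m = p + r - k"
      have "jp k powr s * (cmod (cf k (p, r)) * (cmod (x p) * cmod (y m) * cmod (z r)))
         = jp k powr (s - 1) * (jp k * cmod (cf k (p, r))) * (cmod (x p) * cmod (y m) * cmod (z r))"
        by (simp add: powr_diff)
      also have "\<dots> \<le> (jp p * jp m * jp r) powr (s - 1) * (C * (wx p * wy m * wz r) * K k p r)
          * (cmod (x p) * cmod (y m) * cmod (z r))"
      proof (rule mult_right_mono[OF mult_mono])
        show "jp k powr (s - 1) \<le> (jp p * jp m * jp r) powr (s - 1)"
          using s jp_triple[of k p r] unfolding m_def by (intro powr_mono2) auto
        show "jp k * cmod (cf k (p, r)) \<le> C * (wx p * wy m * wz r) * K k p r"
          using ws unfolding m_def .
      qed auto
      also have "\<dots> = C * (f p * g m * h r * K k p r)"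
        by (simp add: powr_mult f_def g_def h_def)
      finally show ?thesis by (simp add: m_def)
    qed
    then have "jp k powr s * (\<Sum>(p, r)\<in>S. cmod (cf k (p, r)) * (cmod (x p) * cmod (y (p + r - k)) * cmod (z r)))
      \<le> (\<Sum>(p, r)\<in>S. C * (f p * g (p + r - k) * h r * K k p r))"
      unfolding sum_distrib_left by (intro sum_mono) (auto simp: case_prod_beta)
    also have "\<dots> = C * (\<Sum>(p, r)\<in>S. f p * g (p + r - k) * h r * K k p r)"
      by (simp add: sum_distrib_left case_prod_beta)
    also have "\<dots> \<le> C * (9 * (F * G * H))"
      using that C unfolding f_def g_def h_def by (intro mult_left_mono trilinear_K) auto
    finally show ?thesis by simp
  qed
  have s1: "jp k powr (s - 1) * (jp k * c) = jp k powr s * c" for k s c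
    by (simp add: powr_diff)
  show ?thesis
  proof (intro exI[of _ "9 * C"] conjI allI impI)
    fix k s R D x y z and S :: "(int \<times> int) set"
    assume S: "finite S" and s: "1 \<le> s"
      and xyz: "h_bounded (s - 1) D x \<and> h_bounded s R y \<and> h_bounded s R z \<or>
     h_bounded s R x \<and> h_bounded (s - 1) D y \<and> h_bounded s R z \<or>
     h_bounded s R x \<and> h_bounded s R y \<and> h_bounded (s - 1) D z"
    let ?L = "jp k powr s * (\<Sum>(p, r)\<in>S. cmod (cf k (p, r)) * (cmod (x p) * cmod (y (p + r - k)) * cmod (z r)))"
    have 1: "?L \<le> 9 * C * (D * R * R)" if "h_bounded (s - 1) D x" "h_bounded s R y" "h_bounded s R z"
      by (rule key[OF S s, where wx = "\<lambda>_. 1" and wy = jp and wz = jp])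
        (use C that in \<open>auto simp: h_bounded_def s1\<close>)
    have 2: "?L \<le> 9 * C * (R * D * R)" if "h_bounded s R x" "h_bounded (s - 1) D y" "h_bounded s R z"
      by (rule key[OF S s, where wx = jp and wy = "\<lambda>_. 1" and wz = jp])
        (use C that in \<open>auto simp: h_bounded_def s1\<close>)
    have 3: "?L \<le> 9 * C * (R * R * D)" if "h_bounded s R x" "h_bounded s R y" "h_bounded (s - 1) D z"
      by (rule key[OF S s, where wx = jp and wy = jp and wz = "\<lambda>_. 1"])
        (use C that in \<open>auto simp: h_bounded_def s1\<close>)
    have eq: "9 * C * (R * D * R) = 9 * C * (D * R\<^sup>2)" "9 * C * (R * R * D) = 9 * C * (D * R\<^sup>2)"
      "9 * C * (D * R * R) = 9 * C * (D * R\<^sup>2)" by (simp_all add: power2_eq_square)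
    show "?L \<le> 9 * C * (D * R\<^sup>2)" using xyz 1 2 3 unfolding eq by blast
  qed (use C in simp)
qed

end

context raman
begin

section \<open>The resonant growth rate and the normal form transformation\<close>

definition NR :: "int \<Rightarrow> (int \<times> int) set" where
  "NR k = {(p, r). p \<noteq> k \<and> r \<noteq> k}"

text \<open>The interactions with \<open>p = k\<close> or \<open>r = k\<close> are resonant: their sum is \<open>G a k * a k\<close>, and the real part of
  \<open>G a k\<close> grows like \<open>\<Gamma> * k * mass a / (2 * pi)\<close>.\<close>

definition G :: "(int \<Rightarrow> complex) \<Rightarrow> int \<Rightarrow> complex" where
  "G a k = (\<Sum>\<^sub>\<infinity>r. mu k r * of_real ((cmod (a r))\<^sup>2)) + mu k k * of_real (\<Sum>\<^sub>\<infinity>p\<in>-{k}. (cmod (a p))\<^sup>2)"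

lemma mu_mass_sum_bound:
  assumes "h_bounded 1 R a" "finite S"
  shows "(\<Sum>r\<in>S. cmod (mu k r * of_real ((cmod (a r))\<^sup>2))) \<le> 2 * C0 * jp k * R\<^sup>2"
proof -
  have "(\<Sum>r\<in>S. cmod (mu k r * of_real ((cmod (a r))\<^sup>2))) \<le> (\<Sum>r\<in>S. 2 * C0 * jp k * (jp r * cmod (a r))\<^sup>2)"
  proof (rule sum_mono)
    fix r
    have "jp (k - r) \<le> jp k * jp r" using jp_add_mult[of k "- r"] by simp
    moreover have "jp k \<le> jp k * jp r" using mult_left_mono[OF jp_ge1[of r] jp_nonneg[of k]] by simp
    ultimately have "C0 * (jp k + jp (k - r)) \<le> C0 * (jp k * jp r + jp k * jp r)"
      using C0_nonneg by (intro mult_left_mono add_mono)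
    then have "cmod (mu k r) \<le> 2 * C0 * jp k * jp r" using mu_bound[of k r] by simp
    also have "\<dots> \<le> 2 * C0 * jp k * (jp r)\<^sup>2"
      using C0_nonneg jp_ge1[of r] by (intro mult_left_mono self_le_power) auto
    finally show "cmod (mu k r * of_real ((cmod (a r))\<^sup>2)) \<le> 2 * C0 * jp k * (jp r * cmod (a r))\<^sup>2"
      by (simp add: norm_mult norm_power power_mult_distrib mult_right_mono mult.assoc[symmetric])
  qed
  also have "\<dots> \<le> 2 * C0 * jp k * R\<^sup>2"
    unfolding sum_distrib_left[symmetric] using assms C0_nonneg
    by (intro mult_left_mono) (auto simp: h_bounded_def l2_bounded_def)
  finally show ?thesis .
qed

text \<open>The resonant pairs form the row p = k and the column r = k; on each of them the
  conjugated factor and the free one combine to a squared modulus. The pair (k, k) is counted with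
  the row, which is why the second sum in \<open>G\<close> omits k.\<close>

lemma nl_split:
  assumes a: "h_bounded 1 R a"
  shows "nl a k = G a k * a k + infsum (nlt a k) (NR k)"
proof -
  have U: "UNIV = {k} \<times> UNIV \<union> ((- {k}) \<times> {k} \<union> NR k)" by (auto simp: NR_def)
  have "nl a k = infsum (nlt a k) ({k} \<times> UNIV) + (infsum (nlt a k) ((- {k}) \<times> {k}) + infsum (nlt a k) (NR k))"
    unfolding nl_def U
    by (subst infsum_Un_disjoint, rule nlt_summable[OF a], rule nlt_summable[OF a], force simp: NR_def,
        subst infsum_Un_disjoint, rule nlt_summable[OF a], rule nlt_summable[OF a]) (auto simp: NR_def)
  moreover have "infsum (nlt a k) ({k} \<times> UNIV) = (\<Sum>\<^sub>\<infinity>r. mu k r * of_real ((cmod (a r))\<^sup>2)) * a k"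
  proof -
    have "{k} \<times> (UNIV :: int set) = Pair k ` UNIV" by auto
    then have "infsum (nlt a k) ({k} \<times> UNIV) = infsum (nlt a k \<circ> Pair k) UNIV"
      by (simp only:) (rule infsum_reindex, auto simp: inj_on_def)
    also have "nlt a k \<circ> Pair k = (\<lambda>r. mu k r * of_real ((cmod (a r))\<^sup>2) * a k)"
      by (auto simp: fun_eq_iff nlt_def complex_norm_square simp del: of_real_power)
    finally show ?thesis by (simp only: infsum_cmult_left')
  qed
  moreover have "infsum (nlt a k) ((- {k}) \<times> {k}) = mu k k * of_real (\<Sum>\<^sub>\<infinity>p\<in>-{k}. (cmod (a p))\<^sup>2) * a k"
  proof -
    have "(- {k}) \<times> {k} = (\<lambda>p. (p, k)) ` (- {k})" by auto
    then have "infsum (nlt a k) ((- {k}) \<times> {k}) = infsum (nlt a k \<circ> (\<lambda>p. (p, k))) (- {k})"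
      by (simp only:) (rule infsum_reindex, auto simp: inj_on_def)
    also have "nlt a k \<circ> (\<lambda>p. (p, k)) = (\<lambda>p. mu k k * of_real ((cmod (a p))\<^sup>2) * a k)"
      by (auto simp: fun_eq_iff nlt_def complex_norm_square simp del: of_real_power)
    also have "infsum \<dots> (- {k}) = mu k k * (\<Sum>\<^sub>\<infinity>p\<in>-{k}. of_real ((cmod (a p))\<^sup>2)) * a k"
      by (simp only: infsum_cmult_left' infsum_cmult_right')
    also have "(\<Sum>\<^sub>\<infinity>p\<in>-{k}. complex_of_real ((cmod (a p))\<^sup>2)) = of_real (\<Sum>\<^sub>\<infinity>p\<in>-{k}. (cmod (a p))\<^sup>2)"
      by (intro infsumI has_sum_of_real has_sum_infsum h_bounded_mass(1)[OF a]) simp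
    finally show ?thesis .
  qed
  ultimately show ?thesis by (simp add: G_def algebra_simps)
qed

lemma G_upper:
  assumes a: "h_bounded 1 R a"
  shows "cmod (G a k) \<le> 4 * C0 * jp k * R\<^sup>2"
proof -
  have "cmod (\<Sum>\<^sub>\<infinity>r. mu k r * of_real ((cmod (a r))\<^sup>2)) \<le> 2 * C0 * jp k * R\<^sup>2"
    by (rule abs_summable_bounded(3)) (rule mu_mass_sum_bound[OF a])
  moreover have "cmod (mu k k * of_real (\<Sum>\<^sub>\<infinity>p\<in>-{k}. (cmod (a p))\<^sup>2)) \<le> (2 * C0 * jp k) * R\<^sup>2"
    unfolding norm_mult
  proof (rule mult_mono)
    have "C0 * (jp k + jp (k - k)) \<le> C0 * (jp k + jp k)"
      using C0_nonneg jp_ge1[of k] by (intro mult_left_mono add_mono) (auto simp: jp_def)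
    then show "cmod (mu k k) \<le> 2 * C0 * jp k" using mu_bound[of k k] by simp
    show "cmod (of_real (\<Sum>\<^sub>\<infinity>p\<in>-{k}. (cmod (a p))\<^sup>2)) \<le> R\<^sup>2"
      unfolding norm_of_real using h_bounded_mass(2)[OF a, of "- {k}"] by (simp add: infsum_nonneg)
  qed (use C0_nonneg in auto)
  ultimately have "cmod (\<Sum>\<^sub>\<infinity>r. mu k r * of_real ((cmod (a r))\<^sup>2)) +
      cmod (mu k k * of_real (\<Sum>\<^sub>\<infinity>p\<in>-{k}. (cmod (a p))\<^sup>2)) \<le> 4 * C0 * jp k * R\<^sup>2"
    by linarith
  then show ?thesis unfolding G_def by (rule order_trans[OF norm_triangle_ineq])
qed

text \<open>Taking real parts leaves \<Gamma>/(2 pi) times the sum of (k - r) |a r|^2, since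
  \<open>mu k k\<close> is imaginary. The part with r is a momentum, bounded through the H^1 norm,
  hence a bounded loss against k times the mass.\<close>

lemma G_lower:
  assumes a: "h_bounded 1 R a"
  shows "\<Gamma> / (2 * pi) * (of_int k * mass a - R\<^sup>2) \<le> Re (G a k)"
proof -
  have sm: "(\<lambda>r. mu k r * of_real ((cmod (a r))\<^sup>2)) summable_on UNIV"
    by (rule abs_summable_bounded(2)) (rule mu_mass_sum_bound[OF a])
  have s1: "(\<lambda>r. (cmod (a r))\<^sup>2) summable_on UNIV" using h_bounded_mass(1)[OF a] by simp
  have A: "l2_bounded (\<lambda>k. jp k * cmod (a k)) R" using a by (simp add: h_bounded_def)
  note s2 = l2_bounded_summable[OF A, of UNIV]
  have "\<Gamma> / (2 * pi) * (of_int k * mass a - R\<^sup>2)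
      \<le> \<Gamma> / (2 * pi) * (of_int k * mass a + - (\<Sum>\<^sub>\<infinity>r. (jp r * cmod (a r))\<^sup>2))"
    using s2(2) Gamma_pos by (intro mult_left_mono) auto
  also have "\<dots> = (\<Sum>\<^sub>\<infinity>r. \<Gamma> / (2 * pi) * (of_int k * (cmod (a r))\<^sup>2 + - (jp r * cmod (a r))\<^sup>2))"
    unfolding mass_def infsum_cmult_right'[symmetric] infsum_uminus[symmetric]
    by (subst infsum_add[symmetric])
      (auto intro!: summable_on_cmult_right s1 s2(1) simp: summable_on_uminus infsum_cmult_right'[symmetric] distrib_left)
  also have "\<dots> \<le> (\<Sum>\<^sub>\<infinity>r. Re (mu k r * of_real ((cmod (a r))\<^sup>2)))"
  proof (rule infsum_mono)
    show "(\<lambda>r. \<Gamma> / (2 * pi) * (of_int k * (cmod (a r))\<^sup>2 + - (jp r * cmod (a r))\<^sup>2)) summable_on UNIV"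
      by (intro summable_on_cmult_right summable_on_add s1) (use s2(1) in \<open>simp add: summable_on_uminus\<close>)
    show "(\<lambda>r. Re (mu k r * of_real ((cmod (a r))\<^sup>2))) summable_on UNIV"
      using sm by (rule summable_on_Re)
    fix r
    have "of_int r \<le> (jp r)\<^sup>2"
    proof -
      have "of_int r \<le> jp r" by (simp add: jp_def)
      also have "\<dots> \<le> (jp r)\<^sup>2" using jp_ge1[of r] by (rule self_le_power) simp
      finally show ?thesis .
    qed
    then have "of_int r * (cmod (a r))\<^sup>2 \<le> (jp r)\<^sup>2 * (cmod (a r))\<^sup>2" by (intro mult_right_mono) auto
    then have "of_int k * (cmod (a r))\<^sup>2 + - (jp r * cmod (a r))\<^sup>2 \<le> of_int (k - r) * (cmod (a r))\<^sup>2"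
      by (simp add: power_mult_distrib left_diff_distrib)
    then have "\<Gamma> / (2 * pi) * (of_int k * (cmod (a r))\<^sup>2 + - (jp r * cmod (a r))\<^sup>2)
        \<le> \<Gamma> / (2 * pi) * (of_int (k - r) * (cmod (a r))\<^sup>2)"
      using Gamma_pos by (intro mult_left_mono) auto
    then show "\<Gamma> / (2 * pi) * (of_int k * (cmod (a r))\<^sup>2 + - (jp r * cmod (a r))\<^sup>2)
        \<le> Re (mu k r * of_real ((cmod (a r))\<^sup>2))"
      by (simp add: mu_def del: of_real_power)
  qed
  also have "\<dots> = Re (G a k)"
    using infsum_Re[OF sm] by (simp add: G_def mu_def)
  finally show ?thesis .
qed

text \<open>Subtracting \<open>NF F a k\<close> from \<open>a k\<close> removes the interactions in \<open>F\<close> at the price of the quintic terms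
  \<open>NE F a k\<close>; only finite \<open>F\<close> are used, so that no sum has to be differentiated term by term.\<close>

definition NF :: "(int \<times> int) set \<Rightarrow> (int \<Rightarrow> complex) \<Rightarrow> int \<Rightarrow> complex" where
  "NF F a k = (\<Sum>(p, r)\<in>F. cf k (p, r) * (a p * cnj (a (p + r - k)) * a r))"

definition NE :: "(int \<times> int) set \<Rightarrow> (int \<Rightarrow> complex) \<Rightarrow> int \<Rightarrow> complex" where
  "NE F a k = (\<Sum>(p, r)\<in>F. cf k (p, r) * (nl a p * cnj (a (p + r - k)) * a r
     + a p * cnj (nl a (p + r - k)) * a r + a p * cnj (a (p + r - k)) * nl a r))"

text \<open>With m = p + r - k the linear parts contribute i (om p - om m + om r) = i (om k + Phi).
  The Phi part cancels the denominator of \<open>cf\<close> and reproduces the interaction, the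
  other one is the linear evolution of mode k, and \<open>NE\<close> collects the derivatives
  falling on the nonlinearity.\<close>

lemma NF_derivative:
  assumes sol: "fsol I a" and t: "t \<in> I" and F: "F \<subseteq> NR k"
  shows "((\<lambda>t. NF F (a t) k) has_vector_derivative
    \<i> * of_real (om k) * NF F (a t) k + sum (nlt (a t) k) F + NE F (a t) k) (at t within I)"
proof -
  have d: "((\<lambda>t. a t j) has_vector_derivative (\<i> * of_real (om j) * a t j + nl (a t) j)) (at t within I)" for j
    using sol t by (auto simp: fsol_def)
  have "((\<lambda>t. cf k (p, r) * (a t p * cnj (a t (p + r - k)) * a t r)) has_vector_derivative
      \<i> * of_real (om k) * (cf k (p, r) * (a t p * cnj (a t (p + r - k)) * a t r)) + nlt (a t) k (p, r)
      + cf k (p, r) * (nl (a t) p * cnj (a t (p + r - k)) * a t r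
     + a t p * cnj (nl (a t) (p + r - k)) * a t r + a t p * cnj (a t (p + r - k)) * nl (a t) r)) (at t within I)"
    if "(p, r) \<in> F" for p r
  proof -
    define m where "m = p + r - k"
    have "Phi k p r \<noteq> 0" using that F by (intro Phi_nonzero) (auto simp: NR_def)
    then have cf: "mu k r = cf k (p, r) * (\<i> * of_real (Phi k p r))" by (simp add: cf_def)
    have dc: "((\<lambda>t. cnj (a t m)) has_vector_derivative cnj (\<i> * of_real (om m) * a t m + nl (a t) m)) (at t within I)"
      by (rule bounded_linear.has_vector_derivative[OF bounded_linear_cnj d])
    have "((\<lambda>t. cf k (p, r) * (a t p * cnj (a t m) * a t r)) has_vector_derivative
       cf k (p, r) * ((a t p * cnj (a t m)) * (\<i> * of_real (om r) * a t r + nl (a t) r) +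
         (a t p * cnj (\<i> * of_real (om m) * a t m + nl (a t) m) + (\<i> * of_real (om p) * a t p + nl (a t) p) * cnj (a t m)) * a t r)) (at t within I)"
      by (intro has_vector_derivative_mult_right has_vector_derivative_mult d dc)
    also have "cf k (p, r) * ((a t p * cnj (a t m)) * (\<i> * of_real (om r) * a t r + nl (a t) r) +
         (a t p * cnj (\<i> * of_real (om m) * a t m + nl (a t) m) + (\<i> * of_real (om p) * a t p + nl (a t) p) * cnj (a t m)) * a t r)
       = \<i> * of_real (om k) * (cf k (p, r) * (a t p * cnj (a t m) * a t r))
        + cf k (p, r) * (\<i> * of_real (Phi k p r)) * (a t p * cnj (a t m) * a t r)
      + cf k (p, r) * (nl (a t) p * cnj (a t m) * a t r
     + a t p * cnj (nl (a t) m) * a t r + a t p * cnj (a t m) * nl (a t) r)"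
      unfolding Phi_def m_def[symmetric] by (simp add: algebra_simps)
    finally show ?thesis unfolding nlt_def m_def using cf by simp
  qed
  then have "((\<lambda>t. \<Sum>x\<in>F. (case x of (p, r) \<Rightarrow> cf k (p, r) * (a t p * cnj (a t (p + r - k)) * a t r))) has_vector_derivative
     (\<Sum>x\<in>F. (case x of (p, r) \<Rightarrow> \<i> * of_real (om k) * (cf k (p, r) * (a t p * cnj (a t (p + r - k)) * a t r)) + nlt (a t) k (p, r)
      + cf k (p, r) * (nl (a t) p * cnj (a t (p + r - k)) * a t r
     + a t p * cnj (nl (a t) (p + r - k)) * a t r + a t p * cnj (a t (p + r - k)) * nl (a t) r)))) (at t within I)"
    by (intro has_vector_derivative_sum) auto
  then show ?thesis
    unfolding NF_def NE_def
    by (rule has_vector_derivative_eq_rhs) (simp add: split_def sum.distrib sum_distrib_left)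
qed

text \<open>Both rest on the fact that one factor may lack a derivative. For \<open>NF\<close> the
  extra weight at k is moved to an input by \<open>jp_triple_sum\<close>; for \<open>NE\<close> the
  rough factor is \<open>nl a\<close>, bounded in H^(s-1) with R^3, whence R^5. The constant does
  not depend on F, so F may vary with k.\<close>

lemma NF_NE_bounds:
  "\<exists>C\<ge>0. \<forall>F k s R a. finite F \<longrightarrow> 1 \<le> s \<longrightarrow> h_bounded s R a \<longrightarrow>
     jp k powr (s + 1) * cmod (NF F a k) \<le> C * R ^ 3 \<and> jp k powr s * cmod (NE F a k) \<le> C * R ^ 5"
proof -
  obtain C where C1: "0 \<le> C" and *: "\<forall>k S s R D x y z. finite S \<longrightarrow> 1 \<le> s \<longrightarrow>
    (h_bounded (s - 1) D x \<and> h_bounded s R y \<and> h_bounded s R z \<or>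
     h_bounded s R x \<and> h_bounded (s - 1) D y \<and> h_bounded s R z \<or>
     h_bounded s R x \<and> h_bounded s R y \<and> h_bounded (s - 1) D z) \<longrightarrow>
    jp k powr s * (\<Sum>(p, r)\<in>S. cmod (cf k (p, r)) * (cmod (x p) * cmod (y (p + r - k)) * cmod (z r)))
      \<le> C * (D * R\<^sup>2)"
    using normal_form_bound by (elim exE conjE)
  note C = C1 *[rule_format]
  define C' where "C' = 3 * C + 3 * C * (54 * C0)"
  have b1: "jp k powr (s + 1) * cmod (NF F a k) \<le> C' * R ^ 3"
    if F: "finite F" and s: "1 \<le> s" and a: "h_bounded s R a" for F k s R a
  proof -
    let ?d = "\<lambda>k. of_real (jp k) * a k :: complex"
    have R: "0 \<le> R" using a by (rule h_bounded_nonneg)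
    have d: "h_bounded (s - 1) R ?d" using a by (rule h_bounded_deriv)
    have "jp k * cmod (NF F a k) \<le> jp k * (\<Sum>(p, r)\<in>F. cmod (cf k (p, r)) * (cmod (a p) * cmod (a (p + r - k)) * cmod (a r)))"
    proof (rule mult_left_mono)
      show "cmod (NF F a k) \<le> (\<Sum>(p, r)\<in>F. cmod (cf k (p, r)) * (cmod (a p) * cmod (a (p + r - k)) * cmod (a r)))"
        unfolding NF_def using norm_sum[of "\<lambda>(p, r). cf k (p, r) * (a p * cnj (a (p + r - k)) * a r)" F]
        by (simp add: norm_mult split_def)
    qed simp
    also have "\<dots> \<le> (\<Sum>(p, r)\<in>F. cmod (cf k (p, r)) * (cmod (?d p) * cmod (a (p + r - k)) * cmod (a r)))
       + (\<Sum>(p, r)\<in>F. cmod (cf k (p, r)) * (cmod (a p) * cmod (?d (p + r - k)) * cmod (a r)))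
       + (\<Sum>(p, r)\<in>F. cmod (cf k (p, r)) * (cmod (a p) * cmod (a (p + r - k)) * cmod (?d r)))"
      unfolding sum_distrib_left sum.distrib[symmetric]
    proof (intro sum_mono, clarify)
      fix p r assume "(p, r) \<in> F"
      let ?P = "cmod (cf k (p, r)) * (cmod (a p) * cmod (a (p + r - k)) * cmod (a r))"
      have "jp k * ?P \<le> (jp p + jp (p + r - k) + jp r) * ?P"
        by (intro mult_right_mono jp_triple_sum) auto
      then show "jp k * ?P \<le> cmod (cf k (p, r)) * (cmod (?d p) * cmod (a (p + r - k)) * cmod (a r))
       + cmod (cf k (p, r)) * (cmod (a p) * cmod (?d (p + r - k)) * cmod (a r))
       + cmod (cf k (p, r)) * (cmod (a p) * cmod (a (p + r - k)) * cmod (?d r))"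
        by (simp add: norm_mult algebra_simps)
    qed
    finally have "jp k powr s * (jp k * cmod (NF F a k)) \<le> jp k powr s * ((\<Sum>(p, r)\<in>F. cmod (cf k (p, r)) * (cmod (?d p) * cmod (a (p + r - k)) * cmod (a r)))
       + (\<Sum>(p, r)\<in>F. cmod (cf k (p, r)) * (cmod (a p) * cmod (?d (p + r - k)) * cmod (a r)))
       + (\<Sum>(p, r)\<in>F. cmod (cf k (p, r)) * (cmod (a p) * cmod (a (p + r - k)) * cmod (?d r))))"
      by (rule mult_left_mono) auto
    also have "\<dots> \<le> C * (R * R\<^sup>2) + C * (R * R\<^sup>2) + C * (R * R\<^sup>2)"
      unfolding distrib_left using a d by (intro add_mono C(2) F s) auto
    also have "\<dots> = 3 * C * R ^ 3" by (simp add: power2_eq_square power3_eq_cube)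
    also have "\<dots> \<le> C' * R ^ 3" using C(1) C0_nonneg R by (intro mult_right_mono) (auto simp: C'_def)
    finally show ?thesis by (simp add: powr_add mult.assoc)
  qed
  have b2: "jp k powr s * cmod (NE F a k) \<le> C' * R ^ 5"
    if F: "finite F" and s: "1 \<le> s" and a: "h_bounded s R a" for F k s R a
  proof -
    have R: "0 \<le> R" using a by (rule h_bounded_nonneg)
    have d: "h_bounded (s - 1) (54 * C0 * R ^ 3) (nl a)" using s a by (rule nl_l2)
    have "cmod (NE F a k) \<le> (\<Sum>x\<in>F. cmod (case x of (p, r) \<Rightarrow> cf k (p, r) * (nl a p * cnj (a (p + r - k)) * a r
     + a p * cnj (nl a (p + r - k)) * a r + a p * cnj (a (p + r - k)) * nl a r)))"
      unfolding NE_def by (rule norm_sum)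
    also have "\<dots> \<le> (\<Sum>(p, r)\<in>F. cmod (cf k (p, r)) * (cmod (nl a p) * cmod (a (p + r - k)) * cmod (a r)))
       + (\<Sum>(p, r)\<in>F. cmod (cf k (p, r)) * (cmod (a p) * cmod (nl a (p + r - k)) * cmod (a r)))
       + (\<Sum>(p, r)\<in>F. cmod (cf k (p, r)) * (cmod (a p) * cmod (a (p + r - k)) * cmod (nl a r)))"
      unfolding sum.distrib[symmetric]
    proof (intro sum_mono, clarsimp)
      fix p r assume "(p, r) \<in> F"
      let ?x = "nl a p * cnj (a (p + r - k)) * a r" and ?y = "a p * cnj (nl a (p + r - k)) * a r"
        and ?z = "a p * cnj (a (p + r - k)) * nl a r"
      have "cmod (?x + ?y + ?z) \<le> cmod ?x + cmod ?y + cmod ?z"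
        by (intro norm_triangle_le add_mono norm_triangle_ineq order_refl)
      then have "cmod (cf k (p, r)) * cmod (?x + ?y + ?z) \<le> cmod (cf k (p, r)) * (cmod ?x + cmod ?y + cmod ?z)"
        by (intro mult_left_mono) auto
      then show "cmod (cf k (p, r) * (?x + ?y + ?z)) \<le> cmod (cf k (p, r)) * (cmod (nl a p) * cmod (a (p + r - k)) * cmod (a r))
       + cmod (cf k (p, r)) * (cmod (a p) * cmod (nl a (p + r - k)) * cmod (a r))
       + cmod (cf k (p, r)) * (cmod (a p) * cmod (a (p + r - k)) * cmod (nl a r))"
        by (subst norm_mult) (simp only: norm_mult complex_mod_cnj distrib_left)
    qed
    finally have "jp k powr s * cmod (NE F a k) \<le> jp k powr s * ((\<Sum>(p, r)\<in>F. cmod (cf k (p, r)) * (cmod (nl a p) * cmod (a (p + r - k)) * cmod (a r)))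
       + (\<Sum>(p, r)\<in>F. cmod (cf k (p, r)) * (cmod (a p) * cmod (nl a (p + r - k)) * cmod (a r)))
       + (\<Sum>(p, r)\<in>F. cmod (cf k (p, r)) * (cmod (a p) * cmod (a (p + r - k)) * cmod (nl a r))))"
      by (rule mult_left_mono) auto
    also have "\<dots> \<le> C * (54 * C0 * R ^ 3 * R\<^sup>2) + C * (54 * C0 * R ^ 3 * R\<^sup>2) + C * (54 * C0 * R ^ 3 * R\<^sup>2)"
      unfolding distrib_left using a d by (intro add_mono C(2) F s) auto
    also have "\<dots> = 3 * C * (54 * C0) * R ^ 5" by (simp add: power2_eq_square numeral_eq_Suc)
    also have "\<dots> \<le> C' * R ^ 5" using C(1) C0_nonneg R by (intro mult_right_mono) (auto simp: C'_def)
    finally show ?thesis .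
  qed
  have "0 \<le> C'" using C(1) C0_nonneg by (simp add: C'_def)
  then show ?thesis using b1 b2 by blast
qed

end

section \<open>Decay of the Fourier coefficients\<close>

context raman
begin

text \<open>F is chosen before the sequence: the same finite set serves all times of all solutions
  in the ball, so the transformation stays a fixed finite sum that can be differentiated.\<close>

lemma nlt_truncation:
  assumes "0 < \<eta>" "0 \<le> R"
  shows "\<exists>F. finite F \<and> F \<subseteq> A \<and>
    (\<forall>a. h_bounded 1 R a \<longrightarrow> cmod (infsum (nlt a k) (A) - sum (nlt a k) F) \<le> \<eta>)"
proof -
  \<comment> \<open>Makes the bound of \<open>nlt_tail_bound\<close> at most \<eta>; the 1 keeps L
    positive.\<close>
  define L where "L = 36 * C0 * R ^ 3 / \<eta> + 1"
  have L: "0 < L" "36 * C0 * R ^ 3 / L \<le> \<eta>"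
  proof -
    have "0 \<le> 36 * C0 * R ^ 3 / \<eta>" using assms C0_nonneg by simp
    then show "0 < L" by (simp add: L_def)
    have "36 * C0 * R ^ 3 \<le> \<eta> * L" using assms by (simp add: L_def distrib_left)
    then show "36 * C0 * R ^ 3 / L \<le> \<eta>" using \<open>0 < L\<close> by (simp add: divide_le_eq)
  qed
  define K where "K = \<lceil>2 * L + \<bar>of_int k\<bar>\<rceil>"
  have K: "2 * L + \<bar>of_int k\<bar> \<le> of_int K" by (simp add: K_def)
  define F where "F = ({-K..K} \<times> {-K..K}) \<inter> A"
  have F: "finite F" "F \<subseteq> A" by (auto simp: F_def)
  have "cmod (infsum (nlt a k) (A) - sum (nlt a k) F) \<le> \<eta>" if a: "h_bounded 1 R a" for a
  proof -
    have "infsum (nlt a k) (A) = infsum (nlt a k) F + infsum (nlt a k) (A - F)"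
      using F infsum_Un_disjoint[OF nlt_summable(1)[OF a] nlt_summable(1)[OF a], of F "A - F" k]
      by (simp add: Un_absorb1)
    then have "infsum (nlt a k) (A) - sum (nlt a k) F = infsum (nlt a k) (A - F)"
      using F by simp
    also have "cmod \<dots> \<le> 36 * C0 * R ^ 3 / L"
    proof (rule abs_summable_bounded(3))
      fix S assume S: "finite S" "S \<subseteq> A - F"
      show "(\<Sum>x\<in>S. cmod (nlt a k x)) \<le> 36 * C0 * R ^ 3 / L"
      proof (rule nlt_tail_bound[OF a S(1) L(1) K])
        fix p r assume "(p, r) \<in> S"
        then have "(p, r) \<notin> {-K..K} \<times> {-K..K}" using S(2) by (auto simp: F_def)
        then have "K < \<bar>p\<bar> \<or> K < \<bar>r\<bar>" by auto
        then show "real_of_int K < \<bar>of_int p\<bar> \<or> real_of_int K < \<bar>of_int r\<bar>"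
          by (metis of_int_abs of_int_less_iff)
      qed
    qed
    finally show ?thesis using L(2) by linarith
  qed
  with F show ?thesis by blast
qed

text \<open>The difference c = a - NF solves c' = (i om + G) c + h with h = O(k^(-s)) and Re G at
  least of order k. By \<open>exp_growth_backward\<close>, c(0) is bounded by the forcing divided by
  the rate, O(k^(-s-1)), up to an exponentially small end-time term; \<open>NF\<close> is
  O(k^(-s-1)) itself.\<close>

lemma decay_forward:
  assumes s: "1 \<le> s" and m: "0 < m" and \<tau>: "0 < \<tau>" and R: "0 \<le> R"
  shows "\<exists>C\<ge>0. \<forall>a. fsol {0..\<tau>} a \<longrightarrow> (\<forall>t\<in>{0..\<tau>}. h_bounded s R (a t) \<and> m \<le> mass (a t)) \<longrightarrow>
    (\<forall>k\<ge>1. jp k powr (s + 1) * cmod (a 0 k) \<le> C)"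
proof -
  obtain Cn where Cn0: "0 \<le> Cn" and Cn: "\<forall>F k s R a. finite F \<longrightarrow> 1 \<le> s \<longrightarrow> h_bounded s R a \<longrightarrow>
     jp k powr (s + 1) * cmod (NF F a k) \<le> Cn * R ^ 3 \<and> jp k powr s * cmod (NE F a k) \<le> Cn * R ^ 5"
    using NF_NE_bounds by (elim exE conjE)
  define MB where "MB = Cn * R ^ 3"
  \<comment> \<open>The three parts of the forcing: \<open>G\<close> times \<open>NF\<close>, where
    the weight k of \<open>G\<close> is paid by the extra derivative of \<open>NF\<close>; the
    truncation error; and \<open>NE\<close>.\<close>
  define H0 where "H0 = 4 * C0 * R\<^sup>2 * MB + 1 + Cn * R ^ 5"
  \<comment> \<open>\<open>G_lower\<close> gives \<Gamma>/(2 pi) times m k - R^2, which is at least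
    m k/2 once k \<ge> 2 R^2/m; replacing k by jp k \<le> 2 k costs another factor 2.\<close>
  define l0 where "l0 = \<Gamma> * m / (8 * pi)"
  define R1 where "R1 = R + MB"
  have nn: "0 \<le> MB" "0 \<le> H0" "0 < l0" "0 \<le> R1"
    using Cn0 R C0_nonneg Gamma_pos m by (auto simp: MB_def H0_def l0_def R1_def)
  have "\<exists>C\<ge>0. \<forall>y\<ge>1. y powr (2 * (s + 1)) * exp (- (l0 * \<tau>) * y) \<le> C"
    using nn \<tau> by (intro powr_times_exp_bounded) auto
  then obtain C2 where C2: "0 \<le> C2" "\<And>y. 1 \<le> y \<Longrightarrow> y powr (2 * (s + 1)) * exp (- (l0 * \<tau>) * y) \<le> C2"
    by blast
  define Cc where "Cc = sqrt ((H0 / l0)\<^sup>2 + C2 * R1\<^sup>2)"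
  define Cs where "Cs = (1 + 2 * R\<^sup>2 / m) powr (s + 1) * R"
  have large: "jp k powr (s + 1) * cmod (a 0 k) \<le> Cc + MB"
    if sol: "fsol {0..\<tau>} a" and b: "\<And>t. t \<in> {0..\<tau>} \<Longrightarrow> h_bounded s R (a t)"
      and ms: "\<And>t. t \<in> {0..\<tau>} \<Longrightarrow> m \<le> mass (a t)" and k: "1 \<le> k" "2 * R\<^sup>2 / m \<le> of_int k" for a k
  proof -
    have b1: "h_bounded 1 R (a t)" if "t \<in> {0..\<tau>}" for t
      using b[OF that] s by (rule h_bounded_mono)
    define y where "y = jp k"
    have y: "1 \<le> y" by (simp add: y_def jp_ge1)
    have "0 < y powr (- s)" using y by simp
    \<comment> \<open>The truncation depends on k: its error is matched to the size k^(-s) of the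
      other forcing terms.\<close>
    then obtain F where F: "finite F" "F \<subseteq> NR k"
      "\<And>a. h_bounded 1 R a \<Longrightarrow> cmod (infsum (nlt a k) (NR k) - sum (nlt a k) F) \<le> y powr (- s)"
      using nlt_truncation[OF _ R, of "y powr (- s)" "NR k" k] by blast
    have NFb: "cmod (NF F (a t) k) \<le> MB * y powr (- (s + 1))"
      and NEb: "cmod (NE F (a t) k) \<le> Cn * R ^ 5 * y powr (- s)" if "t \<in> {0..\<tau>}" for t
    proof -
      have "y powr (s + 1) * cmod (NF F (a t) k) \<le> MB" "y powr s * cmod (NE F (a t) k) \<le> Cn * R ^ 5"
        using Cn[rule_format, OF F(1) s b[OF that], of k] unfolding y_def[symmetric] MB_def by auto
      then show "cmod (NF F (a t) k) \<le> MB * y powr (- (s + 1))"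
        "cmod (NE F (a t) k) \<le> Cn * R ^ 5 * y powr (- s)"
        using y unfolding powr_minus_divide by (simp_all add: pos_le_divide_eq mult.commute)
    qed
    define c where "c = (\<lambda>t. a t k - NF F (a t) k)"
    define g where "g = (\<lambda>t. \<i> * of_real (om k) + G (a t) k)"
    \<comment> \<open>\<open>G\<close> times \<open>NF\<close> appears because \<open>G\<close>
      multiplies a = c + NF.\<close>
    define h where "h = (\<lambda>t. G (a t) k * NF F (a t) k + (infsum (nlt (a t) k) (NR k) - sum (nlt (a t) k) F) - NE F (a t) k)"
    define H where "H = H0 * y powr (- s)"
    have "(cmod (c 0))\<^sup>2 \<le> (H / (l0 * y))\<^sup>2 + exp (- (l0 * y) * \<tau>) * (cmod (c \<tau>))\<^sup>2"
    proof (rule exp_growth_backward[where g = g and h = h])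
      show "0 < \<tau>" "0 < l0 * y" using \<tau> nn y by auto
      fix t assume t: "t \<in> {0..\<tau>}"
      have "((\<lambda>t. a t k) has_vector_derivative (\<i> * of_real (om k) * a t k + nl (a t) k)) (at t within {0..\<tau>})"
        using sol t by (simp add: fsol_def)
      from has_vector_derivative_diff[OF this NF_derivative[OF sol t F(2)]]
      show "(c has_vector_derivative g t * c t + h t) (at t within {0..\<tau>})"
        unfolding c_def
        by (rule has_vector_derivative_eq_rhs) (simp add: g_def h_def nl_split[OF b1[OF t]] algebra_simps)
      have "m * of_int k / 2 \<le> of_int k * mass (a t) - R\<^sup>2"
      proof -
        have "R\<^sup>2 \<le> m * of_int k / 2" using k m by (simp add: field_simps)
        moreover have "of_int k * m \<le> of_int k * mass (a t)"
          using ms[OF t] k by (intro mult_left_mono) auto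
        ultimately show ?thesis by (simp add: mult.commute)
      qed
      then have "\<Gamma> / (2 * pi) * (m * of_int k / 2) \<le> \<Gamma> / (2 * pi) * (of_int k * mass (a t) - R\<^sup>2)"
        using Gamma_pos by (intro mult_left_mono) auto
      also have "\<dots> \<le> Re (G (a t) k)" by (rule G_lower[OF b1[OF t]])
      also have "\<dots> = Re (g t)" by (simp add: g_def)
      finally have lo: "\<Gamma> / (2 * pi) * (m * of_int k / 2) \<le> Re (g t)" .
      have "l0 * y \<le> l0 * (2 * of_int k)" using k nn by (intro mult_left_mono) (auto simp: y_def jp_def)
      also have "\<dots> = \<Gamma> / (2 * pi) * (m * of_int k / 2)" by (simp add: l0_def)
      finally show "l0 * y \<le> Re (g t)" using lo by linarith
      have "cmod (G (a t) k * NF F (a t) k) \<le> (4 * C0 * y * R\<^sup>2) * (MB * y powr (- (s + 1)))"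
        unfolding norm_mult using G_upper[OF b1[OF t], of k] NFb[OF t]
        by (intro mult_mono) (auto simp: y_def C0_nonneg)
      also have "\<dots> = 4 * C0 * R\<^sup>2 * MB * y powr (- s)"
        using y by (simp add: powr_diff powr_minus field_simps)
      finally have 1: "cmod (G (a t) k * NF F (a t) k) \<le> 4 * C0 * R\<^sup>2 * MB * y powr (- s)" .
      have "cmod (h t) \<le> cmod (G (a t) k * NF F (a t) k)
         + cmod (infsum (nlt (a t) k) (NR k) - sum (nlt (a t) k) F) + cmod (NE F (a t) k)"
        unfolding h_def by (meson norm_triangle_le_diff norm_triangle_ineq add_right_mono order_trans order_refl)
      also have "\<dots> \<le> 4 * C0 * R\<^sup>2 * MB * y powr (- s) + y powr (- s) + Cn * R ^ 5 * y powr (- s)"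
        by (intro add_mono 1 F(3) NEb b1 t)
      also have "\<dots> = H" by (simp add: H_def H0_def algebra_simps)
      finally show "cmod (h t) \<le> H" .
    qed
    moreover have "cmod (c \<tau>) \<le> R1"
    proof -
      have "cmod (c \<tau>) \<le> cmod (a \<tau> k) + cmod (NF F (a \<tau>) k)" unfolding c_def by (rule norm_triangle_ineq4)
      moreover have "cmod (a \<tau> k) \<le> R" using h_bounded_coeff[OF b[of \<tau>]] \<tau> s by simp
      moreover have "MB * y powr (- (s + 1)) \<le> MB * y powr 0"
        using y s nn by (intro mult_left_mono powr_mono) auto
      ultimately show ?thesis using NFb[of \<tau>] \<tau> y by (simp add: R1_def)
    qed
    ultimately have c0: "(cmod (c 0))\<^sup>2 \<le> (H / (l0 * y))\<^sup>2 + exp (- (l0 * \<tau>) * y) * R1\<^sup>2"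
    proof -
      assume 1: "(cmod (c 0))\<^sup>2 \<le> (H / (l0 * y))\<^sup>2 + exp (- (l0 * y) * \<tau>) * (cmod (c \<tau>))\<^sup>2"
        and 2: "cmod (c \<tau>) \<le> R1"
      have "exp (- (l0 * y) * \<tau>) * (cmod (c \<tau>))\<^sup>2 \<le> exp (- (l0 * y) * \<tau>) * R1\<^sup>2"
        using 2 by (intro mult_left_mono power_mono) auto
      moreover have e: "- (l0 * y) * \<tau> = - (l0 * \<tau>) * y" by simp
      ultimately show ?thesis using 1 unfolding e by linarith
    qed
    have "(y powr (s + 1) * cmod (c 0))\<^sup>2 = (y powr (s + 1))\<^sup>2 * (cmod (c 0))\<^sup>2" by (rule power_mult_distrib)
    also have "\<dots> \<le> (y powr (s + 1))\<^sup>2 * ((H / (l0 * y))\<^sup>2 + exp (- (l0 * \<tau>) * y) * R1\<^sup>2)"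
      using c0 by (intro mult_left_mono) auto
    also have "\<dots> = (y powr (s + 1) * (H / (l0 * y)))\<^sup>2 + ((y powr (s + 1))\<^sup>2 * exp (- (l0 * \<tau>) * y)) * R1\<^sup>2"
      unfolding power_mult_distrib[of "y powr (s + 1)" "H / (l0 * y)"] by (simp only: distrib_left mult.assoc)
    also have "y powr (s + 1) * (H / (l0 * y)) = H0 / l0"
      using y by (simp add: H_def powr_add powr_minus field_simps)
    also have "(y powr (s + 1))\<^sup>2 = y powr (2 * (s + 1))"
      using y by (simp add: power2_eq_square powr_add[symmetric])
    also have "(H0 / l0)\<^sup>2 + y powr (2 * (s + 1)) * exp (- (l0 * \<tau>) * y) * R1\<^sup>2 \<le> (H0 / l0)\<^sup>2 + C2 * R1\<^sup>2"
      using C2(2)[OF y] by (intro add_left_mono mult_right_mono) auto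
    finally have "y powr (s + 1) * cmod (c 0) \<le> Cc"
      unfolding Cc_def by (rule real_le_rsqrt)
    moreover have "y powr (s + 1) * cmod (NF F (a 0) k) \<le> MB"
      using NFb[of 0] \<tau> y unfolding powr_minus_divide by (simp add: pos_le_divide_eq mult.commute)
    moreover have "y powr (s + 1) * cmod (a 0 k) \<le> y powr (s + 1) * cmod (c 0) + y powr (s + 1) * cmod (NF F (a 0) k)"
    proof -
      have "cmod (a 0 k) \<le> cmod (c 0) + cmod (NF F (a 0) k)"
        using norm_triangle_ineq[of "c 0" "NF F (a 0) k"] by (simp add: c_def)
      then show ?thesis unfolding distrib_left[symmetric] by (intro mult_left_mono) auto
    qed
    ultimately show ?thesis unfolding y_def by linarith
  qed
  \<comment> \<open>Below the threshold 2 R^2/m growth is not guaranteed; these modes are finitely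
    many and bounded trivially.\<close>
  have small: "jp k powr (s + 1) * cmod (a 0 k) \<le> Cs"
    if "h_bounded s R (a 0)" and k: "1 \<le> k" "of_int k < 2 * R\<^sup>2 / m" for a :: "real \<Rightarrow> int \<Rightarrow> complex" and k
  proof -
    have "jp k powr (s + 1) \<le> (1 + 2 * R\<^sup>2 / m) powr (s + 1)"
      using k s by (intro powr_mono2) (auto simp: jp_def)
    then show ?thesis unfolding Cs_def using h_bounded_coeff[OF that(1), of k] s by (intro mult_mono) auto
  qed
  have Cp: "0 \<le> Cc + MB" "0 \<le> Cs" using nn C2 R by (auto simp: Cc_def Cs_def)
  show ?thesis
  proof (intro exI[of _ "Cc + MB + Cs"] conjI allI impI)
    show "0 \<le> Cc + MB + Cs" using Cp by simp
    fix a k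
    assume A: "fsol {0..\<tau>} a" "\<forall>t\<in>{0..\<tau>}. h_bounded s R (a t) \<and> m \<le> mass (a t)" "(1 :: int) \<le> k"
    show "jp k powr (s + 1) * cmod (a 0 k) \<le> Cc + MB + Cs"
    proof (cases "of_int k < 2 * R\<^sup>2 / m")
      case True
      then show ?thesis using small[of a k] A Cp \<tau> by force
    next
      case False
      then show ?thesis using large[of a k] A Cp by force
    qed
  qed
qed

lemma fsol_shift:
  assumes "fsol {l..r} a" "l \<le> t0" "t0 + \<tau> \<le> r"
  shows "fsol {0..\<tau>} (\<lambda>t. a (t0 + t))"
  unfolding fsol_def
proof (intro ballI allI)
  fix t k assume t: "t \<in> {0..\<tau>}"
  have "((\<lambda>t. a t k) has_vector_derivative (\<i> * of_real (om k) * a (t0 + t) k + nl (a (t0 + t)) k))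
     (at (t0 + t) within {l..r})" using assms t by (auto simp: fsol_def)
  then have "((\<lambda>t. a t k) has_vector_derivative (\<i> * of_real (om k) * a (t0 + t) k + nl (a (t0 + t)) k))
     (at (t0 + t) within (\<lambda>t. t0 + t) ` {0..\<tau>})"
    by (rule has_vector_derivative_within_subset) (use assms in auto)
  moreover have "((\<lambda>t. t0 + t) has_vector_derivative 1) (at t within {0..\<tau>})"
    by (auto intro!: derivative_eq_intros)
  ultimately have "((\<lambda>t. a t k) \<circ> (\<lambda>t. t0 + t) has_vector_derivative
     1 *\<^sub>R (\<i> * of_real (om k) * a (t0 + t) k + nl (a (t0 + t)) k)) (at t within {0..\<tau>})"
    by (intro vector_diff_chain_within)
  then show "((\<lambda>t. a (t0 + t) k) has_vector_derivative (\<i> * of_real (om k) * a (t0 + t) k + nl (a (t0 + t)) k))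
     (at t within {0..\<tau>})" by (simp add: o_def)
qed

lemma fsol_subset: "fsol I a \<Longrightarrow> J \<subseteq> I \<Longrightarrow> fsol J a"
  unfolding fsol_def by (blast intro: has_vector_derivative_within_subset)

text \<open>The H^1 bound confines at least m/2 to a finite set X of modes determined by m and R. On
  X each squared modulus changes at a bounded rate, so at most m/4 is lost within a time \<theta>
  that also depends only on m and R.\<close>

lemma mass_persists:
  assumes m: "0 < m" and R: "0 \<le> R"
  shows "\<exists>\<theta>>0. \<forall>a T. fsol {0..T} a \<longrightarrow> (\<forall>t\<in>{0..T}. h_bounded 1 R (a t)) \<longrightarrow> m \<le> mass (a 0) \<longrightarrow>
    (\<forall>t\<in>{0..T}. t \<le> \<theta> \<longrightarrow> m / 4 \<le> mass (a t))"
proof -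
  define K where "K = nat \<lceil>2 * R\<^sup>2 / m\<rceil>"
  define X where "X = {- int K..int K}"
  define D where "D = 36 * C0 * R ^ 4"
  define \<theta> where "\<theta> = m / 4 / (real (card X) * D + 1)"
  have D0: "0 \<le> D" using C0_nonneg R by (simp add: D_def)
  have den: "0 < real (card X) * D + 1" using D0 by (intro add_nonneg_pos) auto
  have "m / 4 \<le> mass (a t)"
    if sol: "fsol {0..T} a" and b: "\<And>t. t \<in> {0..T} \<Longrightarrow> h_bounded 1 R (a t)" and ms: "m \<le> mass (a 0)"
      and t: "t \<in> {0..T}" "t \<le> \<theta>" for a T t
  proof -
    define S where "S = (\<lambda>t. \<Sum>k\<in>X. (cmod (a t k))\<^sup>2)"
    have t0: "0 \<in> {0..T}" using t by auto
    have low: "m / 2 \<le> S 0"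
    proof -
      have A: "l2_bounded (\<lambda>k. jp k * cmod (a 0 k)) R" using b[OF t0] by (simp add: h_bounded_def)
      have sumr: "(\<lambda>k. (cmod (a 0 k))\<^sup>2) summable_on A" for A using h_bounded_mass(1)[OF b[OF t0]] by simp
      have "mass (a 0) = infsum (\<lambda>k. (cmod (a 0 k))\<^sup>2) (X \<union> - X)" by (simp add: mass_def)
      also have "\<dots> = S 0 + (\<Sum>\<^sub>\<infinity>k\<in>-X. (cmod (a 0 k))\<^sup>2)"
        by (subst infsum_Un_disjoint) (auto simp: sumr S_def X_def)
      finally have eq: "mass (a 0) = S 0 + (\<Sum>\<^sub>\<infinity>k\<in>-X. (cmod (a 0 k))\<^sup>2)" .
      have "(\<Sum>\<^sub>\<infinity>k\<in>-X. (cmod (a 0 k))\<^sup>2) \<le> (\<Sum>\<^sub>\<infinity>k\<in>-X. (jp k * cmod (a 0 k))\<^sup>2 * (1 / (1 + real K)))"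
      proof (rule infsum_mono)
        show "(\<lambda>k. (jp k * cmod (a 0 k))\<^sup>2 * (1 / (1 + real K))) summable_on - X"
          by (intro summable_on_cmult_left l2_bounded_summable[OF A])
        fix k assume "k \<in> - X"
        then have "int K \<le> \<bar>k\<bar>" by (auto simp: X_def)
        then have "1 + real K \<le> jp k" unfolding jp_def
          by (metis add_left_mono of_int_abs of_int_le_iff of_int_of_nat_eq)
        also have "\<dots> \<le> (jp k)\<^sup>2" using jp_ge1[of k] by (rule self_le_power) simp
        finally have "(cmod (a 0 k))\<^sup>2 * (1 + real K) \<le> (cmod (a 0 k))\<^sup>2 * (jp k)\<^sup>2"
          by (rule mult_left_mono) simp
        then show "(cmod (a 0 k))\<^sup>2 \<le> (jp k * cmod (a 0 k))\<^sup>2 * (1 / (1 + real K))"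
          by (simp add: field_simps power_mult_distrib)
      qed (rule sumr)
      also have "\<dots> = (\<Sum>\<^sub>\<infinity>k\<in>-X. (jp k * cmod (a 0 k))\<^sup>2) * (1 / (1 + real K))"
        by (rule infsum_cmult_left')
      also have "\<dots> \<le> R\<^sup>2 * (1 / (1 + real K))"
        by (intro mult_right_mono l2_bounded_summable(2)[OF A]) auto
      also have "\<dots> \<le> m / 2"
      proof -
        have "2 * R\<^sup>2 / m \<le> 1 + real K" unfolding K_def by linarith
        then show ?thesis using m by (simp add: field_simps)
      qed
      finally show ?thesis using eq ms by linarith
    qed
    have der: "(S has_vector_derivative (\<Sum>k\<in>X. 2 * (a u k \<bullet> (\<i> * of_real (om k) * a u k + nl (a u) k)))) (at u within {0..T})"
      if u: "u \<in> {0..T}" for u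
      unfolding S_def power2_norm_eq_inner
    proof (rule has_vector_derivative_sum)
      fix k
      have "((\<lambda>t. a t k) has_vector_derivative (\<i> * of_real (om k) * a u k + nl (a u) k)) (at u within {0..T})"
        using sol u by (simp add: fsol_def)
      then have "((\<lambda>t. a t k \<bullet> a t k) has_derivative (\<lambda>x. a u k \<bullet> (x *\<^sub>R (\<i> * of_real (om k) * a u k + nl (a u) k))
          + (x *\<^sub>R (\<i> * of_real (om k) * a u k + nl (a u) k)) \<bullet> a u k)) (at u within {0..T})"
        unfolding has_vector_derivative_def by (intro has_derivative_inner)
      then show "((\<lambda>t. a t k \<bullet> a t k) has_vector_derivative 2 * (a u k \<bullet> (\<i> * of_real (om k) * a u k + nl (a u) k))) (at u within {0..T})"
        unfolding has_vector_derivative_def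
        by (rule has_derivative_eq_rhs) (auto simp: fun_eq_iff inner_commute)
    qed
    have "norm (S t - S 0) \<le> real (card X) * D * norm (t - 0)"
    proof (rule differentiable_bound)
      show "convex {0..T}" by (rule convex_real_interval)
      show "(S has_derivative (\<lambda>h. h *\<^sub>R (\<Sum>k\<in>X. 2 * (a u k \<bullet> (\<i> * of_real (om k) * a u k + nl (a u) k))))) (at u within {0..T})"
        if "u \<in> {0..T}" for u using der[OF that] by (simp add: has_vector_derivative_def)
      fix u assume u: "u \<in> {0..T}"
      have "\<bar>\<Sum>k\<in>X. 2 * (a u k \<bullet> (\<i> * of_real (om k) * a u k + nl (a u) k))\<bar>
         \<le> (\<Sum>k\<in>X. \<bar>2 * (a u k \<bullet> (\<i> * of_real (om k) * a u k + nl (a u) k))\<bar>)" by (rule sum_abs)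
      also have "\<dots> \<le> (\<Sum>k\<in>X. D)"
      proof (rule sum_mono)
        fix k
        \<comment> \<open>The dispersive part only rotates the coefficient, so the cubic growth of
          \<open>om\<close> does not enter the rate.\<close>
        have "a u k \<bullet> (\<i> * of_real (om k) * a u k + nl (a u) k) = a u k \<bullet> nl (a u) k"
          by (simp add: inner_complex_def algebra_simps)
        moreover have "\<bar>a u k \<bullet> nl (a u) k\<bar> \<le> cmod (a u k) * cmod (nl (a u) k)" by (rule Cauchy_Schwarz_ineq2)
        moreover have "cmod (a u k) * cmod (nl (a u) k) \<le> R * (18 * C0 * R ^ 3)"
          using h_bounded_coeff[OF b[OF u], of k] nl_bound[OF b[OF u], of k] R by (intro mult_mono) auto
        moreover have "R * (18 * C0 * R ^ 3) * 2 = D" by (simp add: D_def numeral_eq_Suc)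
        ultimately show "\<bar>2 * (a u k \<bullet> (\<i> * of_real (om k) * a u k + nl (a u) k))\<bar> \<le> D"
          by (simp add: abs_mult)
      qed
      finally have "\<bar>\<Sum>k\<in>X. 2 * (a u k \<bullet> (\<i> * of_real (om k) * a u k + nl (a u) k))\<bar> \<le> real (card X) * D" by simp
      then show "onorm (\<lambda>h. h *\<^sub>R (\<Sum>k\<in>X. 2 * (a u k \<bullet> (\<i> * of_real (om k) * a u k + nl (a u) k)))) \<le> real (card X) * D"
        by (intro onorm_bound) (auto simp: abs_mult mult.commute mult_left_mono D0)
    qed (use t t0 in auto)
    then have "S 0 - S t \<le> real (card X) * D * t" using t by simp
    also have "\<dots> \<le> real (card X) * D * \<theta>" using t D0 by (intro mult_left_mono) auto
    also have "\<dots> \<le> (real (card X) * D + 1) * \<theta>"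
      using m den by (intro mult_right_mono) (auto simp: \<theta>_def)
    also have "\<dots> = m / 4" 
    proof -
      have "x * (m / 4 / x) = m / 4" if "0 < x" for x using that by simp
      from this[OF den] show ?thesis unfolding \<theta>_def .
    qed
    finally have "m / 4 \<le> S t" using low by linarith
    also have "S t \<le> mass (a t)" unfolding S_def mass_def
      using h_bounded_mass(1)[OF b[OF t(1)], of UNIV] by (intro finite_sum_le_infsum) (auto simp: X_def)
    finally show ?thesis .
  qed
  moreover have "0 < \<theta>" using m den by (simp add: \<theta>_def)
  ultimately show ?thesis by blast
qed

end

section \<open>Reversal of time and space\<close>

lemma raman_reflect: "raman \<alpha>\<^sub>1 \<alpha>\<^sub>2 \<Gamma> \<Longrightarrow> raman \<alpha>\<^sub>1 (- \<alpha>\<^sub>2) \<Gamma>"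
  unfolding raman_def using Ints_minus[of "- (2 * \<alpha>\<^sub>2 / (3 * \<alpha>\<^sub>1))"] by auto

text \<open>The reflection changes the signs of \<open>\<alpha>\<^sub>2\<close> and
  \<open>\<gamma>\<^sub>1\<close> but keeps that of \<Gamma>. So forward growth of positive modes
  for the reflected equation is backward growth of negative modes for the original one.\<close>

lemma fsol_reflect:
  assumes par: "raman \<alpha>\<^sub>1 \<alpha>\<^sub>2 \<Gamma>" and sol: "raman.fsol \<alpha>\<^sub>1 \<alpha>\<^sub>2 \<gamma>\<^sub>1 \<gamma>\<^sub>2 \<Gamma> I a"
  shows "raman.fsol \<alpha>\<^sub>1 (- \<alpha>\<^sub>2) (- \<gamma>\<^sub>1) \<gamma>\<^sub>2 \<Gamma> (uminus ` I) (\<lambda>t k. a (- t) (- k))"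
proof -
  interpret A: raman \<alpha>\<^sub>1 \<alpha>\<^sub>2 \<gamma>\<^sub>1 \<gamma>\<^sub>2 \<Gamma> by (rule par)
  interpret B: raman \<alpha>\<^sub>1 "- \<alpha>\<^sub>2" "- \<gamma>\<^sub>1" \<gamma>\<^sub>2 \<Gamma> by (rule raman_reflect[OF par])
  have om: "A.om (- k) = - B.om k" for k by (simp add: A.om_def B.om_def)
  have mu: "B.mu k r = - A.mu (- k) (- r)" for k r
    by (simp add: A.mu_def B.mu_def complex_eq_iff right_diff_distrib diff_divide_distrib add_divide_distrib)
  have nl: "B.nl (\<lambda>k. c (- k)) k = - A.nl c (- k)" for c k
  proof -
    have "B.nl (\<lambda>k. c (- k)) k = (\<Sum>\<^sub>\<infinity>x. - A.nlt c (- k) x)"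
      unfolding B.nl_def
      by (rule infsum_reindex_bij_witness[of _ "\<lambda>(p, r). (- p, - r)" "\<lambda>(p, r). (- p, - r)"])
        (auto simp: A.nlt_def B.nlt_def mu algebra_simps)
    then show ?thesis by (simp add: infsum_uminus A.nl_def)
  qed
  show ?thesis
    unfolding B.fsol_def
  proof (intro ballI allI)
    fix t k assume t: "t \<in> uminus ` I"
    have "((\<lambda>t. a t (- k)) has_vector_derivative (\<i> * of_real (A.om (- k)) * a (- t) (- k) + A.nl (a (- t)) (- k)))
       (at (- t) within I)" using sol t by (auto simp: A.fsol_def)
    then have "((\<lambda>t. a t (- k)) has_vector_derivative (\<i> * of_real (A.om (- k)) * a (- t) (- k) + A.nl (a (- t)) (- k)))
       (at (- t) within uminus ` uminus ` I)" by (simp add: image_image)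
    moreover have "(uminus has_vector_derivative - 1) (at t within uminus ` I)"
      by (auto intro!: derivative_eq_intros)
    ultimately have "((\<lambda>t. a t (- k)) \<circ> uminus has_vector_derivative
       - 1 *\<^sub>R (\<i> * of_real (A.om (- k)) * a (- t) (- k) + A.nl (a (- t)) (- k))) (at t within uminus ` I)"
      by (intro vector_diff_chain_within)
    then show "((\<lambda>t. a (- t) (- k)) has_vector_derivative
       (\<i> * of_real (B.om k) * a (- t) (- k) + B.nl (\<lambda>k. a (- t) (- k)) k)) (at t within uminus ` I)"
      by (simp add: o_def om nl)
  qed
qed

lemma h_bounded_reflect: "h_bounded s R a \<Longrightarrow> h_bounded s R (\<lambda>k. a (- k))"
  using l2_bounded_reindex[of "\<lambda>k. jp k powr s * cmod (a k)" R uminus]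
  by (simp add: h_bounded_def)

lemma mass_reflect: "mass (\<lambda>k. a (- k)) = mass a"
  unfolding mass_def by (rule infsum_reindex_bij_witness[of _ uminus uminus]) auto

context raman
begin

text \<open>The forward estimate for positive modes yields negative modes by the reflection \<open>(t, x) \<mapsto> (- t, - x)\<close>.\<close>

lemma decay_two_sided:
  assumes s: "1 \<le> s" and m: "0 < m" and \<tau>: "0 < \<tau>" and R: "0 \<le> R"
  shows "\<exists>R'\<ge>0. \<forall>a l r. fsol {l..r} a \<longrightarrow> (\<forall>t\<in>{l..r}. h_bounded s R (a t) \<and> m \<le> mass (a t)) \<longrightarrow>
    (\<forall>t\<in>{l + \<tau>..r - \<tau>}. (\<forall>k. jp k powr (s + 1) * cmod (a t k) \<le> R') \<and> h_bounded (s + 1 / 4) (3 * R') (a t))"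
proof -
  have par: "raman \<alpha>\<^sub>1 \<alpha>\<^sub>2 \<Gamma>" by unfold_locales
  interpret B: raman \<alpha>\<^sub>1 "- \<alpha>\<^sub>2" "- \<gamma>\<^sub>1" \<gamma>\<^sub>2 \<Gamma> by (rule raman_reflect[OF par])
  obtain C where C: "0 \<le> C" "\<And>a k. fsol {0..\<tau>} a \<Longrightarrow> (\<forall>t\<in>{0..\<tau>}. h_bounded s R (a t) \<and> m \<le> mass (a t)) \<Longrightarrow>
    1 \<le> k \<Longrightarrow> jp k powr (s + 1) * cmod (a 0 k) \<le> C"
    using decay_forward[OF assms] by blast
  obtain D where D: "0 \<le> D" "\<And>a k. B.fsol {0..\<tau>} a \<Longrightarrow> (\<forall>t\<in>{0..\<tau>}. h_bounded s R (a t) \<and> m \<le> mass (a t)) \<Longrightarrow>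
    1 \<le> k \<Longrightarrow> jp k powr (s + 1) * cmod (a 0 k) \<le> D"
    using B.decay_forward[OF assms] by blast
  define R' where "R' = C + D + R"
  have R': "0 \<le> R'" using C D R by (simp add: R'_def)
  have bound: "jp k powr (s + 1) * cmod (a t k) \<le> R'"
    if sol: "fsol {l..r} a" and b: "\<And>t. t \<in> {l..r} \<Longrightarrow> h_bounded s R (a t) \<and> m \<le> mass (a t)"
      and t: "t \<in> {l + \<tau>..r - \<tau>}" for a l r t k
  proof -
    consider "1 \<le> k" | "k = 0" | "1 \<le> - k" by linarith
    then show ?thesis
    proof cases
      case 1
      have "jp k powr (s + 1) * cmod (a (t + 0) k) \<le> C"
        by (rule C(2)[OF fsol_shift[OF sol] _ 1]) (use t b \<tau> in auto)
      then show ?thesis using D R by (simp add: R'_def)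
    next
      case 2
      have "cmod (a t k) \<le> R" using b[of t] t \<tau> s by (intro h_bounded_coeff) auto
      then show ?thesis using 2 C D by (simp add: R'_def jp_def)
    next
      \<comment> \<open>Negative modes: the reflected solution covers [t - \<tau>, t], run backwards
        from t.\<close>
      case 3
      have "B.fsol (uminus ` {t - \<tau>..t}) (\<lambda>t k. a (- t) (- k))"
        by (rule fsol_reflect[OF par]) (rule fsol_subset[OF sol], use t \<tau> in auto)
      then have "B.fsol {- t..- t + \<tau>} (\<lambda>t k. a (- t) (- k))" by simp
      then have sh: "B.fsol {0..\<tau>} (\<lambda>u k. a (- (- t + u)) (- k))"
        by (rule B.fsol_shift) auto
      have "jp (- k) powr (s + 1) * cmod (a (- (- t + 0)) (- (- k))) \<le> D"
        by (rule D(2)[OF sh _ 3]) (use t b \<tau> in \<open>auto intro: h_bounded_reflect simp: mass_reflect\<close>)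
      then show ?thesis using C R by (simp add: R'_def)
    qed
  qed
  \<comment> \<open>Turning pointwise decay into an l2 bound costs 3/4 of the gained derivative,
    because jp^(-3/2) has to be summable; 1/4 remains. The factor 3 is the square root of the bound
    9.\<close>
  have hb: "h_bounded (s + 1 / 4) (3 * R') c" if "\<And>k. jp k powr (s + 1) * cmod (c k) \<le> R'" for c
    unfolding h_bounded_def l2_bounded_def
  proof (intro conjI allI impI)
    fix X :: "int set" assume X: "finite X"
    have "(\<Sum>k\<in>X. (jp k powr (s + 1 / 4) * cmod (c k))\<^sup>2) \<le> (\<Sum>k\<in>X. R'\<^sup>2 * jp k powr (- 3 / 2))"
    proof (rule sum_mono)
      fix k
      have "jp k powr (s + 1 / 4) * cmod (c k) = jp k powr (- 3 / 4) * (jp k powr (s + 1) * cmod (c k))"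
      proof -
        have e: "s + 1 / 4 = - 3 / 4 + (s + 1)" by simp
        show ?thesis unfolding e powr_add by simp
      qed
      also have "\<dots> \<le> jp k powr (- 3 / 4) * R'" using that by (intro mult_left_mono) auto
      finally have "(jp k powr (s + 1 / 4) * cmod (c k))\<^sup>2 \<le> (jp k powr (- 3 / 4) * R')\<^sup>2"
        by (intro power_mono) auto
      also have "\<dots> = R'\<^sup>2 * jp k powr (- 3 / 2)"
        by (simp add: power2_eq_square powr_add[symmetric] mult.assoc mult.left_commute)
      finally show "(jp k powr (s + 1 / 4) * cmod (c k))\<^sup>2 \<le> R'\<^sup>2 * jp k powr (- 3 / 2)" .
    qed
    also have "\<dots> \<le> R'\<^sup>2 * 9"
      unfolding sum_distrib_left[symmetric] using X by (intro mult_left_mono jp_power_sum_bound) auto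
    finally show "(\<Sum>k\<in>X. (jp k powr (s + 1 / 4) * cmod (c k))\<^sup>2) \<le> (3 * R')\<^sup>2"
      by (simp add: power_mult_distrib)
  qed (use R' in auto)
  show ?thesis
  proof (intro exI[of _ R'] conjI allI impI ballI)
    fix a l r t
    assume A: "fsol {l..r} a" "\<forall>t\<in>{l..r}. h_bounded s R (a t) \<and> m \<le> mass (a t)" "t \<in> {l + \<tau>..r - \<tau>}"
    have *: "jp k powr (s + 1) * cmod (a t k) \<le> R'" for k
      by (rule bound[OF A(1) _ A(3)]) (use A(2) in blast)
    show "jp k powr (s + 1) * cmod (a t k) \<le> R'" for k by (rule *)
    show "h_bounded (s + 1 / 4) (3 * R') (a t)" by (rule hb) (rule *)
  qed (rule R')
qed

text \<open>Each use of \<open>decay_two_sided\<close> gains 1/4 of a derivative and gives up a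
  margin at both ends. Taking half of the remaining radius as margin keeps a neighbourhood of 0
  after any number of steps.\<close>

lemma smoothing:
  assumes m: "0 < m" and \<tau>: "0 < \<tau>" and R: "0 \<le> R"
  shows "\<exists>R'\<ge>0. \<forall>a. fsol {- \<tau>..\<tau>} a \<longrightarrow> (\<forall>t\<in>{- \<tau>..\<tau>}. h_bounded 1 R (a t) \<and> m \<le> mass (a t)) \<longrightarrow>
    (\<forall>t\<in>{- (\<tau> / 2 ^ n)..\<tau> / 2 ^ n}. h_bounded (1 + real n / 4) R' (a t))"
proof (induction n)
  case 0
  then show ?case using R by auto
next
  case (Suc n)
  then obtain R' where R': "0 \<le> R'" "\<And>a t. fsol {- \<tau>..\<tau>} a \<Longrightarrow> (\<forall>t\<in>{- \<tau>..\<tau>}. h_bounded 1 R (a t) \<and> m \<le> mass (a t)) \<Longrightarrow>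
    t \<in> {- (\<tau> / 2 ^ n)..\<tau> / 2 ^ n} \<Longrightarrow> h_bounded (1 + real n / 4) R' (a t)" by blast
  define d where "d = \<tau> / 2 ^ Suc n"
  have d: "0 < d" using \<tau> by (simp add: d_def)
  have d2: "\<tau> / 2 ^ n = 2 * d" by (simp add: d_def)
  have "2 * d \<le> \<tau> / 1" unfolding d2[symmetric] using \<tau> by (intro divide_left_mono) auto
  then have sub: "{- (2 * d)..2 * d} \<subseteq> {- \<tau>..\<tau>}" by auto
  have "1 \<le> 1 + real n / 4" by simp
  from decay_two_sided[OF this m d R'(1)] obtain R2 where R2: "0 \<le> R2" and
    *: "\<forall>a l r. fsol {l..r} a \<longrightarrow> (\<forall>t\<in>{l..r}. h_bounded (1 + real n / 4) R' (a t) \<and> m \<le> mass (a t)) \<longrightarrow>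
    (\<forall>t\<in>{l + d..r - d}. (\<forall>k. jp k powr (1 + real n / 4 + 1) * cmod (a t k) \<le> R2)
       \<and> h_bounded (1 + real n / 4 + 1 / 4) (3 * R2) (a t))"
    by (elim exE conjE)
  have "h_bounded (1 + real (Suc n) / 4) (3 * R2) (a t)"
    if sol: "fsol {- \<tau>..\<tau>} a" and b: "\<forall>t\<in>{- \<tau>..\<tau>}. h_bounded 1 R (a t) \<and> m \<le> mass (a t)"
      and t: "t \<in> {- d..d}" for a t
  proof -
    have "h_bounded (1 + real n / 4 + 1 / 4) (3 * R2) (a t)"
    proof (rule *[rule_format, THEN conjunct2])
      show "fsol {- (2 * d)..2 * d} a" using sol sub by (rule fsol_subset)
      show "h_bounded (1 + real n / 4) R' (a u) \<and> m \<le> mass (a u)" if "u \<in> {- (2 * d)..2 * d}" for u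
        using R'(2)[OF sol b] b sub that unfolding d2 by blast
    qed (use t in auto)
    then show ?thesis by (simp add: add_divide_distrib algebra_simps)
  qed
  with R2 show ?case unfolding d_def[symmetric] by (intro exI[of _ "3 * R2"] conjI allI impI ballI) auto
qed

end

section \<open>Fourier series on the torus\<close>

definition torus_measure :: "real measure" where
  "torus_measure = restrict_space lebesgue {0..2 * pi}"

lemma space_torus_measure [simp]: "space torus_measure = {0..2 * pi}"
  by (simp add: torus_measure_def)

lemma finite_measure_torus: "finite_measure torus_measure"
  by (rule finite_measureI) (simp add: torus_measure_def emeasure_restrict_space space_restrict_space)

lemma torus_integral_eq: "torus_integral f = integral\<^sup>L torus_measure f"
  unfolding torus_integral_def torus_measure_def set_lebesgue_integral_def
  by (subst integral_restrict_space) auto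

lemma set_integrable_torus_iff:
  fixes f :: "real \<Rightarrow> 'a :: {banach, second_countable_topology}"
  shows "set_integrable lebesgue {0..2 * pi} f \<longleftrightarrow> integrable torus_measure f"
  unfolding torus_measure_def by (subst set_integrable_eq) auto

lemma set_borel_measurable_torus_iff:
  fixes f :: "real \<Rightarrow> 'a :: real_normed_vector"
  shows "set_borel_measurable lebesgue {0..2 * pi} f \<longleftrightarrow> f \<in> borel_measurable torus_measure"
  unfolding torus_measure_def set_borel_measurable_def
  by (subst borel_measurable_restrict_space_iff) auto

lemma square_integrable_iff:
  "square_integrable f \<longleftrightarrow> f \<in> borel_measurable torus_measure \<and> integrable torus_measure (\<lambda>x. (cmod (f x))\<^sup>2)"
  by (simp add: square_integrable_def set_integrable_torus_iff set_borel_measurable_torus_iff)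

lemma AE_torus_iff: "(AE x in torus_measure. P x) \<longleftrightarrow> (AE x in lebesgue. x \<in> {0..2 * pi} \<longrightarrow> P x)"
  unfolding torus_measure_def by (subst AE_restrict_space_iff) auto

lemma borel_measurable_torus:
  fixes f :: "real \<Rightarrow> 'a :: topological_space"
  assumes "f \<in> borel_measurable borel"
  shows "f \<in> borel_measurable torus_measure"
  unfolding torus_measure_def using assms
  by (intro measurable_restrict_space1 measurable_completion) simp

lemma continuous_measurable_torus:
  fixes f :: "real \<Rightarrow> 'a :: topological_space"
  shows "continuous_on UNIV f \<Longrightarrow> f \<in> borel_measurable torus_measure"
  by (intro borel_measurable_torus borel_measurable_continuous_onI)

lemma integrable_mult_bounded:
  fixes f g :: "'a \<Rightarrow> complex"
  assumes f: "integrable M f" and g: "g \<in> borel_measurable M" and B: "\<And>x. x \<in> space M \<Longrightarrow> cmod (g x) \<le> B"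
  shows "integrable M (\<lambda>x. g x * f x)"
proof (rule Bochner_Integration.integrable_bound)
  show "integrable M (\<lambda>x. B * cmod (f x))" using f by simp
  show "(\<lambda>x. g x * f x) \<in> borel_measurable M" using f g by measurable
  show "AE x in M. norm (g x * f x) \<le> norm (B * cmod (f x))"
  proof (rule AE_I2)
    fix x assume "x \<in> space M"
    then have "cmod (g x) * cmod (f x) \<le> B * cmod (f x)" by (intro mult_right_mono B) auto
    then show "norm (g x * f x) \<le> norm (B * cmod (f x))" by (simp add: norm_mult)
  qed
qed

lemma square_integrable_integrable:
  assumes "square_integrable f"
  shows "integrable torus_measure f"
proof -
  interpret finite_measure torus_measure by (rule finite_measure_torus)
  show ?thesis
  proof (rule Bochner_Integration.integrable_bound)
    show "integrable torus_measure (\<lambda>x. 1 + (cmod (f x))\<^sup>2)"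
      using assms by (simp add: square_integrable_iff)
    show "f \<in> borel_measurable torus_measure" using assms by (simp add: square_integrable_iff)
    show "AE x in torus_measure. norm (f x) \<le> norm (1 + (cmod (f x))\<^sup>2)"
    proof (rule AE_I2)
      fix x
      have "0 \<le> (cmod (f x) - 1 / 2)\<^sup>2" by simp
      then have "cmod (f x) \<le> 1 + (cmod (f x))\<^sup>2" by (simp add: power2_eq_square algebra_simps)
      then show "norm (f x) \<le> norm (1 + (cmod (f x))\<^sup>2)" by simp
    qed
  qed
qed

definition ek :: "int \<Rightarrow> real \<Rightarrow> complex" where
  "ek k x = exp (\<i> * of_int k * of_real x)"

lemma norm_ek [simp]: "cmod (ek k x) = 1"
  by (simp add: ek_def norm_exp_eq_Re)

lemma ek_add: "ek (j + k) x = ek j x * ek k x"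
  by (simp add: ek_def exp_add[symmetric] algebra_simps)

lemma ek_0 [simp]: "ek 0 x = 1"
  by (simp add: ek_def)

lemma ek_cnj: "cnj (ek k x) = ek (- k) x"
  by (simp add: ek_def exp_cnj)

lemma continuous_ek: "continuous_on A (ek k)"
  unfolding ek_def by (intro continuous_intros)

lemma measurable_ek: "ek k \<in> borel_measurable torus_measure"
  by (rule continuous_measurable_torus[OF continuous_ek])

lemma integrable_ek_mult:
  "integrable torus_measure f \<Longrightarrow> integrable torus_measure (\<lambda>x. ek k x * f x)"
  by (rule integrable_mult_bounded[where B = 1]) (auto intro: measurable_ek)

lemma fourier_eq: "fourier f k = (\<integral>x. ek (- k) x * f x \<partial>torus_measure) / of_real (sqrt (2 * pi))"
  unfolding fourier_def torus_integral_eq ek_def by simp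

lemma fourier_ek_mult: "fourier (\<lambda>x. ek j x * f x) k = fourier f (k - j)"
  by (simp add: fourier_eq mult.assoc[symmetric] ek_add[symmetric])

lemma fourier_add:
  "integrable torus_measure f \<Longrightarrow> integrable torus_measure g \<Longrightarrow>
    fourier (\<lambda>x. f x + g x) k = fourier f k + fourier g k"
  by (simp add: fourier_eq distrib_left integrable_ek_mult add_divide_distrib)

lemma fourier_diff:
  "integrable torus_measure f \<Longrightarrow> integrable torus_measure g \<Longrightarrow>
    fourier (\<lambda>x. f x - g x) k = fourier f k - fourier g k"
  by (simp add: fourier_eq right_diff_distrib integrable_ek_mult diff_divide_distrib)

lemma fourier_cmult: "fourier (\<lambda>x. c * f x) k = c * fourier f k"
  by (simp add: fourier_eq mult.left_commute)

lemma fourier_cnj: "fourier (\<lambda>x. cnj (f x)) k = cnj (fourier f (- k))"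
proof -
  have "(\<integral>x. ek (- k) x * cnj (f x) \<partial>torus_measure) = (\<integral>x. cnj (ek k x * f x) \<partial>torus_measure)"
    by (simp add: ek_cnj)
  also have "\<dots> = cnj (\<integral>x. ek k x * f x \<partial>torus_measure)" 
    by (rule Bochner_Integration.integral_cnj)
  finally show ?thesis by (simp add: fourier_eq)
qed

lemma fourier_cong_AE:
  assumes "f \<in> borel_measurable torus_measure" "g \<in> borel_measurable torus_measure"
    and "AE x in torus_measure. f x = g x"
  shows "fourier f k = fourier g k"
proof -
  have "(\<integral>x. ek (- k) x * f x \<partial>torus_measure) = (\<integral>x. ek (- k) x * g x \<partial>torus_measure)"
    using assms measurable_ek by (intro integral_cong_AE) (auto elim: eventually_mono)
  then show ?thesis by (simp add: fourier_eq)
qed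

lemma norm_fourier_le:
  assumes "integrable torus_measure f"
  shows "cmod (fourier f k) \<le> (\<integral>x. cmod (f x) \<partial>torus_measure) / sqrt (2 * pi)"
proof -
  have "cmod (\<integral>x. ek (- k) x * f x \<partial>torus_measure) \<le> (\<integral>x. cmod (ek (- k) x * f x) \<partial>torus_measure)"
    by (rule integral_norm_bound)
  then show ?thesis by (simp add: fourier_eq norm_divide norm_mult divide_right_mono)
qed

section \<open>Uniqueness of Fourier coefficients\<close>

text \<open>On the circle a real-linear function is a combination of e^(ix) and e^(-ix), and
  multiplication by these only shifts coefficients. For a product one induction hypothesis is
  applied to f times the other factor, so f has to be generalized.\<close>

lemma fourier_zero_polynomial:
  assumes "real_polynomial_function p"
  shows "integrable torus_measure f \<Longrightarrow> (\<And>k. fourier f k = 0) \<Longrightarrow>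
    integrable torus_measure (\<lambda>x. of_real (p (cis x)) * f x) \<and> (\<forall>k. fourier (\<lambda>x. of_real (p (cis x)) * f x) k = 0)"
  using assms
proof (induction p arbitrary: f rule: real_polynomial_function.induct)
  case (linear p f)
  \<comment> \<open>The coefficients of cos x * p 1 + sin x * p \<i> in the two
    exponentials.\<close>
  define A B where "A = (of_real (p 1) - \<i> * of_real (p \<i>)) / 2" and "B = (of_real (p 1) + \<i> * of_real (p \<i>)) / 2"
  have "of_real (p (cis x)) = A * ek 1 x + B * ek (- 1) x" for x
  proof -
    have "cis x = cos x *\<^sub>R 1 + sin x *\<^sub>R \<i>" by (simp add: complex_eq_iff)
    then have "p (cis x) = p (cos x *\<^sub>R 1 + sin x *\<^sub>R \<i>)" by simp
    also have "\<dots> = cos x * p 1 + sin x * p \<i>"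
      using linear(1) by (simp add: bounded_linear.linear linear_add linear_scale)
    finally have "p (cis x) = cos x * p 1 + sin x * p \<i>" .
    moreover have "ek 1 x = cis x" "ek (- 1) x = cis (- x)"
      by (simp_all add: ek_def cis_conv_exp)
    ultimately show ?thesis by (simp add: A_def B_def complex_eq_iff algebra_simps add_divide_distrib diff_divide_distrib)
  qed
  then have eq: "(\<lambda>x. of_real (p (cis x)) * f x) = (\<lambda>x. A * (ek 1 x * f x) + B * (ek (- 1) x * f x))"
    by (simp add: fun_eq_iff algebra_simps)
  show ?case
    unfolding eq using linear(2,3)
    by (auto simp: fourier_add fourier_cmult fourier_ek_mult integrable_ek_mult)
next
  case (const c f)
  then show ?case by (auto simp: fourier_cmult)
next
  case (add p q f)
  have eq: "(\<lambda>x. of_real (p (cis x) + q (cis x)) * f x) = (\<lambda>x. of_real (p (cis x)) * f x + of_real (q (cis x)) * f x)"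
    by (simp add: fun_eq_iff algebra_simps)
  show ?case unfolding eq using add.IH(1)[OF add.prems(1,2)] add.IH(2)[OF add.prems(1,2)] by (simp add: fourier_add)
next
  case (mult p q f)
  have eq: "(\<lambda>x. of_real (p (cis x) * q (cis x)) * f x) = (\<lambda>x. of_real (p (cis x)) * (of_real (q (cis x)) * f x))"
    by (simp add: fun_eq_iff algebra_simps)
  show ?case unfolding eq using mult.IH(1)[of "\<lambda>x. of_real (q (cis x)) * f x"] mult.IH(2)[OF mult.prems(1,2)] by blast
qed

text \<open>Stone-Weierstrass on the unit circle: h is uniformly close to a polynomial, for which
  the integral vanishes.\<close>

lemma fourier_zero_continuous:
  fixes h :: "complex \<Rightarrow> real"
  assumes f: "integrable torus_measure f" "\<And>k. fourier f k = 0" and h: "continuous_on (sphere 0 1) h"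
  shows "(\<integral>x. of_real (h (cis x)) * f x \<partial>torus_measure) = 0"
proof -
  have hm: "(\<lambda>x. complex_of_real (h (cis x))) \<in> borel_measurable torus_measure"
    by (intro continuous_measurable_torus continuous_intros continuous_on_compose2[OF h]) auto
  obtain B where B: "\<And>z. z \<in> sphere 0 1 \<Longrightarrow> norm (h z) \<le> B"
    using compact_imp_bounded[OF compact_continuous_image[OF h compact_sphere]] unfolding bounded_iff by blast
  have hint: "integrable torus_measure (\<lambda>x. of_real (h (cis x)) * f x)"
    by (rule integrable_mult_bounded[OF f(1) hm, where B = B]) (use B in auto)
  have "cmod (\<integral>x. of_real (h (cis x)) * f x \<partial>torus_measure) \<le> e * (\<integral>x. cmod (f x) \<partial>torus_measure)" if e: "0 < e" for e
  proof -
    obtain p where p: "real_polynomial_function p" "\<And>z. z \<in> sphere 0 1 \<Longrightarrow> \<bar>h z - p z\<bar> < e"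
      using Stone_Weierstrass_real_polynomial_function[OF compact_sphere h e] by blast
    note z = fourier_zero_polynomial[OF p(1) f]
    have "(\<integral>x. of_real (p (cis x)) * f x \<partial>torus_measure) = 0"
      using z fourier_eq[of "\<lambda>x. of_real (p (cis x)) * f x" 0] by simp
    then have "(\<integral>x. of_real (h (cis x)) * f x \<partial>torus_measure) = (\<integral>x. of_real (h (cis x)) * f x - of_real (p (cis x)) * f x \<partial>torus_measure)"
      using z hint by simp
    also have "cmod \<dots> \<le> (\<integral>x. cmod (of_real (h (cis x)) * f x - of_real (p (cis x)) * f x) \<partial>torus_measure)"
      by (rule integral_norm_bound)
    also have "\<dots> \<le> (\<integral>x. e * cmod (f x) \<partial>torus_measure)"
    proof (rule integral_mono)
      show "integrable torus_measure (\<lambda>x. cmod (of_real (h (cis x)) * f x - of_real (p (cis x)) * f x))"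
        using z hint by simp
      show "integrable torus_measure (\<lambda>x. e * cmod (f x))" using f by simp
      fix x
      have "cmod (of_real (h (cis x)) * f x - of_real (p (cis x)) * f x) = \<bar>h (cis x) - p (cis x)\<bar> * cmod (f x)"
        by (simp add: left_diff_distrib[symmetric] norm_mult flip: of_real_diff)
      also have "\<dots> \<le> e * cmod (f x)" using p(2)[of "cis x"] by (intro mult_right_mono) auto
      finally show "cmod (of_real (h (cis x)) * f x - of_real (p (cis x)) * f x) \<le> e * cmod (f x)" .
    qed
    finally show ?thesis by simp
  qed
  note le = this
  define J where "J = (\<integral>x. cmod (f x) \<partial>torus_measure)"
  have "cmod (\<integral>x. of_real (h (cis x)) * f x \<partial>torus_measure) \<le> 0 + e" if "0 < e" for e
  proof -
    have J: "0 \<le> J" by (simp add: J_def)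
    have "cmod (\<integral>x. of_real (h (cis x)) * f x \<partial>torus_measure) \<le> e / (J + 1) * J"
      unfolding J_def using that J by (intro le) (auto simp: J_def add_nonneg_pos)
    also have "\<dots> \<le> e" using that J by (simp add: field_simps)
    finally show ?thesis by simp
  qed
  then have "cmod (\<integral>x. of_real (h (cis x)) * f x \<partial>torus_measure) \<le> 0" by (rule field_le_epsilon)
  then show ?thesis by simp
qed

lemma fourier_zero_closed_set:
  assumes f: "integrable torus_measure f" "\<And>k. fourier f k = 0" and A: "closed A" "A \<noteq> {}"
  shows "(\<integral>x. indicator A (cis x) * f x \<partial>torus_measure) = 0"
proof -
  \<comment> \<open>Continuous functions that are 1 on A and decrease to its indicator.\<close>
  define h where "h = (\<lambda>n z. max 0 (1 - real n * setdist {z} A))"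
  have "(\<lambda>n. \<integral>x. of_real (h n (cis x)) * f x \<partial>torus_measure) \<longlonglongrightarrow> (\<integral>x. indicator A (cis x) * f x \<partial>torus_measure)"
  proof (rule integral_dominated_convergence[where w = "\<lambda>x. cmod (f x)"])
    have cont: "continuous_on UNIV (\<lambda>x. complex_of_real (h n (cis x)))" for n
      unfolding h_def by (intro continuous_intros continuous_on_compose2[OF continuous_on_setdist[of UNIV A]]) auto
    show "(\<lambda>x. of_real (h n (cis x)) * f x) \<in> borel_measurable torus_measure" for n
      using f(1) continuous_measurable_torus[OF cont[of n]] by measurable
    have "(\<lambda>x. indicator A (cis x) :: complex) \<in> borel_measurable torus_measure"
    proof (rule borel_measurable_torus)
      have "cis \<in> borel_measurable borel" by (intro borel_measurable_continuous_onI continuous_intros)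
      then have "cis -` A \<in> sets borel" using A by (metis borel_closed measurable_sets_borel)
      then have "(indicator (cis -` A) :: real \<Rightarrow> complex) \<in> borel_measurable borel" by measurable
      moreover have "(\<lambda>x. indicator A (cis x)) = (indicator (cis -` A) :: real \<Rightarrow> complex)"
        by (auto simp: fun_eq_iff indicator_def)
      ultimately show "(\<lambda>x. indicator A (cis x) :: complex) \<in> borel_measurable borel" by simp
    qed
    then show "(\<lambda>x. indicator A (cis x) * f x) \<in> borel_measurable torus_measure" using f(1) by measurable
    show "integrable torus_measure (\<lambda>x. cmod (f x))" using f by simp
    have lim: "(\<lambda>n. h n z) \<longlonglongrightarrow> indicator A z" for z
    proof (cases "z \<in> A")
      case True
      then have "setdist {z} A = 0" by (intro setdist_eq_0I[of z]) auto
      then show ?thesis using True by (simp add: h_def)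
    next
      case False
      then have "0 < setdist {z} A"
        using A setdist_eq_0_sing_1[of z A] setdist_pos_le[of "{z}" A] by (metis closure_closed less_eq_real_def)
      then obtain N where N: "1 < real N * setdist {z} A" using reals_Archimedean3 by blast
      have "h n z = 0" if "N \<le> n" for n
      proof -
        have "real N * setdist {z} A \<le> real n * setdist {z} A" using that setdist_pos_le by (intro mult_right_mono) auto
        then show ?thesis using N by (simp add: h_def)
      qed
      then have "(\<lambda>n. h n z) \<longlonglongrightarrow> 0" by (intro tendsto_eventually eventually_sequentiallyI)
      then show ?thesis using False by simp
    qed
    have "(\<lambda>n. of_real (h n (cis x)) * f x) \<longlonglongrightarrow> of_real (indicator A (cis x)) * f x" for x
      by (intro tendsto_intros lim)
    then show "AE x in torus_measure. (\<lambda>n. of_real (h n (cis x)) * f x) \<longlonglongrightarrow> indicator A (cis x) * f x"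
      by (simp add: of_real_indicator)
    show "AE x in torus_measure. cmod (of_real (h n (cis x)) * f x) \<le> cmod (f x)" for n
    proof (rule AE_I2)
      fix x
      have "\<bar>h n (cis x)\<bar> \<le> 1" using setdist_pos_le[of "{cis x}" A] by (simp add: h_def)
      then show "cmod (of_real (h n (cis x)) * f x) \<le> cmod (f x)"
        by (simp add: norm_mult mult_left_le_one_le)
    qed
  qed
  moreover have "(\<integral>x. of_real (h n (cis x)) * f x \<partial>torus_measure) = 0" for n
    by (rule fourier_zero_continuous[OF f]) (auto simp: h_def intro!: continuous_intros continuous_on_compose2[OF continuous_on_setdist[of UNIV A]])
  ultimately show ?thesis using LIMSEQ_unique by (simp add: LIMSEQ_const_iff)
qed

lemma cis_eq_torus:
  assumes "x \<in> {0..2 * pi}" "0 < y" "y < 2 * pi" "cis x = cis y"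
  shows "x = y"
proof -
  from assms(4) have "cos x = cos y" "sin x = sin y" by (auto simp: complex_eq_iff)
  then obtain n :: int where n: "x = y + 2 * pi * n" using sin_cos_eq_iff by metis
  have "2 * pi * real_of_int n < 2 * pi * 1" "2 * pi * (- 1) < 2 * pi * real_of_int n"
    using n assms(1-3) unfolding atLeastAtMost_iff by linarith+
  then have "real_of_int n < 1" "- 1 < real_of_int n"
    using mult_less_cancel_left_pos[of "2 * pi"] pi_gt_zero by (metis zero_less_mult_iff zero_less_numeral)+
  then have "n = 0" by linarith
  then show ?thesis using n by simp
qed

text \<open>Testing with indicators of closed arcs shows that the integrals over all intervals
  inside (0, 2 pi) vanish, and Lebesgue differentiation does the rest. The end points are kept out
  because \<open>cis\<close> identifies them.\<close>

theorem fourier_unique: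
  assumes f: "integrable torus_measure f" "\<And>k. fourier f k = 0"
  shows "AE x in torus_measure. f x = 0"
proof -
  define g where "g = (\<lambda>x. indicator {0..2 * pi} x *\<^sub>R f x)"
  have gi: "integrable lebesgue g"
    using f(1) unfolding g_def set_integrable_torus_iff[symmetric] set_integrable_def .
  have zero: "integral {a..b} g = 0" if ab: "0 < a" "a \<le> b" "b < 2 * pi" for a b
  proof -
    have "{x \<in> {0..2 * pi}. cis x \<in> cis ` {a..b}} = {a..b}"
    proof (intro equalityI subsetI)
      fix x assume "x \<in> {x \<in> {0..2 * pi}. cis x \<in> cis ` {a..b}}"
      then obtain y where "x \<in> {0..2 * pi}" "y \<in> {a..b}" "cis x = cis y" by auto
      then show "x \<in> {a..b}" using cis_eq_torus[of x y] ab by auto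
    qed (use ab in auto)
    then have ind: "indicator (cis ` {a..b}) (cis x) = (indicator {a..b} x :: complex)" if "x \<in> {0..2 * pi}" for x
      using that unfolding indicator_def by auto
    have "closed (cis ` {a..b})"
      by (intro compact_imp_closed compact_continuous_image continuous_intros) auto
    then have "(\<integral>x. indicator (cis ` {a..b}) (cis x) * f x \<partial>torus_measure) = 0"
      using ab by (intro fourier_zero_closed_set f) auto
    also have "(\<integral>x. indicator (cis ` {a..b}) (cis x) * f x \<partial>torus_measure) = (\<integral>x. indicator {a..b} x * f x \<partial>torus_measure)"
      by (intro Bochner_Integration.integral_cong) (auto simp: ind)
    also have "\<dots> = (LINT x:{0..2*pi}|lebesgue. indicator {a..b} x * f x)"
      using torus_integral_eq[of "\<lambda>x. indicator {a..b} x * f x"] by (simp add: torus_integral_def)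
    also have "\<dots> = (LINT x:{a..b}|lebesgue. g x)"
      unfolding set_lebesgue_integral_def g_def
      by (intro Bochner_Integration.integral_cong) (auto simp: indicator_def)
    also have "\<dots> = integral {a..b} g"
      using gi by (intro set_lebesgue_integral_eq_integral(2)) (auto simp: set_integrable_def intro: integrable_mult_indicator)
    finally show ?thesis .
  qed
  have "g integrable_on cbox a b" for a b
  proof (rule set_lebesgue_integral_eq_integral(1))
    show "set_integrable lebesgue (cbox a b) g"
      unfolding set_integrable_def using gi by (intro integrable_mult_indicator) auto
  qed
  then obtain N where N: "negligible N" "\<And>x e. x \<notin> N \<Longrightarrow> 0 < e \<Longrightarrow>
      \<exists>d>0. \<forall>h. 0 < h \<and> h < d \<longrightarrow> norm (integral (cbox x (x + h *\<^sub>R One)) g /\<^sub>R h ^ DIM(real) - g x) < e"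
    using integrable_ccontinuous_explicit[of g] by metis
  have gz: "g x = 0" if x: "x \<notin> N" "0 < x" "x < 2 * pi" for x
  proof (rule ccontr)
    assume "g x \<noteq> 0"
    then obtain d where d: "0 < d" "\<And>h. 0 < h \<Longrightarrow> h < d \<Longrightarrow> norm (integral (cbox x (x + h *\<^sub>R One)) g /\<^sub>R h ^ DIM(real) - g x) < norm (g x)"
      using N(2)[OF x(1), of "norm (g x)"] by auto
    define h where "h = min d (2 * pi - x) / 2"
    have h: "0 < h" "h < d" "x + h < 2 * pi" using d x by (auto simp: h_def min_def field_simps)
    have "integral (cbox x (x + h *\<^sub>R One)) g = 0" using zero[of x "x + h"] h x by simp
    then show False using d(2)[OF h(1,2)] by simp
  qed
  have "AE x in lebesgue. x \<notin> N \<union> {0, 2 * pi}"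
    using N(1) by (intro AE_not_in) (simp add: negligible_iff_null_sets[symmetric])
  then have "AE x in lebesgue. x \<in> {0..2 * pi} \<longrightarrow> f x = 0"
  proof (rule AE_mp, intro AE_I2 impI)
    fix x assume "x \<notin> N \<union> {0, 2 * pi}" "x \<in> {0..2 * pi}"
    then show "f x = 0" using gz[of x] by (auto simp: g_def)
  qed
  then show ?thesis by (simp add: AE_torus_iff)
qed

lemma ek_zero_fun: "ek 0 = (\<lambda>x. 1)"
  by (simp add: fun_eq_iff)

lemma integral_ek: "(\<integral>x. ek k x \<partial>torus_measure) = (if k = 0 then 2 * pi else 0)"
proof -
  have "(\<integral>x. ek k x \<partial>torus_measure) = (LINT x:{0..2 * pi}|lebesgue. ek k x)"
    using torus_integral_eq[of "ek k"] by (simp add: torus_integral_def)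
  also have "\<dots> = integral {0..2 * pi} (ek k)"
    by (intro set_lebesgue_integral_eq_integral absolutely_integrable_continuous_real continuous_ek)
  also have "\<dots> = (if k = 0 then 2 * pi else 0)"
  proof (cases "k = 0")
    case False
    have "(ek k has_integral (ek k (2 * pi) / (\<i> * of_int k) - ek k 0 / (\<i> * of_int k))) {0..2 * pi}"
      unfolding ek_def
      by (rule fundamental_theorem_of_calculus)
        (use False in \<open>auto intro!: derivative_eq_intros has_vector_derivative_real_field simp: field_simps\<close>)
    moreover have "ek k (2 * pi) = ek k 0"
      using exp_integer_2pi[of "of_int k"] by (simp add: ek_def mult_ac)
    ultimately show ?thesis using False by (simp add: integral_unique)
  qed (simp add: ek_zero_fun scaleR_conv_of_real)
  finally show ?thesis .
qed

lemma fourier_ek: "fourier (ek j) k = (if j = k then of_real (sqrt (2 * pi)) else 0)"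
proof -
  have "fourier (ek j) k = (\<integral>x. ek (j - k) x \<partial>torus_measure) / of_real (sqrt (2 * pi))"
    by (simp add: fourier_eq ek_add[symmetric])
  then show ?thesis by (simp add: integral_ek real_div_sqrt flip: of_real_divide)
qed

text \<open>Turns unordered sums into limits of a sequence of symmetric partial sums, the form in
  which dominated convergence and measurability of limits apply.\<close>

lemma filterlim_int_intervals:
  "filterlim (\<lambda>n. {- int n..int n}) (finite_subsets_at_top UNIV) sequentially"
  unfolding filterlim_finite_subsets_at_top
proof (intro allI impI)
  fix X :: "int set" assume X: "finite X \<and> X \<subseteq> UNIV"
  define N where "N = nat (Max (insert 0 (abs ` X)))"
  have "X \<subseteq> {- int n..int n}" if "N \<le> n" for n
  proof
    fix x assume "x \<in> X"
    then have "\<bar>x\<bar> \<le> Max (insert 0 (abs ` X))" using X by (intro Max_ge) auto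
    then show "x \<in> {- int n..int n}" using that by (auto simp: N_def)
  qed
  then show "\<forall>\<^sub>F n in sequentially. finite {- int n..int n} \<and> X \<subseteq> {- int n..int n} \<and> {- int n..int n} \<subseteq> UNIV"
    by (intro eventually_sequentiallyI[of N]) auto
qed

section \<open>Absolutely convergent Fourier series\<close>

text \<open>For summable c this is an everywhere defined bounded representative of the function with
  coefficients c; a given function of class H^1 agrees with its series only almost
  everywhere.\<close>

definition wsum :: "(int \<Rightarrow> complex) \<Rightarrow> real \<Rightarrow> complex" where
  "wsum c x = (\<Sum>\<^sub>\<infinity>k. c k * ek k x / of_real (sqrt (2 * pi)))"

context
  fixes c :: "int \<Rightarrow> complex"
  assumes c: "(\<lambda>k. cmod (c k)) summable_on UNIV"
begin

lemma wsum_summable: "(\<lambda>k. cmod (c k * ek k x / of_real (sqrt (2 * pi)))) summable_on UNIV"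
  using summable_on_cmult_left[OF c, of "1 / sqrt (2 * pi)"] by (simp add: norm_divide norm_mult)

lemma wsum_partial_bound: "cmod (\<Sum>k\<in>X. c k * ek k x / of_real (sqrt (2 * pi))) \<le> (\<Sum>\<^sub>\<infinity>k. cmod (c k)) / sqrt (2 * pi)"
proof (cases "finite X")
  case True
  have "cmod (\<Sum>k\<in>X. c k * ek k x / of_real (sqrt (2 * pi))) \<le> (\<Sum>k\<in>X. cmod (c k * ek k x / of_real (sqrt (2 * pi))))"
    by (rule norm_sum)
  also have "\<dots> = (\<Sum>k\<in>X. cmod (c k)) / sqrt (2 * pi)"
    by (simp add: norm_divide norm_mult sum_divide_distrib)
  also have "\<dots> \<le> (\<Sum>\<^sub>\<infinity>k. cmod (c k)) / sqrt (2 * pi)"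
    using True c by (intro divide_right_mono finite_sum_le_infsum) auto
  finally show ?thesis .
qed (simp add: infsum_nonneg)

lemma wsum_limit: "(\<lambda>n. \<Sum>k\<in>{- int n..int n}. c k * ek k x / of_real (sqrt (2 * pi))) \<longlonglongrightarrow> wsum c x"
  unfolding wsum_def
  by (rule filterlim_compose[OF infsum_tendsto[OF abs_summable_summable[OF wsum_summable]] filterlim_int_intervals])

lemma wsum_bound: "cmod (wsum c x) \<le> (\<Sum>\<^sub>\<infinity>k. cmod (c k)) / sqrt (2 * pi)"
  by (rule LIMSEQ_le_const2[OF tendsto_norm[OF wsum_limit]]) (auto intro: wsum_partial_bound)

lemma wsum_measurable: "wsum c \<in> borel_measurable torus_measure"
  by (rule borel_measurable_LIMSEQ_metric[OF _ wsum_limit]) (intro borel_measurable_sum measurable_ek borel_measurable_divide borel_measurable_times borel_measurable_const)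

text \<open>For trigonometric polynomials the convolution formula is a shift of coefficients. The
  symmetric partial sums are bounded by the l1 norm of c, so dominated convergence carries the
  formula over to every integrable g.\<close>

lemma fourier_wsum_mult:
  assumes g: "integrable torus_measure g"
  shows "fourier (\<lambda>x. wsum c x * g x) j = (\<Sum>\<^sub>\<infinity>k. c k * fourier g (j - k) / of_real (sqrt (2 * pi)))"
    and "(\<lambda>k. cmod (c k * fourier g (j - k) / of_real (sqrt (2 * pi)))) summable_on UNIV"
proof -
  let ?r = "of_real (sqrt (2 * pi)) :: complex"
  let ?W = "\<lambda>n x. \<Sum>k\<in>{- int n..int n}. c k * ek k x / ?r"
  define B where "B = (\<integral>x. cmod (g x) \<partial>torus_measure) / sqrt (2 * pi)"
  show s: "(\<lambda>k. cmod (c k * fourier g (j - k) / ?r)) summable_on UNIV"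
  proof (rule summable_on_comparison_test)
    show "(\<lambda>k. cmod (c k) * (B / sqrt (2 * pi))) summable_on UNIV"
      using c by (rule summable_on_cmult_left)
    fix k
    have "cmod (c k) * (cmod (fourier g (j - k)) / sqrt (2 * pi)) \<le> cmod (c k) * (B / sqrt (2 * pi))"
      unfolding B_def by (intro mult_left_mono divide_right_mono norm_fourier_le g) auto
    then show "cmod (c k * fourier g (j - k) / ?r) \<le> cmod (c k) * (B / sqrt (2 * pi))"
      by (simp add: norm_mult norm_divide)
  qed auto
  have Wm: "?W n \<in> borel_measurable torus_measure" for n
    by (intro borel_measurable_sum measurable_ek borel_measurable_divide borel_measurable_times borel_measurable_const)
  have "(\<lambda>n. \<integral>x. ek (- j) x * (?W n x * g x) \<partial>torus_measure) \<longlonglongrightarrow> (\<integral>x. ek (- j) x * (wsum c x * g x) \<partial>torus_measure)"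
  proof (rule integral_dominated_convergence[where w = "\<lambda>x. (\<Sum>\<^sub>\<infinity>k. cmod (c k)) / sqrt (2 * pi) * cmod (g x)"])
    show "(\<lambda>x. ek (- j) x * (wsum c x * g x)) \<in> borel_measurable torus_measure"
      using g wsum_measurable measurable_ek by measurable
    show "(\<lambda>x. ek (- j) x * (?W n x * g x)) \<in> borel_measurable torus_measure" for n
      using g Wm measurable_ek by measurable
    show "integrable torus_measure (\<lambda>x. (\<Sum>\<^sub>\<infinity>k. cmod (c k)) / sqrt (2 * pi) * cmod (g x))"
      using g by simp
    show "AE x in torus_measure. (\<lambda>n. ek (- j) x * (?W n x * g x)) \<longlonglongrightarrow> ek (- j) x * (wsum c x * g x)"
      by (intro AE_I2 tendsto_intros wsum_limit)
    show "AE x in torus_measure. cmod (ek (- j) x * (?W n x * g x)) \<le> (\<Sum>\<^sub>\<infinity>k. cmod (c k)) / sqrt (2 * pi) * cmod (g x)" for n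
      using mult_right_mono[OF wsum_partial_bound norm_ge_zero] by (intro AE_I2) (simp only: norm_mult norm_ek mult_1)
  qed
  then have "(\<lambda>n. fourier (\<lambda>x. ?W n x * g x) j) \<longlonglongrightarrow> fourier (\<lambda>x. wsum c x * g x) j"
    unfolding fourier_eq by (intro tendsto_divide tendsto_const) auto
  moreover have "fourier (\<lambda>x. ?W n x * g x) j = (\<Sum>k\<in>{- int n..int n}. c k * fourier g (j - k) / ?r)" for n
  proof -
    have "(\<integral>x. ek (- j) x * (?W n x * g x) \<partial>torus_measure)
       = (\<integral>x. (\<Sum>k\<in>{- int n..int n}. c k / ?r * (ek (- (j - k)) x * g x)) \<partial>torus_measure)"
      by (intro Bochner_Integration.integral_cong refl)
        (simp add: sum_distrib_left sum_distrib_right ek_add[of "- j", symmetric] mult_ac flip: ek_add)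
    also have "\<dots> = (\<Sum>k\<in>{- int n..int n}. c k / ?r * (\<integral>x. ek (- (j - k)) x * g x \<partial>torus_measure))"
      using integrable_ek_mult[OF g] by (subst Bochner_Integration.integral_sum) auto
    finally show ?thesis
      unfolding fourier_eq by (simp add: sum_divide_distrib mult.assoc)
  qed
  ultimately have "(\<lambda>n. \<Sum>k\<in>{- int n..int n}. c k * fourier g (j - k) / ?r) \<longlonglongrightarrow> fourier (\<lambda>x. wsum c x * g x) j"
    by simp
  moreover have "(\<lambda>n. \<Sum>k\<in>{- int n..int n}. c k * fourier g (j - k) / ?r) \<longlonglongrightarrow> (\<Sum>\<^sub>\<infinity>k. c k * fourier g (j - k) / ?r)"
    by (rule filterlim_compose[OF infsum_tendsto[OF abs_summable_summable[OF s]] filterlim_int_intervals])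
  ultimately show "fourier (\<lambda>x. wsum c x * g x) j = (\<Sum>\<^sub>\<infinity>k. c k * fourier g (j - k) / ?r)"
    by (rule LIMSEQ_unique)
qed

lemma fourier_wsum: "fourier (wsum c) k = c k"
proof -
  interpret finite_measure torus_measure by (rule finite_measure_torus)
  have "fourier (\<lambda>x. wsum c x * 1) k = (\<Sum>\<^sub>\<infinity>j. c j * fourier (ek 0) (k - j) / of_real (sqrt (2 * pi)))"
    using fourier_wsum_mult(1)[of "\<lambda>_. 1" k] by (simp add: ek_zero_fun)
  also have "\<dots> = (\<Sum>\<^sub>\<infinity>j\<in>{k}. c j * fourier (ek 0) (k - j) / of_real (sqrt (2 * pi)))"
    by (rule infsum_cong_neutral) (auto simp: fourier_ek)
  also have "\<dots> = c k" by (simp add: fourier_ek)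
  finally show ?thesis by simp
qed

end

text \<open>The Wiener algebra, in which products become absolutely convergent convolutions;
  \<open>wienerI\<close> places H^1 inside it.\<close>

definition wiener :: "(real \<Rightarrow> complex) \<Rightarrow> bool" where
  "wiener f \<longleftrightarrow> square_integrable f \<and> (\<lambda>k. cmod (fourier f k)) summable_on UNIV"

lemma wiener_eq_wsum:
  assumes "wiener f"
  shows "AE x in torus_measure. f x = wsum (fourier f) x"
proof -
  interpret finite_measure torus_measure by (rule finite_measure_torus)
  have f: "integrable torus_measure f" and s: "(\<lambda>k. cmod (fourier f k)) summable_on UNIV"
    using assms by (auto simp: wiener_def square_integrable_integrable)
  have w: "integrable torus_measure (wsum (fourier f))"
    using integrable_mult_bounded[where f = "\<lambda>_. 1", OF _ wsum_measurable[OF s] wsum_bound[OF s]] by simp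
  have "AE x in torus_measure. f x - wsum (fourier f) x = 0"
    using f w by (intro fourier_unique) (auto simp: fourier_diff fourier_wsum[OF s])
  then show ?thesis by eventually_elim simp
qed

lemma wiener_measurable: "wiener f \<Longrightarrow> f \<in> borel_measurable torus_measure"
  by (simp add: wiener_def square_integrable_iff)

lemma wiener_mult_integrable:
  assumes f: "wiener f" and g: "integrable torus_measure g"
  shows "integrable torus_measure (\<lambda>x. f x * g x)"
proof (rule integrable_cong_AE_imp)
  have s: "(\<lambda>k. cmod (fourier f k)) summable_on UNIV" using f by (simp add: wiener_def)
  show "integrable torus_measure (\<lambda>x. wsum (fourier f) x * g x)"
    by (rule integrable_mult_bounded[OF g wsum_measurable[OF s] wsum_bound[OF s]])
  show "(\<lambda>x. f x * g x) \<in> borel_measurable torus_measure" using wiener_measurable[OF f] g by measurable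
  show "AE x in torus_measure. wsum (fourier f) x * g x = f x * g x"
    using wiener_eq_wsum[OF f] by eventually_elim simp
qed

lemma fourier_mult:
  assumes f: "wiener f" and g: "integrable torus_measure g"
  shows "fourier (\<lambda>x. f x * g x) k = (\<Sum>\<^sub>\<infinity>r. fourier f r * fourier g (k - r) / of_real (sqrt (2 * pi)))"
    and "(\<lambda>r. cmod (fourier f r * fourier g (k - r) / of_real (sqrt (2 * pi)))) summable_on UNIV"
proof -
  have s: "(\<lambda>k. cmod (fourier f k)) summable_on UNIV" using f by (simp add: wiener_def)
  have "fourier (\<lambda>x. f x * g x) k = fourier (\<lambda>x. wsum (fourier f) x * g x) k"
  proof (rule fourier_cong_AE)
    show "(\<lambda>x. f x * g x) \<in> borel_measurable torus_measure" using wiener_measurable[OF f] g by measurable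
    show "(\<lambda>x. wsum (fourier f) x * g x) \<in> borel_measurable torus_measure" using wsum_measurable[OF s] g by measurable
    show "AE x in torus_measure. f x * g x = wsum (fourier f) x * g x"
      using wiener_eq_wsum[OF f] by eventually_elim simp
  qed
  then show "fourier (\<lambda>x. f x * g x) k = (\<Sum>\<^sub>\<infinity>r. fourier f r * fourier g (k - r) / of_real (sqrt (2 * pi)))"
    using fourier_wsum_mult(1)[OF s g] by simp
  show "(\<lambda>r. cmod (fourier f r * fourier g (k - r) / of_real (sqrt (2 * pi)))) summable_on UNIV"
    by (rule fourier_wsum_mult(2)[OF s g])
qed

lemma fourier_abs_square:
  assumes f: "wiener f"
  shows "fourier (\<lambda>x. of_real ((cmod (f x))\<^sup>2)) k = (\<Sum>\<^sub>\<infinity>p. fourier f p * cnj (fourier f (p - k)) / of_real (sqrt (2 * pi)))"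
    and "integrable torus_measure (\<lambda>x. complex_of_real ((cmod (f x))\<^sup>2))"
proof -
  have g: "integrable torus_measure (\<lambda>x. cnj (f x))"
    using f by (auto simp: wiener_def square_integrable_integrable)
  show "fourier (\<lambda>x. of_real ((cmod (f x))\<^sup>2)) k = (\<Sum>\<^sub>\<infinity>p. fourier f p * cnj (fourier f (p - k)) / of_real (sqrt (2 * pi)))"
    using fourier_mult(1)[OF f g, of k] by (simp add: complex_norm_square fourier_cnj del: of_real_power)
  show "integrable torus_measure (\<lambda>x. complex_of_real ((cmod (f x))\<^sup>2))"
    using wiener_mult_integrable[OF f g] by (simp add: complex_norm_square del: of_real_power)
qed

text \<open>The convolution formula for |f|^2 at frequency 0.\<close>

lemma parseval:
  assumes f: "wiener f"
  shows "L2_norm f = sqrt (mass (fourier f))"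
proof -
  let ?r = "of_real (sqrt (2 * pi)) :: complex"
  have "(\<integral>x. complex_of_real ((cmod (f x))\<^sup>2) \<partial>torus_measure) = ?r * fourier (\<lambda>x. of_real ((cmod (f x))\<^sup>2)) 0"
    by (simp add: fourier_eq)
  also have "\<dots> = ?r * ((\<Sum>\<^sub>\<infinity>p. fourier f p * cnj (fourier f p)) / ?r)"
    unfolding fourier_abs_square(1)[OF f] by (simp add: infsum_cmult_left' divide_inverse)
  also have "\<dots> = (\<Sum>\<^sub>\<infinity>p. complex_of_real ((cmod (fourier f p))\<^sup>2))"
    by (simp add: complex_norm_square del: of_real_power)
  finally have eq: "(\<integral>x. complex_of_real ((cmod (f x))\<^sup>2) \<partial>torus_measure) = (\<Sum>\<^sub>\<infinity>p. complex_of_real ((cmod (fourier f p))\<^sup>2))" .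
  have s: "(\<lambda>p. (cmod (fourier f p))\<^sup>2) summable_on UNIV"
  proof -
    have "(\<lambda>r. cmod (fourier f r * fourier (\<lambda>x. cnj (f x)) (0 - r) / ?r)) summable_on UNIV"
      using f by (intro fourier_mult(2)) (auto simp: wiener_def square_integrable_integrable)
    then have "(\<lambda>r. sqrt (2 * pi) * cmod (fourier f r * fourier (\<lambda>x. cnj (f x)) (0 - r) / ?r)) summable_on UNIV"
      by (rule summable_on_cmult_right)
    then show ?thesis by (simp add: fourier_cnj norm_divide norm_mult power2_eq_square)
  qed
  have "complex_of_real (\<integral>x. (cmod (f x))\<^sup>2 \<partial>torus_measure) = complex_of_real (mass (fourier f))"
  proof -
    have "(\<integral>x. complex_of_real ((cmod (f x))\<^sup>2) \<partial>torus_measure) = complex_of_real (\<integral>x. (cmod (f x))\<^sup>2 \<partial>torus_measure)"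
      by (rule integral_complex_of_real)
    moreover have "(\<Sum>\<^sub>\<infinity>p. complex_of_real ((cmod (fourier f p))\<^sup>2)) = complex_of_real (mass (fourier f))"
      unfolding mass_def by (intro infsumI has_sum_of_real has_sum_infsum s)
    ultimately show ?thesis using eq by (simp only:)
  qed
  then have "(\<integral>x. (cmod (f x))\<^sup>2 \<partial>torus_measure) = mass (fourier f)" by (simp only: of_real_eq_iff)
  moreover have "set_lebesgue_integral lebesgue {0..2 * pi} (\<lambda>x. (cmod (f x))\<^sup>2) = (\<integral>x. (cmod (f x))\<^sup>2 \<partial>torus_measure)"
    unfolding torus_measure_def set_lebesgue_integral_def by (subst integral_restrict_space) auto
  ultimately show ?thesis by (simp add: L2_norm_def)
qed

lemma h_bounded_abs_summable:
  assumes "h_bounded 1 R a"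
  shows "(\<lambda>k. cmod (a k)) summable_on UNIV" "(\<Sum>\<^sub>\<infinity>k. cmod (a k)) \<le> 3 * R"
proof -
  have b: "(\<Sum>k\<in>S. cmod (a k)) \<le> 3 * R" if "finite S" for S
    using l2_bounded_CS[of "\<lambda>k. jp k * cmod (a k)" R "\<lambda>k. 1 / jp k" 3 S] assms that l2_bounded_inverse_jp
    by (simp add: h_bounded_def)
  show s: "(\<lambda>k. cmod (a k)) summable_on UNIV"
    using b by (intro abs_summable_bounded(1)[of _ a "3 * R"]) auto
  show "(\<Sum>\<^sub>\<infinity>k. cmod (a k)) \<le> 3 * R"
    by (rule infsum_le_finite_sums[OF s]) (rule b)
qed

lemma wienerI: "square_integrable f \<Longrightarrow> h_bounded 1 R (fourier f) \<Longrightarrow> wiener f"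
  unfolding wiener_def using h_bounded_abs_summable by blast

context raman
begin

section \<open>The nonlinearity in terms of Fourier coefficients\<close>

text \<open>Summing over p first produces the coefficient of |f|^2 at k - r; the sum over r is then
  a convolution with f. The part of \<open>mu\<close> that depends on k alone gives the cubic terms,
  the part with k - r the Raman term.\<close>

lemma nl_fourier:
  assumes f: "square_integrable f" and b: "h_bounded 1 R (fourier f)"
  shows "nl (fourier f) k = (\<i> * of_real \<gamma>\<^sub>1 + \<i> * of_real \<gamma>\<^sub>2 * of_int k) * fourier (\<lambda>x. of_real ((cmod (f x))\<^sup>2) * f x) k
    - \<i> * of_real \<Gamma> * pairing (dx_abs_sq f) (\<lambda>x. f x * ek (- k) x) / of_real (sqrt (2 * pi))"
proof -
  let ?r = "of_real (sqrt (2 * pi)) :: complex"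
  define a where "a = fourier f"
  define F where "F = fourier (\<lambda>x. of_real ((cmod (f x))\<^sup>2))"
  have w: "wiener f" using f b by (rule wienerI)
  have rr: "?r * ?r = 2 * of_real pi" 
  proof -
    have "?r * ?r = of_real (sqrt (2 * pi) * sqrt (2 * pi))" by (simp only: of_real_mult)
    then show ?thesis by simp
  qed
  have Fint: "integrable torus_measure (\<lambda>x. complex_of_real ((cmod (f x))\<^sup>2))"
    using w by (rule fourier_abs_square(2))
  have Feq: "F j = (\<Sum>\<^sub>\<infinity>p. a p * cnj (a (p - j)) / ?r)" for j
    unfolding F_def a_def by (rule fourier_abs_square(1)[OF w])
  have nls: "nlt a k summable_on UNIV" using nlt_summable(1)[OF b] by (simp add: a_def)
  have nls': "(\<lambda>(r, p). nlt a k (p, r)) summable_on UNIV \<times> UNIV"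
    using summable_on_reindex_bij_witness[of UNIV prod.swap prod.swap UNIV "nlt a k" "\<lambda>(r, p). nlt a k (p, r)"] nls
    by (auto simp: UNIV_Times_UNIV)
  have "nl a k = (\<Sum>\<^sub>\<infinity>(r, p)\<in>UNIV \<times> UNIV. nlt a k (p, r))"
    unfolding nl_def UNIV_Times_UNIV by (rule infsum_reindex_bij_witness[of _ prod.swap prod.swap]) auto
  also have "\<dots> = (\<Sum>\<^sub>\<infinity>r. \<Sum>\<^sub>\<infinity>p. nlt a k (p, r))"
    using infsum_Sigma'_banach[OF nls'] by simp
  also have "\<dots> = (\<Sum>\<^sub>\<infinity>r. mu k r * ?r * (F (k - r) * a r))"
  proof (rule infsum_cong)
    fix r
    have "(\<Sum>\<^sub>\<infinity>p. nlt a k (p, r)) = (\<Sum>\<^sub>\<infinity>p. mu k r * ?r * a r * (a p * cnj (a (p - (k - r))) / ?r))"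
      by (rule infsum_cong) (simp add: nlt_def algebra_simps)
    also have "\<dots> = mu k r * ?r * a r * F (k - r)"
      unfolding Feq by (rule infsum_cmult_right')
    finally show "(\<Sum>\<^sub>\<infinity>p. nlt a k (p, r)) = mu k r * ?r * (F (k - r) * a r)" by simp
  qed
  finally have nl1: "nl a k = (\<Sum>\<^sub>\<infinity>r. mu k r * ?r * (F (k - r) * a r))" .
  have sr: "(\<lambda>r. mu k r * ?r * (F (k - r) * a r)) summable_on UNIV"
  proof -
    have "(\<lambda>r. \<Sum>\<^sub>\<infinity>p. nlt a k (p, r)) summable_on UNIV"
      using summable_on_Sigma_banach[OF nls'] by simp
    moreover have "(\<Sum>\<^sub>\<infinity>p. nlt a k (p, r)) = mu k r * ?r * (F (k - r) * a r)" for r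
    proof -
      have "(\<Sum>\<^sub>\<infinity>p. nlt a k (p, r)) = (\<Sum>\<^sub>\<infinity>p. mu k r * ?r * a r * (a p * cnj (a (p - (k - r))) / ?r))"
        by (rule infsum_cong) (simp add: nlt_def algebra_simps)
      also have "\<dots> = mu k r * ?r * a r * F (k - r)"
        unfolding Feq by (rule infsum_cmult_right')
      finally show ?thesis by simp
    qed
    ultimately show ?thesis by simp
  qed
  define c1 where "c1 = (\<i> * of_real \<gamma>\<^sub>1 + \<i> * of_real \<gamma>\<^sub>2 * of_int k) / ?r"
  have mu: "mu k r * ?r = c1 + of_real \<Gamma> * of_int (k - r) / ?r" for r
  proof -
    have "mu k r = (\<i> * of_real \<gamma>\<^sub>1 + \<i> * of_real \<gamma>\<^sub>2 * of_int k + of_real \<Gamma> * of_int (k - r)) / (?r * ?r)"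
      unfolding rr by (simp add: mu_def complex_eq_iff add_divide_distrib)
    moreover have "X / (z * z) * z = X / z" for X z :: complex by simp
    ultimately show ?thesis by (simp only: c1_def add_divide_distrib distrib_right)
  qed
  have s1: "(\<lambda>r. c1 * (F (k - r) * a r)) summable_on UNIV"
  proof -
    have "(\<lambda>r. a r * F (k - r) / ?r) summable_on UNIV"
      unfolding a_def F_def using fourier_mult(2)[OF w Fint, of k] by (rule abs_summable_summable)
    then have "(\<lambda>r. c1 * ?r * (a r * F (k - r) / ?r)) summable_on UNIV" by (rule summable_on_cmult_right)
    then show ?thesis by (simp add: mult_ac)
  qed
  \<comment> \<open>By subtraction: the whole series and its cubic part converge, hence so does the
    part carrying the derivative.\<close>
  have s2: "(\<lambda>r. of_real \<Gamma> * of_int (k - r) / ?r * (F (k - r) * a r)) summable_on UNIV"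
  proof -
    have "(\<lambda>r. mu k r * ?r * (F (k - r) * a r) + - (c1 * (F (k - r) * a r))) summable_on UNIV"
      by (rule summable_on_add[OF sr summable_on_uminus[THEN iffD2, OF s1]])
    then show ?thesis by (simp only: mu distrib_right add_diff_cancel_left' flip: diff_conv_add_uminus)
  qed
  have "nl a k = (\<Sum>\<^sub>\<infinity>r. c1 * (F (k - r) * a r)) + (\<Sum>\<^sub>\<infinity>r. of_real \<Gamma> * of_int (k - r) / ?r * (F (k - r) * a r))"
    unfolding nl1 mu distrib_right by (rule infsum_add[OF s1 s2])
  also have "(\<Sum>\<^sub>\<infinity>r. c1 * (F (k - r) * a r)) = c1 * ?r * fourier (\<lambda>x. f x * of_real ((cmod (f x))\<^sup>2)) k"
    unfolding fourier_mult(1)[OF w Fint] infsum_cmult_right'[symmetric]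
    by (rule infsum_cong) (simp add: a_def F_def)
  also have "(\<Sum>\<^sub>\<infinity>r. of_real \<Gamma> * of_int (k - r) / ?r * (F (k - r) * a r))
     = (\<Sum>\<^sub>\<infinity>j. of_real \<Gamma> * of_int j / ?r * (F j * a (k - j)))"
    by (rule infsum_reindex_bij_witness[of _ "\<lambda>j. k - j" "\<lambda>j. k - j"]) auto
  also have "\<dots> = - \<i> * of_real \<Gamma> / ?r * (\<Sum>\<^sub>\<infinity>j. \<i> * of_int j * F j * a (k - j))"
    unfolding infsum_cmult_right'[symmetric] by (rule infsum_cong) (simp add: algebra_simps)
  \<comment> \<open>The pairing evaluates its second factor at -j, and multiplication by e^(-ikx)
    moves this to k - j.\<close>
  also have "(\<Sum>\<^sub>\<infinity>j. \<i> * of_int j * F j * a (k - j)) = pairing (dx_abs_sq f) (\<lambda>x. f x * ek (- k) x)"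
    unfolding pairing_def dx_abs_sq_def F_def a_def
    using fourier_ek_mult[of "- k" f] by (simp add: mult.commute)
  finally show ?thesis by (simp add: c1_def a_def mult.commute)
qed

end

section \<open>From weak solutions to Fourier coefficients\<close>

text \<open>Differentiating P(1/y) exp(-\<delta>/y) in y replaces P(z) by z^2 (\<delta> P(z) -
  P'(z)), with z = 1/y.\<close>

fun bump_poly :: "real \<Rightarrow> nat \<Rightarrow> real poly" where
  "bump_poly \<delta> 0 = 1"
| "bump_poly \<delta> (Suc n) = [:0, 0, 1:] * (smult \<delta> (bump_poly \<delta> n) - pderiv (bump_poly \<delta> n))"

text \<open>The \<open>n\<close>-th derivative of the smooth function that is \<open>exp (- \<delta> / y)\<close> for \<open>y > 0\<close> and vanishes
  for \<open>y \<le> 0\<close>. As \<open>\<delta>\<close> tends to \<open>0\<close>, \<open>bump \<delta> 0 (c - t)\<close> tends to the indicator of \<open>t < c\<close> and \<open>bump \<delta> 1 (c - t)\<close>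
  to the unit mass at \<open>t = c\<close>, which turns the weak identity into the integrated equation.\<close>

definition bump :: "real \<Rightarrow> nat \<Rightarrow> real \<Rightarrow> real" where
  "bump \<delta> n y = (if 0 < y then poly (bump_poly \<delta> n) (1 / y) * exp (- \<delta> / y) else 0)"

lemma poly_times_exp_tendsto_0:
  fixes q :: "real poly"
  shows "0 < d \<Longrightarrow> ((\<lambda>z. poly q z * exp (- d * z)) \<longlongrightarrow> 0) at_top"
proof (induction q arbitrary: d)
  case (pCons a q)
  have top: "filterlim (\<lambda>z. e * z) at_top at_top" if "0 < e" for e :: real
    by (rule filterlim_tendsto_pos_mult_at_top[OF tendsto_const that filterlim_ident])
  have z: "((\<lambda>z. z * exp (- e * z)) \<longlongrightarrow> 0) at_top" if e: "0 < e" for e :: real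
  proof -
    have "((\<lambda>z. (e * z) ^ 1 / exp (e * z)) \<longlongrightarrow> 0) at_top"
      by (rule filterlim_compose[OF tendsto_power_div_exp_0 top[OF e]])
    then have "((\<lambda>z. 1 / e * ((e * z) ^ 1 / exp (e * z))) \<longlongrightarrow> 1 / e * 0) at_top" by (intro tendsto_intros)
    then show ?thesis using e by (simp add: exp_minus field_simps)
  qed
  have one: "((\<lambda>z. exp (- d * z)) \<longlongrightarrow> 0) at_top"
  proof -
    have "((\<lambda>z. (d * z) ^ 0 / exp (d * z)) \<longlongrightarrow> 0) at_top"
      by (rule filterlim_compose[OF tendsto_power_div_exp_0 top[OF pCons.prems]])
    then show ?thesis by (simp add: exp_minus field_simps)
  qed
  have "((\<lambda>z. a * exp (- d * z) + (z * exp (- (d / 2) * z)) * (poly q z * exp (- (d / 2) * z))) \<longlongrightarrow> a * 0 + 0 * 0) at_top"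
    using pCons by (intro tendsto_intros one z pCons.IH) auto
  moreover have "a * exp (- d * z) + (z * exp (- (d / 2) * z)) * (poly q z * exp (- (d / 2) * z))
      = poly (pCons a q) z * exp (- d * z)" for z
  proof -
    have "exp (- (d / 2) * z) * exp (- (d / 2) * z) = exp (- d * z)" by (simp add: exp_add[symmetric])
    then show ?thesis by (simp add: algebra_simps)
  qed
  ultimately show ?case by simp
qed simp

lemma bump_derivative:
  assumes d: "0 < \<delta>"
  shows "(bump \<delta> n has_real_derivative bump \<delta> (Suc n) y) (at y)"
proof -
  consider "0 < y" | "y < 0" | "y = 0" by linarith
  then show ?thesis
  proof cases
    case 1
    have "((\<lambda>y. poly (bump_poly \<delta> n) (1 / y) * exp (- \<delta> / y)) has_real_derivative bump \<delta> (Suc n) y) (at y)"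
      using 1 by (auto intro!: derivative_eq_intros DERIV_chain2[OF poly_DERIV] simp: bump_def power2_eq_square field_simps)
    moreover have "\<forall>\<^sub>F z in nhds y. bump \<delta> n z = poly (bump_poly \<delta> n) (1 / z) * exp (- \<delta> / z)"
      using 1 eventually_nhds_in_open[of "{0<..}" y] by (auto simp: bump_def elim: eventually_mono)
    ultimately show ?thesis by (subst DERIV_cong_ev) auto
  next
    case 2
    have "\<forall>\<^sub>F z in nhds y. bump \<delta> n z = 0"
      using 2 eventually_nhds_in_open[of "{..<0}" y] by (auto simp: bump_def elim: eventually_mono)
    then show ?thesis using 2 by (subst DERIV_cong_ev[where g = "\<lambda>_. 0"]) (auto simp: bump_def)
  next
    \<comment> \<open>At 0 the difference quotient from the right is again a polynomial in 1/h times
      the exponential.\<close>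
    case 3
    have "((\<lambda>h. bump \<delta> n h / h) \<longlongrightarrow> 0) (at 0)"
    proof (rule filterlim_split_at)
      show "((\<lambda>h. bump \<delta> n h / h) \<longlongrightarrow> 0) (at_left 0)"
      proof (rule tendsto_eventually)
        show "\<forall>\<^sub>F x in at_left 0. bump \<delta> n x / x = 0"
          using eventually_at_left_real[of "- 1" 0] by (auto simp: bump_def elim: eventually_mono)
      qed
      have "((\<lambda>h. poly ([:0, 1:] * bump_poly \<delta> n) (inverse h) * exp (- \<delta> * inverse h)) \<longlongrightarrow> 0) (at_right 0)"
        by (rule filterlim_compose[OF poly_times_exp_tendsto_0[OF d] filterlim_inverse_at_top_right])
      moreover have "\<forall>\<^sub>F h in at_right 0. bump \<delta> n h / h = poly ([:0, 1:] * bump_poly \<delta> n) (inverse h) * exp (- \<delta> * inverse h)"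
        using eventually_at_right_less[of "0 :: real"] by eventually_elim (simp add: bump_def field_simps)
      ultimately show "((\<lambda>h. bump \<delta> n h / h) \<longlongrightarrow> 0) (at_right 0)"
        by (subst filterlim_cong[OF refl refl])
    qed
    then show ?thesis using 3 by (simp add: DERIV_def bump_def)
  qed
qed

lemma bump_continuous: "0 < \<delta> \<Longrightarrow> continuous_on A (bump \<delta> n)"
  using bump_derivative by (meson DERIV_isCont continuous_at_imp_continuous_on)

lemma bump_0: "bump \<delta> 0 y = (if 0 < y then exp (- \<delta> / y) else 0)"
  by (simp add: bump_def)

lemma bump_1: "bump \<delta> (Suc 0) y = (if 0 < y then \<delta> / y\<^sup>2 * exp (- \<delta> / y) else 0)"
  by (simp add: bump_def power2_eq_square)

lemma bump_limit: "0 < y \<Longrightarrow> (\<lambda>n. bump (1 / real (Suc n)) 0 y) \<longlonglongrightarrow> 1"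
proof -
  assume y: "0 < y"
  have "(\<lambda>n. exp (- (1 / real (Suc n)) / y)) \<longlonglongrightarrow> exp (- 0 / y)"
    by (intro tendsto_intros LIMSEQ_Suc[OF lim_1_over_n]) (use y in auto)
  then show ?thesis using y by (simp add: bump_0)
qed

lemma bump_approx_integral:
  fixes g :: "real \<Rightarrow> complex"
  assumes c: "0 < c" and g: "continuous_on {0..c} g"
  shows "(\<lambda>n. integral {0..c} (\<lambda>s. of_real (bump (1 / real (Suc n)) 0 (c - s)) * g s)) \<longlonglongrightarrow> integral {0..c} g"
proof -
  obtain B where B: "\<And>s. s \<in> {0..c} \<Longrightarrow> norm (g s) \<le> B"
    using compact_imp_bounded[OF compact_continuous_image[OF g compact_Icc]] unfolding bounded_iff by blast
  \<comment> \<open>All cutoffs vanish at s = c, so the pointwise limit is g off a single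
    point.\<close>
  have "(\<lambda>n. integral {0..c} (\<lambda>s. of_real (bump (1 / real (Suc n)) 0 (c - s)) * g s)) \<longlonglongrightarrow>
      integral {0..c} (\<lambda>s. if s = c then 0 else g s)"
  proof (rule dominated_convergence(2)[where h = "\<lambda>_. B"])
    show "(\<lambda>s. of_real (bump (1 / real (Suc n)) 0 (c - s)) * g s) integrable_on {0..c}" for n
      by (intro integrable_continuous_real continuous_intros g continuous_on_compose2[OF bump_continuous[of _ UNIV]]) auto
    show "(\<lambda>_. B) integrable_on {0..c}" by (rule integrable_const_ivl)
    show "norm (of_real (bump (1 / real (Suc n)) 0 (c - s)) * g s) \<le> B" if "s \<in> {0..c}" for n s
    proof -
      have "\<bar>bump (1 / real (Suc n)) 0 (c - s)\<bar> \<le> 1" by (simp add: bump_0)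
      then have "norm (of_real (bump (1 / real (Suc n)) 0 (c - s)) * g s) \<le> 1 * norm (g s)"
        unfolding norm_mult norm_of_real by (intro mult_right_mono) auto
      then show ?thesis using B[OF that] by simp
    qed
    show "(\<lambda>n. of_real (bump (1 / real (Suc n)) 0 (c - s)) * g s) \<longlonglongrightarrow> (if s = c then 0 else g s)" if "s \<in> {0..c}" for s
    proof (cases "s = c")
      case False
      then have "(\<lambda>n. of_real (bump (1 / real (Suc n)) 0 (c - s)) * g s) \<longlonglongrightarrow> of_real 1 * g s"
        using that by (intro tendsto_intros bump_limit) auto
      then show ?thesis using False by simp
    qed (simp add: bump_0)
  qed
  moreover have "integral {0..c} (\<lambda>s. if s = c then 0 else g s) = integral {0..c} g"
    by (rule integral_spike[of "{c}"]) auto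
  ultimately show ?thesis by simp
qed

text \<open>The kernels \<open>b n\<close> are nonnegative, their total mass tends to 1 and their
  first moment about c tends to 0. Continuity of h enters as |h s - h c| \<le> e/2 + C (c - s),
  whose integral against the kernel involves only mass and moment.\<close>

lemma bump_approx_delta:
  fixes h :: "real \<Rightarrow> complex"
  assumes c: "0 < c" and h: "continuous_on {0..c} h"
  shows "(\<lambda>n. integral {0..c} (\<lambda>s. of_real (bump (1 / real (Suc n)) 1 (c - s)) * h s)) \<longlonglongrightarrow> h c"
proof -
  obtain B0 where B0: "\<And>s. s \<in> {0..c} \<Longrightarrow> norm (h s) \<le> B0"
    using compact_imp_bounded[OF compact_continuous_image[OF h compact_Icc]] unfolding bounded_iff by blast
  define B where "B = B0 + 1"
  have B: "0 < B" "\<And>s. s \<in> {0..c} \<Longrightarrow> norm (h s) \<le> B"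
    using order_trans[OF norm_ge_zero B0[of 0]] c unfolding B_def by (auto intro: order_trans[OF B0])
  define b where "b = (\<lambda>n s. bump (1 / real (Suc n)) 1 (c - s))"
  have bcont: "continuous_on {0..c} (b n)" for n
    unfolding b_def by (intro continuous_intros continuous_on_compose2[OF bump_continuous[of _ UNIV]]) auto
  have b0: "0 \<le> b n s" for n s by (simp add: b_def bump_1)
  have bint: "(b n has_integral bump (1 / real (Suc n)) 0 c) {0..c}" for n
  proof -
    have "(b n has_integral (- bump (1 / real (Suc n)) 0 (c - c)) - (- bump (1 / real (Suc n)) 0 (c - 0))) {0..c}"
      unfolding b_def using c
      by (intro fundamental_theorem_of_calculus)
        (auto intro!: derivative_eq_intros DERIV_chain2[OF bump_derivative] simp: has_real_derivative_iff_has_vector_derivative[symmetric])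
    then show ?thesis by (simp add: bump_0)
  qed
  \<comment> \<open>The integrand of the first moment; for s < c it has the form z exp(-z), bounded
    by 1.\<close>
  define m where "m = (\<lambda>n s. b n s * (c - s))"
  have mlim: "(\<lambda>n. integral {0..c} (m n)) \<longlonglongrightarrow> integral {0..c} (\<lambda>_. 0)"
  proof (rule dominated_convergence(2)[where h = "\<lambda>_. 1"])
    show "m n integrable_on {0..c}" for n
      unfolding m_def by (intro integrable_continuous_real continuous_intros bcont)
    show "(\<lambda>_. 1) integrable_on {0..c}" by (rule integrable_const_ivl)
    have m: "m n s = (1 / real (Suc n) / (c - s)) * exp (- (1 / real (Suc n) / (c - s)))" if "s < c" for n s
      using that by (simp add: m_def b_def bump_1 power2_eq_square)
    show "norm (m n s) \<le> 1" if "s \<in> {0..c}" for n s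
    proof (cases "s < c")
      case True
      define z where "z = 1 / real (Suc n) / (c - s)"
      have z: "0 \<le> z" using True by (simp add: z_def)
      have "z \<le> exp z" using exp_ge_add_one_self[of z] by linarith
      then have "z * exp (- z) \<le> 1" by (simp add: exp_minus divide_le_eq flip: divide_inverse)
      then show ?thesis using z unfolding m[OF True] z_def[symmetric] by simp
    next
      case False
      then show ?thesis using that by (simp add: m_def)
    qed
    show "(\<lambda>n. m n s) \<longlonglongrightarrow> 0" if "s \<in> {0..c}" for s
    proof (cases "s < c")
      case True
      have "(\<lambda>n. (1 / real (Suc n) / (c - s)) * exp (- (1 / real (Suc n) / (c - s)))) \<longlonglongrightarrow> (0 / (c - s)) * exp (- (0 / (c - s)))"
        by (intro tendsto_intros LIMSEQ_Suc[OF lim_1_over_n]) (use True in auto)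
      then show ?thesis using m[OF True] by simp
    next
      case False
      then show ?thesis using that by (simp add: m_def)
    qed
  qed
  have lim1: "(\<lambda>n. of_real (bump (1 / real (Suc n)) 0 c) * h c) \<longlonglongrightarrow> of_real 1 * h c"
    by (intro tendsto_intros bump_limit c)
  have lim2: "(\<lambda>n. integral {0..c} (\<lambda>s. of_real (b n s) * h s) - of_real (bump (1 / real (Suc n)) 0 c) * h c) \<longlonglongrightarrow> 0"
  proof (rule LIMSEQ_I)
    fix e :: real assume e: "0 < e"
    obtain \<eta> where \<eta>: "0 < \<eta>" "\<And>s. s \<in> {0..c} \<Longrightarrow> dist s c < \<eta> \<Longrightarrow> dist (h s) (h c) < e / 2"
      using h c e unfolding continuous_on_iff by (metis atLeastAtMost_iff half_gt_zero less_eq_real_def order_refl)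
    \<comment> \<open>Beyond distance \<eta> from c the line with slope C lies above the trivial
      bound 2 B.\<close>
    define C where "C = 2 * B / \<eta>"
    have C: "0 < C" using B \<eta> by (simp add: C_def)
    have dom: "norm (h s - h c) \<le> e / 2 + C * (c - s)" if s: "s \<in> {0..c}" for s
    proof (cases "c - s < \<eta>")
      case True
      then have "norm (h s - h c) < e / 2" using \<eta>(2)[OF s] s by (simp add: dist_norm dist_real_def)
      moreover have "0 \<le> C * (c - s)" using C s by simp
      ultimately show ?thesis by linarith
    next
      case False
      have "norm (h s - h c) \<le> B + B" using B(2)[OF s] B(2)[of c] c by (intro norm_triangle_le_diff add_mono) auto
      also have "\<dots> = C * \<eta>" using \<eta> by (simp add: C_def)
      also have "\<dots> \<le> C * (c - s)" using False C by (intro mult_left_mono) auto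
      finally show ?thesis using e by linarith
    qed
    obtain N where N: "\<And>n. N \<le> n \<Longrightarrow> norm (integral {0..c} (m n)) < e / 2 / C"
      using LIMSEQ_D[OF mlim, of "e / 2 / C"] e C by auto
    show "\<exists>no. \<forall>n\<ge>no. norm (integral {0..c} (\<lambda>s. of_real (b n s) * h s) - of_real (bump (1 / real (Suc n)) 0 c) * h c - 0) < e"
    proof (intro exI[of _ N] allI impI)
      fix n assume n: "N \<le> n"
      have i1: "(\<lambda>s. of_real (b n s) * h s) integrable_on {0..c}"
        by (intro integrable_continuous_real continuous_intros bcont h)
      have "((\<lambda>s. of_real (b n s) * h c) has_integral of_real (bump (1 / real (Suc n)) 0 c) * h c) {0..c}"
        using has_integral_mult_left[OF has_integral_of_real[OF bint[of n], where 'b = complex], of "h c"] by simp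
      then have "integral {0..c} (\<lambda>s. of_real (b n s) * h s) - of_real (bump (1 / real (Suc n)) 0 c) * h c
          = integral {0..c} (\<lambda>s. of_real (b n s) * h s - of_real (b n s) * h c)"
        using i1 by (subst Henstock_Kurzweil_Integration.integral_diff) (auto simp: has_integral_iff)
      also have "norm \<dots> \<le> integral {0..c} (\<lambda>s. e / 2 * b n s + C * m n s)"
      proof (rule integral_norm_bound_integral)
        show "(\<lambda>s. of_real (b n s) * h s - of_real (b n s) * h c) integrable_on {0..c}"
          by (intro integrable_continuous_real continuous_intros bcont h)
        show "(\<lambda>s. e / 2 * b n s + C * m n s) integrable_on {0..c}"
          unfolding m_def by (intro integrable_continuous_real continuous_intros bcont)
        fix s assume s: "s \<in> {0..c}"
        have "norm (of_real (b n s) * h s - of_real (b n s) * h c) = b n s * norm (h s - h c)"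
          using b0 by (simp add: norm_mult flip: right_diff_distrib)
        also have "\<dots> \<le> b n s * (e / 2 + C * (c - s))" by (intro mult_left_mono dom s b0)
        also have "\<dots> = e / 2 * b n s + C * m n s" by (simp add: m_def algebra_simps)
        finally show "norm (of_real (b n s) * h s - of_real (b n s) * h c) \<le> e / 2 * b n s + C * m n s" .
      qed
      also have "\<dots> = e / 2 * bump (1 / real (Suc n)) 0 c + C * integral {0..c} (m n)"
      proof -
        have "m n integrable_on {0..c}"
          unfolding m_def by (intro integrable_continuous_real continuous_intros bcont)
        then show ?thesis
          by (intro integral_unique has_integral_add has_integral_mult_right bint integrable_integral)
      qed
      also have "\<dots> < e / 2 * 1 + C * (e / 2 / C)"
      proof (rule add_le_less_mono)
        show "e / 2 * bump (1 / real (Suc n)) 0 c \<le> e / 2 * 1" using e c by (intro mult_left_mono) (auto simp: bump_0)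
        show "C * integral {0..c} (m n) < C * (e / 2 / C)" using N[OF n] C by (intro mult_strict_left_mono) auto
      qed
      also have "\<dots> = e" using C by simp
      finally show "norm (integral {0..c} (\<lambda>s. of_real (b n s) * h s) - of_real (bump (1 / real (Suc n)) 0 c) * h c - 0) < e" by simp
    qed
  qed
  from tendsto_add[OF lim2 lim1] show ?thesis by (simp add: b_def)
qed

section \<open>Fubini for Lebesgue measurable functions of two variables\<close>

text \<open>The product formula applies to sets of the product sigma-algebra. The main part of Z is
  such a set with the same measure, and its sections lie in those of Z.\<close>

lemma null_set_of_sections:
  fixes Z :: "(real \<times> real) set"
  assumes Z: "Z \<in> sets lebesgue" and sec: "\<And>t. {x. (t, x) \<in> Z} \<in> null_sets lebesgue"
  shows "Z \<in> null_sets lebesgue"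
proof -
  define S where "S = main_part lborel Z"
  have S: "S \<in> sets lborel" "S \<subseteq> Z"
    unfolding S_def using main_part_sets[OF Z] main_part_null_part_Un[OF Z] by blast+
  have S2: "S \<in> sets (lborel \<Otimes>\<^sub>M lborel)" unfolding lborel_prod by (rule S(1))
  have "emeasure lborel (Pair t -` S) = 0" for t
  proof -
    have "Pair t -` S \<in> sets lborel" using S2 by (rule sets_Pair1)
    moreover have "Pair t -` S \<in> null_sets lebesgue"
      using S(2) by (intro null_sets_completion_subset[OF _ sec[of t]]) auto
    ultimately have "Pair t -` S \<in> null_sets lborel" by (simp add: null_sets_completion_iff)
    then show ?thesis by auto
  qed
  then have "emeasure (lborel \<Otimes>\<^sub>M lborel) S = 0"
    by (simp add: lborel.emeasure_pair_measure_alt[OF S2])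
  then have "emeasure lebesgue Z = 0"
    using Z by (simp add: emeasure_completion S_def lborel_prod)
  then show ?thesis using Z by (simp add: null_sets_def)
qed

lemma integrable_lebesgue_of_borel:
  fixes f :: "'a :: euclidean_space \<Rightarrow> complex"
  assumes "integrable lborel f"
  shows "integrable lebesgue f" "integral\<^sup>L lebesgue f = integral\<^sup>L lborel f"
  using assms by (auto simp: integrable_completion integral_completion)

text \<open>The solution is only Lebesgue measurable in (t, x), so Fubini is applied to a Borel
  function U that agrees with w almost everywhere at each time in K; outside K the factor \<theta>
  vanishes.\<close>

lemma spacetime_integral_fourier:
  fixes w U :: "real \<Rightarrow> real \<Rightarrow> complex" and \<theta> :: "real \<Rightarrow> complex"
  assumes wm: "set_borel_measurable lebesgue (J \<times> {0..2 * pi}) (\<lambda>(t, x). w t x)"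
    and U: "(\<lambda>(t, x). U t x) \<in> borel_measurable borel"
    and UB: "\<And>t x. t \<in> K \<Longrightarrow> cmod (U t x) \<le> B"
    and K: "compact K" "K \<subseteq> J" and \<theta>: "continuous_on UNIV \<theta>" "\<And>t. t \<in> J - K \<Longrightarrow> \<theta> t = 0"
    and wU: "\<And>t. t \<in> K \<Longrightarrow> w t \<in> borel_measurable torus_measure \<and> U t \<in> borel_measurable torus_measure \<and>
      (AE x in torus_measure. w t x = U t x)"
  shows "spacetime_integral J (\<lambda>t x. w t x * (\<theta> t * ek (- k) x))
      = (LINT t:J|lebesgue. \<theta> t * (of_real (sqrt (2 * pi)) * fourier (w t) k))"
    and "set_integrable lebesgue J (\<lambda>t. \<theta> t * (of_real (sqrt (2 * pi)) * fourier (w t) k))"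
proof -
  let ?I = "{0..2 * pi} :: real set"
  let ?r = "of_real (sqrt (2 * pi)) :: complex"
  define F where "F = (\<lambda>(t, x). indicator (J \<times> ?I) (t, x) *\<^sub>R (w t x * (\<theta> t * ek (- k) x)))"
  define H where "H = (\<lambda>(t, x). indicator K t *\<^sub>R (indicator ?I x *\<^sub>R (U t x * (\<theta> t * ek (- k) x))))"
  have Kb: "K \<in> sets borel" using K by (simp add: compact_imp_closed)
  have \<theta>b: "\<theta> \<in> borel_measurable borel" using \<theta>(1) by (rule borel_measurable_continuous_onI)
  have ekb: "ek (- k) \<in> borel_measurable borel" by (rule borel_measurable_continuous_onI[OF continuous_ek])
  have U': "(\<lambda>z. U (fst z) (snd z)) \<in> borel_measurable (borel \<Otimes>\<^sub>M borel)"
    using U by (simp add: case_prod_beta' borel_prod)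
  have H: "H \<in> borel_measurable (borel \<Otimes>\<^sub>M borel)"
    unfolding H_def case_prod_beta'
    using Kb \<theta>b ekb U' by measurable
  have Hb: "H \<in> borel_measurable lborel" using H by (simp add: borel_prod)
  obtain X where X: "\<And>t. t \<in> K \<Longrightarrow> cmod (\<theta> t) \<le> X"
    using compact_imp_bounded[OF compact_continuous_image[OF continuous_on_subset[OF \<theta>(1)] K(1)]]
    unfolding bounded_iff by blast
  have HB: "norm (H z) \<le> norm ((\<bar>B\<bar> * \<bar>X\<bar>) * indicator (K \<times> ?I) z)" for z
  proof (cases z)
    case (Pair t x)
    show ?thesis
    proof (cases "t \<in> K \<and> x \<in> ?I")
      case True
      have "cmod (U t x) * cmod (\<theta> t) \<le> \<bar>B\<bar> * \<bar>X\<bar>"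
        using UB[of t x] X[of t] True by (intro mult_mono) auto
      then show ?thesis using True Pair by (simp add: H_def norm_mult)
    qed (auto simp: Pair H_def)
  qed
  have Hint: "integrable lborel H"
  proof (rule Bochner_Integration.integrable_bound[OF _ Hb])
    have "K \<times> ?I \<in> sets borel" using K by (intro borel_closed closed_Times compact_imp_closed) auto
    moreover have "emeasure lborel (K \<times> ?I) < \<infinity>"
      using K by (intro emeasure_bounded_finite bounded_Times compact_imp_bounded) auto
    ultimately show "integrable lborel (\<lambda>z. (\<bar>B\<bar> * \<bar>X\<bar>) * indicator (K \<times> ?I) z)"
      by (intro integrable_mult_right integrable_real_indicator) auto
    show "AE z in lborel. norm (H z) \<le> norm ((\<bar>B\<bar> * \<bar>X\<bar>) * indicator (K \<times> ?I) z)"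
      using HB by simp
  qed
  have Hint2: "integrable (lborel \<Otimes>\<^sub>M lborel) H" using Hint by (simp add: lborel_prod)
  have Fm: "F \<in> borel_measurable lebesgue"
  proof -
    have "(\<lambda>z. indicator (J \<times> ?I) z *\<^sub>R (case z of (t, x) \<Rightarrow> w t x)) \<in> borel_measurable lebesgue"
      using wm by (simp add: set_borel_measurable_def)
    moreover have "(\<lambda>z. \<theta> (fst z) * ek (- k) (snd z)) \<in> borel_measurable lebesgue"
    proof (rule measurable_completion)
      have "(\<lambda>z. \<theta> (fst z) * ek (- k) (snd z)) \<in> borel_measurable (borel \<Otimes>\<^sub>M borel)"
        using \<theta>b ekb by measurable
      then show "(\<lambda>z. \<theta> (fst z) * ek (- k) (snd z)) \<in> borel_measurable lborel" by (simp add: borel_prod)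
    qed
    ultimately have "(\<lambda>z. (indicator (J \<times> ?I) z *\<^sub>R (case z of (t, x) \<Rightarrow> w t x)) * (\<theta> (fst z) * ek (- k) (snd z))) \<in> borel_measurable lebesgue"
      by (rule borel_measurable_times)
    then show ?thesis by (simp add: F_def case_prod_beta')
  qed
  have Hm: "H \<in> borel_measurable lebesgue" using Hb by (intro measurable_completion) simp
  have AE: "AE z in lebesgue. F z = H z"
  proof -
    have "{z \<in> space lebesgue. F z \<noteq> H z} \<in> sets lebesgue" using Fm Hm by measurable
    then have "{z. F z \<noteq> H z} \<in> null_sets lebesgue"
    proof (intro null_set_of_sections)
      fix t
      show "{x. (t, x) \<in> {z. F z \<noteq> H z}} \<in> null_sets lebesgue"
      proof (cases "t \<in> K")
        case False
        then have "{x. (t, x) \<in> {z. F z \<noteq> H z}} = {}" using \<theta>(2)[of t] by (auto simp: F_def H_def indicator_def)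
        then show ?thesis by simp
      next
        case True
        then have "AE x in lebesgue. x \<in> ?I \<longrightarrow> w t x = U t x" using wU by (simp add: AE_torus_iff)
        then have "AE x in lebesgue. F (t, x) = H (t, x)"
          by (rule eventually_mono) (use True K in \<open>auto simp: F_def H_def indicator_def\<close>)
        then obtain N where "N \<in> null_sets lebesgue" "{x. F (t, x) \<noteq> H (t, x)} \<subseteq> N"
          by (elim AE_E3) (simp add: subset_iff, blast)
        then show ?thesis by (auto intro: null_sets_completion_subset)
      qed
    qed simp
    then show ?thesis by (rule AE_I') auto
  qed
  have inner: "(\<integral>x. H (t, x) \<partial>lborel) = indicator J t *\<^sub>R (\<theta> t * (?r * fourier (w t) k))" for t
  proof (cases "t \<in> K")
    case True
    have "(\<integral>x. H (t, x) \<partial>lborel) = (\<integral>x. H (t, x) \<partial>lebesgue)"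
    proof (rule integral_completion[symmetric])
      show "(\<lambda>x. H (t, x)) \<in> borel_measurable lborel"
        using measurable_Pair2[OF H, of t] by simp
    qed
    also have "\<dots> = \<theta> t * (LINT x:?I|lebesgue. ek (- k) x * U t x)"
      unfolding set_lebesgue_integral_def integral_mult_right_zero[symmetric]
      using True by (intro Bochner_Integration.integral_cong) (auto simp: H_def indicator_def)
    also have "(LINT x:?I|lebesgue. ek (- k) x * U t x) = ?r * fourier (U t) k"
      using torus_integral_eq[of "\<lambda>x. ek (- k) x * U t x"] by (simp add: fourier_eq torus_integral_def)
    also have "fourier (U t) k = fourier (w t) k"
      using wU[OF True] by (intro fourier_cong_AE) (auto elim: eventually_mono)
    finally show ?thesis using True K by auto
  qed (use \<theta>(2) in \<open>auto simp: H_def indicator_def\<close>)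
  have "spacetime_integral J (\<lambda>t x. w t x * (\<theta> t * ek (- k) x)) = integral\<^sup>L lebesgue F"
    by (simp add: spacetime_integral_def set_lebesgue_integral_def F_def case_prod_beta')
  also have "\<dots> = integral\<^sup>L lebesgue H" by (rule integral_cong_AE[OF Fm Hm AE])
  also have "\<dots> = integral\<^sup>L (lborel \<Otimes>\<^sub>M lborel) H"
    using Hint by (simp add: integrable_lebesgue_of_borel lborel_prod)
  also have "\<dots> = (\<integral>t. (\<integral>x. H (t, x) \<partial>lborel) \<partial>lborel)"
    by (rule lborel_pair.integral_fst'[OF Hint2, symmetric])
  also have "\<dots> = (\<integral>t. (\<integral>x. H (t, x) \<partial>lborel) \<partial>lebesgue)"
    by (rule integrable_lebesgue_of_borel(2)[OF lborel_pair.integrable_fst'[OF Hint2], symmetric])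
  also have "\<dots> = (LINT t:J|lebesgue. \<theta> t * (?r * fourier (w t) k))"
    by (simp add: inner set_lebesgue_integral_def)
  finally show "spacetime_integral J (\<lambda>t x. w t x * (\<theta> t * ek (- k) x))
      = (LINT t:J|lebesgue. \<theta> t * (?r * fourier (w t) k))" .
  show "set_integrable lebesgue J (\<lambda>t. \<theta> t * (?r * fourier (w t) k))"
    using integrable_lebesgue_of_borel(1)[OF lborel_pair.integrable_fst'[OF Hint2]]
    by (simp add: inner set_integrable_def)
qed

section \<open>Test functions for both time directions\<close>

text \<open>With \<sigma> = 1 or -1 the substitution t = \<sigma> s reduces [0, T) and (-T, 0] to
  one argument with s \<ge> 0.\<close>

definition time_interval :: "real \<Rightarrow> real \<Rightarrow> real set" where
  "time_interval \<sigma> T = {t. 0 \<le> \<sigma> * t \<and> \<sigma> * t < T}"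

definition time_segment :: "real \<Rightarrow> real \<Rightarrow> real set" where
  "time_segment \<sigma> c = {t. 0 \<le> \<sigma> * t \<and> \<sigma> * t \<le> c}"

lemma time_interval_simps: "time_interval 1 T = {0..<T}" "time_interval (- 1) T = {- T<..0}"
  by (auto simp: time_interval_def)

lemma time_segment_simps: "time_segment 1 c = {0..c}" "time_segment (- 1) c = {- c..0}"
  by (auto simp: time_segment_def)

lemma ek_derivative: "(ek k has_vector_derivative \<i> * of_int k * ek k x) (at x within A)"
  unfolding ek_def
  by (auto intro!: derivative_eq_intros has_vector_derivative_real_field)

lemma ek_periodic: "ek k (x + 2 * pi) = ek k x"
proof -
  have "\<i> * of_int k * of_real (x + 2 * pi) = \<i> * of_int k * of_real x + 2 * of_int k * of_real pi * \<i>"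
    by (simp add: algebra_simps)
  then show ?thesis
    unfolding ek_def using exp_integer_2pi[of "of_int k"] by (simp only: exp_add) (simp add: mult_ac)
qed

text \<open>The exponential has frequency -k because testing is bilinear, so that it picks out the
  coefficient at k. The cutoff is positive at t = 0, which keeps the initial datum in the
  identity.\<close>

definition test_bump :: "real \<Rightarrow> real \<Rightarrow> real \<Rightarrow> int \<Rightarrow> real \<Rightarrow> real \<Rightarrow> complex" where
  "test_bump \<delta> c \<sigma> k t x = of_real (bump \<delta> 0 (c - \<sigma> * t)) * ek (- k) x"

context
  fixes \<sigma> :: real
  assumes \<sigma>: "\<sigma> = 1 \<or> \<sigma> = - 1"
begin

lemma time_sets [measurable]: "time_interval \<sigma> T \<in> sets borel" "time_segment \<sigma> T \<in> sets borel"
  using \<sigma> by (auto simp: time_interval_simps time_segment_simps)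

lemma compact_time_segment: "compact (time_segment \<sigma> c)"
  using \<sigma> by (auto simp: time_segment_simps)

lemma time_segment_subset: "c < T \<Longrightarrow> time_segment \<sigma> c \<subseteq> time_interval \<sigma> T"
  by (auto simp: time_segment_def time_interval_def)

text \<open>\<open>dt\<close> is a derivative within J, and this is determined only at limit points
  of J.\<close>

lemma at_within_time_interval:
  assumes "0 < T" "t \<in> time_interval \<sigma> T"
  shows "at t within time_interval \<sigma> T \<noteq> bot"
proof -
  have "connected (time_interval \<sigma> T)" using \<sigma> by (auto simp: time_interval_simps)
  moreover have "time_interval \<sigma> T \<noteq> {t}"
  proof
    assume *: "time_interval \<sigma> T = {t}"
    have "0 \<in> time_interval \<sigma> T" "\<sigma> * (T / 2) \<in> time_interval \<sigma> T"
      using \<sigma> assms(1) by (auto simp: time_interval_def)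
    then have "\<sigma> * (T / 2) = 0" unfolding * by simp
    then show False using \<sigma> assms(1) by auto
  qed
  ultimately have "t islimpt time_interval \<sigma> T"
    using assms(2) by (intro connected_imp_perfect) auto
  then show ?thesis by (simp add: trivial_limit_within)
qed

lemma bump_time_derivative:
  assumes "0 < \<delta>"
  shows "((\<lambda>t. of_real (bump \<delta> i (c - \<sigma> * t)) :: complex) has_vector_derivative
    of_real (- \<sigma> * bump \<delta> (Suc i) (c - \<sigma> * t))) (at t within A)"
proof (rule has_vector_derivative_of_real)
  have "((\<lambda>t. c - \<sigma> * t) has_real_derivative - \<sigma>) (at t within A)"
    by (auto intro!: derivative_eq_intros)
  from DERIV_chain2[OF bump_derivative[OF assms] this]
  show "((\<lambda>t. bump \<delta> i (c - \<sigma> * t)) has_real_derivative - \<sigma> * bump \<delta> (Suc i) (c - \<sigma> * t)) (at t within A)"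
    by (simp add: mult.commute)
qed

lemma test_function_test_bump:
  assumes \<delta>: "0 < \<delta>" and c: "0 < c" "c < T"
  shows "test_function (time_interval \<sigma> T) (test_bump \<delta> c \<sigma> k)"
  unfolding test_function_def
proof (intro conjI ballI)
  let ?J = "time_interval \<sigma> T"
  define D where "D = (\<lambda>i j t x. of_real ((- \<sigma>) ^ i * bump \<delta> i (c - \<sigma> * t)) * ((\<i> * of_int (- k)) ^ j * ek (- k) x))"
  show "smooth_on ?J (test_bump \<delta> c \<sigma> k)"
    unfolding smooth_on_def
  proof (intro exI[of _ D] conjI allI ballI)
    show "D 0 0 = test_bump \<delta> c \<sigma> k" by (auto simp: D_def test_bump_def fun_eq_iff)
    fix i j
    have "continuous_on (?J \<times> UNIV) (\<lambda>z. D i j (fst z) (snd z))"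
      unfolding D_def
      by (intro continuous_intros continuous_on_compose2[OF bump_continuous[OF \<delta>, of UNIV]]
          continuous_on_compose2[OF continuous_ek[of UNIV]]) auto
    then show "continuous_on (?J \<times> UNIV) (\<lambda>(t, x). D i j t x)" by (simp add: case_prod_beta')
    fix t x
    have "((\<lambda>t. of_real ((- \<sigma>) ^ i) * of_real (bump \<delta> i (c - \<sigma> * t)) * ((\<i> * of_int (- k)) ^ j * ek (- k) x)) has_vector_derivative
       of_real ((- \<sigma>) ^ i) * of_real (- \<sigma> * bump \<delta> (Suc i) (c - \<sigma> * t)) * ((\<i> * of_int (- k)) ^ j * ek (- k) x)) (at t within ?J)"
      by (intro has_vector_derivative_mult_left has_vector_derivative_mult_right bump_time_derivative \<delta>)
    then show "((\<lambda>t. D i j t x) has_vector_derivative D (Suc i) j t x) (at t within ?J)"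
      by (simp add: D_def mult_ac)
    have "((\<lambda>x. of_real ((- \<sigma>) ^ i * bump \<delta> i (c - \<sigma> * t)) * ((\<i> * of_int (- k)) ^ j * ek (- k) x)) has_vector_derivative
      of_real ((- \<sigma>) ^ i * bump \<delta> i (c - \<sigma> * t)) * ((\<i> * of_int (- k)) ^ j * (\<i> * of_int (- k) * ek (- k) x))) (at x)"
      by (intro has_vector_derivative_mult_right ek_derivative)
    then show "(D i j t has_vector_derivative D i (Suc j) t x) (at x)"
      by (simp add: D_def mult_ac)
  qed
  show "periodic (test_bump \<delta> c \<sigma> k t)" for t
    by (simp add: periodic_def test_bump_def ek_periodic)
  show "\<exists>K. compact K \<and> K \<subseteq> ?J \<and> (\<forall>t\<in>?J - K. \<forall>x. test_bump \<delta> c \<sigma> k t x = 0)"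
    using compact_time_segment time_segment_subset[OF c(2)]
    by (intro exI[of _ "time_segment \<sigma> c"])
      (auto simp: test_bump_def bump_def time_segment_def time_interval_def)
qed

lemma dt_test_bump:
  assumes "0 < \<delta>" "0 < T" "t \<in> time_interval \<sigma> T"
  shows "dt (time_interval \<sigma> T) (test_bump \<delta> c \<sigma> k) t x
    = of_real (- \<sigma> * bump \<delta> 1 (c - \<sigma> * t)) * ek (- k) x"
  unfolding dt_def test_bump_def One_nat_def
  by (rule vector_derivative_within[OF at_within_time_interval[OF assms(2,3)]])
    (intro has_vector_derivative_mult_left bump_time_derivative assms)

lemma dx_power_test_bump:
  "(dx ^^ n) (test_bump \<delta> c \<sigma> k) = (\<lambda>t x. (- \<i> * of_int k) ^ n * test_bump \<delta> c \<sigma> k t x)"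
proof (induction n)
  case (Suc n)
  have "dx ((dx ^^ n) (test_bump \<delta> c \<sigma> k)) t x = (- \<i> * of_int k) ^ Suc n * test_bump \<delta> c \<sigma> k t x" for t x
    unfolding dx_def Suc.IH
  proof (rule vector_derivative_at)
    have "((\<lambda>x. (- \<i> * of_int k) ^ n * (of_real (bump \<delta> 0 (c - \<sigma> * t)) * ek (- k) x)) has_vector_derivative
      (- \<i> * of_int k) ^ n * (of_real (bump \<delta> 0 (c - \<sigma> * t)) * (\<i> * of_int (- k) * ek (- k) x))) (at x)"
      by (intro has_vector_derivative_mult_right ek_derivative)
    then show "((\<lambda>x. (- \<i> * of_int k) ^ n * test_bump \<delta> c \<sigma> k t x) has_vector_derivative
      (- \<i> * of_int k) ^ Suc n * test_bump \<delta> c \<sigma> k t x) (at x)"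
      by (simp add: test_bump_def mult_ac)
  qed
  then show ?case by (simp add: fun_eq_iff)
qed simp

lemma time_integral_eq:
  fixes f :: "real \<Rightarrow> complex"
  assumes c: "0 < c" "c < T" and f: "continuous_on (time_segment \<sigma> c) f"
    and z: "\<And>t. t \<in> time_interval \<sigma> T - time_segment \<sigma> c \<Longrightarrow> f t = 0"
  shows "(LINT t:time_interval \<sigma> T|lebesgue. f t) = integral {0..c} (\<lambda>s. f (\<sigma> * s))"
    and "set_integrable lebesgue (time_interval \<sigma> T) f"
proof -
  have eq: "(\<lambda>t. indicator (time_interval \<sigma> T) t *\<^sub>R f t) = (\<lambda>t. indicator (time_segment \<sigma> c) t *\<^sub>R f t)"
    using z time_segment_subset[OF c(2)] by (auto simp: fun_eq_iff indicator_def)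
  have abs: "set_integrable lebesgue (time_segment \<sigma> c) f"
    using \<sigma> f by (auto simp: time_segment_simps intro: absolutely_integrable_continuous_real)
  then show "set_integrable lebesgue (time_interval \<sigma> T) f"
    by (simp add: set_integrable_def eq)
  have "(LINT t:time_interval \<sigma> T|lebesgue. f t) = (LINT t:time_segment \<sigma> c|lebesgue. f t)"
    by (simp add: set_lebesgue_integral_def eq)
  also have "\<dots> = integral (time_segment \<sigma> c) f"
    using abs by (rule set_lebesgue_integral_eq_integral)
  also have "\<dots> = integral {0..c} (\<lambda>s. f (\<sigma> * s))"
    using \<sigma> integral_reflect_real[of 0 "- c" f] Henstock_Kurzweil_Integration.integral_reflect_real[of c 0 "\<lambda>s. f (- s)"]
    by (auto simp: time_segment_simps)
  finally show "(LINT t:time_interval \<sigma> T|lebesgue. f t) = integral {0..c} (\<lambda>s. f (\<sigma> * s))" .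
qed

end

context raman
begin

section \<open>From the weak identity to ordinary differential equations\<close>

text \<open>A uniform limit of finite truncations: by \<open>nlt_truncation\<close> the tails are
  small uniformly on the ball, hence uniformly in t.\<close>

lemma continuous_on_nl:
  assumes b: "\<And>t. t \<in> I \<Longrightarrow> h_bounded 1 R (a t)" and c: "\<And>k. continuous_on I (\<lambda>t. a t k)"
  shows "continuous_on I (\<lambda>t. nl (a t) k)"
proof (cases "I = {}")
  case False
  then have R: "0 \<le> R" using b h_bounded_nonneg by blast
  have "\<exists>F. finite F \<and> (\<forall>a. h_bounded 1 R a \<longrightarrow> cmod (nl a k - sum (nlt a k) F) \<le> 1 / real (Suc n))" for n
    using nlt_truncation[OF _ R, of "1 / real (Suc n)" UNIV k] unfolding nl_def by auto
  then obtain F where F: "\<And>n. finite (F n)" "\<And>n a. h_bounded 1 R a \<Longrightarrow> cmod (nl a k - sum (nlt a k) (F n)) \<le> 1 / real (Suc n)"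
    by metis
  show ?thesis
  proof (rule uniform_limit_theorem)
    show "\<forall>\<^sub>F n in sequentially. continuous_on I (\<lambda>t. sum (nlt (a t) k) (F n))"
      unfolding nlt_def by (intro always_eventually allI continuous_intros) (auto intro!: continuous_intros c)
    show "uniform_limit I (\<lambda>n t. sum (nlt (a t) k) (F n)) (\<lambda>t. nl (a t) k) sequentially"
    proof (rule uniform_limitI)
      fix e :: real assume "0 < e"
      then obtain N where N: "1 / real (Suc N) < e" using nat_approx_posE by blast
      have "dist (sum (nlt (a t) k) (F n)) (nl (a t) k) < e" if "N \<le> n" "t \<in> I" for n t
      proof -
        have "1 / real (Suc n) \<le> 1 / real (Suc N)" using that by (intro divide_left_mono) auto
        then show ?thesis using F(2)[OF b[OF that(2)], of n] N by (simp add: dist_norm norm_minus_commute)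
      qed
      then show "\<forall>\<^sub>F n in sequentially. \<forall>t\<in>I. dist (sum (nlt (a t) k) (F n)) (nl (a t) k) < e"
        by (intro eventually_sequentiallyI[of N]) auto
    qed
  qed simp
qed simp


end

text \<open>Supplies the Borel representative for \<open>spacetime_integral_fourier\<close>; cutting
  the coefficients off outside I makes the series converge at every t.\<close>

lemma wsum_spacetime_measurable:
  fixes a :: "real \<Rightarrow> int \<Rightarrow> complex"
  assumes a: "\<And>k. continuous_on I (\<lambda>t. a t k)" and I: "I \<in> sets borel"
    and b: "\<And>t. t \<in> I \<Longrightarrow> (\<lambda>k. cmod (a t k)) summable_on UNIV"
  shows "(\<lambda>(t, x). wsum (\<lambda>k. indicator I t *\<^sub>R a t k) x) \<in> borel_measurable borel"
proof -
  have sm: "(\<lambda>k. cmod (indicator I t *\<^sub>R a t k)) summable_on UNIV" for t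
    using b[of t] by (cases "t \<in> I") auto
  have am: "(\<lambda>t. indicator I t *\<^sub>R a t k) \<in> borel_measurable borel" for k
    using I a by (rule borel_measurable_continuous_on_indicator)
  have ekb: "ek k \<in> borel_measurable borel" for k by (rule borel_measurable_continuous_onI[OF continuous_ek])
  have "(\<lambda>z. wsum (\<lambda>k. indicator I (fst z) *\<^sub>R a (fst z) k) (snd z)) \<in> borel_measurable (borel \<Otimes>\<^sub>M borel)"
  proof (rule borel_measurable_LIMSEQ_metric[OF _ wsum_limit[OF sm]])
    fix n
    have "(\<lambda>z. indicator I (fst z) *\<^sub>R a (fst z) k) \<in> borel_measurable (borel \<Otimes>\<^sub>M borel)"
      "(\<lambda>z. ek k (snd z)) \<in> borel_measurable (borel \<Otimes>\<^sub>M borel)" for k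
      using am ekb by measurable
    then show "(\<lambda>z. \<Sum>k\<in>{- int n..int n}. indicator I (fst z) *\<^sub>R a (fst z) k * ek k (snd z) / of_real (sqrt (2 * pi)))
        \<in> borel_measurable (borel \<Otimes>\<^sub>M borel)"
      by (intro borel_measurable_sum borel_measurable_divide borel_measurable_times borel_measurable_const)
  qed
  then show ?thesis by (simp add: borel_prod case_prod_beta')
qed

lemma spacetime_integral_cong:
  assumes "J \<in> sets borel" "\<And>t x. t \<in> J \<Longrightarrow> f t x = g t x"
  shows "spacetime_integral J f = spacetime_integral J g"
  unfolding spacetime_integral_def set_lebesgue_integral_def
  using assms by (intro Bochner_Integration.integral_cong) (auto simp: indicator_def)

lemma pairing_cmult: "pairing c (\<lambda>x. z * g x) = z * pairing c g"
  unfolding pairing_def by (simp add: fourier_cmult mult.left_commute infsum_cmult_right')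

text \<open>The Fourier series of u(t) is the Borel representative. On an H^1 ball it is uniformly
  bounded, and therefore so are its linear and cubic expressions.\<close>

lemma spacetime_integral_nonlinear:
  fixes u :: "real \<Rightarrow> real \<Rightarrow> complex" and \<theta> :: "real \<Rightarrow> complex"
  assumes I: "compact I" "I \<subseteq> J" "J \<in> sets borel"
    and um: "set_borel_measurable lebesgue (J \<times> {0..2 * pi}) (\<lambda>(t, x). u t x)"
    and sq: "\<And>t. t \<in> I \<Longrightarrow> square_integrable (u t)" "\<And>t. t \<in> I \<Longrightarrow> h_bounded 1 R (fourier (u t))"
    and cont: "\<And>k. continuous_on I (\<lambda>t. fourier (u t) k)"
    and \<theta>: "continuous_on UNIV \<theta>" "\<And>t. t \<in> J - I \<Longrightarrow> \<theta> t = 0"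
  shows "spacetime_integral J (\<lambda>t x. (C1 * u t x + C2 * (of_real ((cmod (u t x))\<^sup>2) * u t x)) * (\<theta> t * ek (- k) x))
      = (LINT t:J|lebesgue. \<theta> t * (of_real (sqrt (2 * pi)) *
          (C1 * fourier (u t) k + C2 * fourier (\<lambda>x. of_real ((cmod (u t x))\<^sup>2) * u t x) k)))"
    and "set_integrable lebesgue J (\<lambda>t. \<theta> t * (of_real (sqrt (2 * pi)) *
          (C1 * fourier (u t) k + C2 * fourier (\<lambda>x. of_real ((cmod (u t x))\<^sup>2) * u t x) k)))"
proof -
  let ?r = "of_real (sqrt (2 * pi)) :: complex"
  have Ib: "I \<in> sets borel" using I(1) by (simp add: compact_imp_closed)
  have w: "wiener (u t)" if "t \<in> I" for t using sq that by (intro wienerI)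
  define a where "a = (\<lambda>t k. fourier (u t) k)"
  define U where "U = (\<lambda>t. wsum (\<lambda>k. indicator I t *\<^sub>R a t k))"
  have Ueq: "U t = wsum (fourier (u t))" if "t \<in> I" for t using that by (simp add: U_def a_def)
  have asum: "(\<lambda>k. cmod (a t k)) summable_on UNIV" "(\<Sum>\<^sub>\<infinity>k. cmod (a t k)) \<le> 3 * R" if "t \<in> I" for t
    using h_bounded_abs_summable[OF sq(2)[OF that]] by (auto simp: a_def)
  have Um: "(\<lambda>(t, x). U t x) \<in> borel_measurable borel"
    unfolding U_def
  proof (rule wsum_spacetime_measurable)
    show "continuous_on I (\<lambda>t. a t k)" for k using cont by (simp add: a_def)
  qed (use Ib asum in auto)
  define B where "B = 3 * R / sqrt (2 * pi)"
  have UB: "cmod (U t x) \<le> B" if "t \<in> I" for t x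
  proof -
    have "cmod (U t x) \<le> (\<Sum>\<^sub>\<infinity>k. cmod (a t k)) / sqrt (2 * pi)"
      using wsum_bound[OF asum(1)[OF that]] by (simp add: Ueq[OF that] a_def)
    also have "\<dots> \<le> B" unfolding B_def using asum(2)[OF that] by (intro divide_right_mono) auto
    finally show ?thesis .
  qed
  have um': "u t \<in> borel_measurable torus_measure" "U t \<in> borel_measurable torus_measure"
    "AE x in torus_measure. u t x = U t x" if "t \<in> I" for t
    using wiener_measurable[OF w[OF that]] wsum_measurable[OF asum(1)[OF that]] wiener_eq_wsum[OF w[OF that]]
    by (auto simp: Ueq[OF that] a_def)
  define V where "V = (\<lambda>t x. of_real ((cmod (u t x))\<^sup>2) * u t x)"
  have VU: "(\<lambda>(t, x). of_real ((cmod (U t x))\<^sup>2) * U t x) \<in> borel_measurable borel"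
    using Um unfolding case_prod_beta' by measurable
  have Vm: "set_borel_measurable lebesgue (J \<times> {0..2 * pi}) (\<lambda>(t, x). V t x)"
  proof -
    define W where "W = (\<lambda>z. indicator (J \<times> {0..2 * pi}) z *\<^sub>R (case z of (t, x) \<Rightarrow> u t x))"
    have "W \<in> borel_measurable lebesgue" using um by (simp add: set_borel_measurable_def W_def)
    then have "(\<lambda>z. of_real ((cmod (W z))\<^sup>2) * W z) \<in> borel_measurable lebesgue" by measurable
    also have "(\<lambda>z. of_real ((cmod (W z))\<^sup>2) * W z) = (\<lambda>z. indicator (J \<times> {0..2 * pi}) z *\<^sub>R (case z of (t, x) \<Rightarrow> V t x))"
      by (auto simp: W_def V_def fun_eq_iff indicator_def)
    finally show ?thesis by (simp add: set_borel_measurable_def)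
  qed
  have VB: "cmod (of_real ((cmod (U t x))\<^sup>2) * U t x) \<le> B ^ 3" if "t \<in> I" for t x
  proof -
    have "cmod (of_real ((cmod (U t x))\<^sup>2) * U t x) = cmod (U t x) ^ 3"
      by (simp add: norm_mult norm_power power2_eq_square power3_eq_cube)
    then show ?thesis using UB[OF that, of x] by (simp add: power_mono)
  qed
  have Vt: "V t \<in> borel_measurable torus_measure \<and> (\<lambda>x. of_real ((cmod (U t x))\<^sup>2) * U t x) \<in> borel_measurable torus_measure \<and>
      (AE x in torus_measure. V t x = of_real ((cmod (U t x))\<^sup>2) * U t x)" if "t \<in> I" for t
  proof (intro conjI)
    show "V t \<in> borel_measurable torus_measure" unfolding V_def using um'(1)[OF that] by measurable
    show "(\<lambda>x. of_real ((cmod (U t x))\<^sup>2) * U t x) \<in> borel_measurable torus_measure" using um'(2)[OF that] by measurable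
    show "AE x in torus_measure. V t x = of_real ((cmod (U t x))\<^sup>2) * U t x"
      using um'(3)[OF that] by eventually_elim (simp add: V_def)
  qed
  define Q where "Q = (\<lambda>t x. C1 * u t x + C2 * V t x)"
  have QU: "(\<lambda>(t, x). C1 * U t x + C2 * (of_real ((cmod (U t x))\<^sup>2) * U t x)) \<in> borel_measurable borel"
    using Um unfolding case_prod_beta' by measurable
  have Qm: "set_borel_measurable lebesgue (J \<times> {0..2 * pi}) (\<lambda>(t, x). Q t x)"
  proof -
    have "(\<lambda>z. C1 * (indicator (J \<times> {0..2 * pi}) z *\<^sub>R (case z of (t, x) \<Rightarrow> u t x))
        + C2 * (indicator (J \<times> {0..2 * pi}) z *\<^sub>R (case z of (t, x) \<Rightarrow> V t x))) \<in> borel_measurable lebesgue"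
      using um Vm unfolding set_borel_measurable_def
      by (intro borel_measurable_add borel_measurable_times borel_measurable_const)
    then show ?thesis unfolding set_borel_measurable_def Q_def case_prod_beta' by (simp add: scaleR_add_right)
  qed
  have QB: "cmod (C1 * U t x + C2 * (of_real ((cmod (U t x))\<^sup>2) * U t x)) \<le> cmod C1 * B + cmod C2 * B ^ 3" if "t \<in> I" for t x
  proof (rule norm_triangle_le)
    show "cmod (C1 * U t x) + cmod (C2 * (of_real ((cmod (U t x))\<^sup>2) * U t x)) \<le> cmod C1 * B + cmod C2 * B ^ 3"
      unfolding norm_mult[of C1] norm_mult[of C2] using UB[OF that] VB[OF that] by (intro add_mono mult_left_mono) auto
  qed
  have Qt: "Q t \<in> borel_measurable torus_measure \<and> (\<lambda>x. C1 * U t x + C2 * (of_real ((cmod (U t x))\<^sup>2) * U t x)) \<in> borel_measurable torus_measure \<and>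
      (AE x in torus_measure. Q t x = C1 * U t x + C2 * (of_real ((cmod (U t x))\<^sup>2) * U t x))" if "t \<in> I" for t
  proof (intro conjI)
    show "Q t \<in> borel_measurable torus_measure" unfolding Q_def using um'(1)[OF that] Vt[OF that, THEN conjunct1] by measurable
    show "(\<lambda>x. C1 * U t x + C2 * (of_real ((cmod (U t x))\<^sup>2) * U t x)) \<in> borel_measurable torus_measure"
      using um'(2)[OF that] by measurable
    show "AE x in torus_measure. Q t x = C1 * U t x + C2 * (of_real ((cmod (U t x))\<^sup>2) * U t x)"
      using um'(3)[OF that] by eventually_elim (simp add: Q_def V_def)
  qed
  have Vint: "integrable torus_measure (V t)" if "t \<in> I" for t
    unfolding V_def using wiener_mult_integrable[OF w[OF that] fourier_abs_square(2)[OF w[OF that]]]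
    by (simp add: mult.commute)
  have Qf: "fourier (Q t) k = C1 * a t k + C2 * fourier (V t) k" if "t \<in> I" for t
    unfolding Q_def using Vint[OF that] square_integrable_integrable[OF sq(1)[OF that]]
    by (simp add: fourier_add fourier_cmult a_def)
  have eq: "\<theta> t * (?r * fourier (Q t) k) = \<theta> t * (?r * (C1 * fourier (u t) k + C2 * fourier (\<lambda>x. of_real ((cmod (u t x))\<^sup>2) * u t x) k))"
    if "t \<in> J" for t
    using Qf[of t] \<theta>(2)[of t] that by (cases "t \<in> I") (auto simp: a_def V_def)
  note SQ = spacetime_integral_fourier[OF Qm QU QB I(1,2) \<theta> Qt]
  have "(LINT t:J|lebesgue. \<theta> t * (?r * fourier (Q t) k)) = (LINT t:J|lebesgue. \<theta> t * (?r *
          (C1 * fourier (u t) k + C2 * fourier (\<lambda>x. of_real ((cmod (u t x))\<^sup>2) * u t x) k)))"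
    using I(3) eq by (intro set_lebesgue_integral_cong) auto
  with SQ(1) show "spacetime_integral J (\<lambda>t x. (C1 * u t x + C2 * (of_real ((cmod (u t x))\<^sup>2) * u t x)) * (\<theta> t * ek (- k) x))
      = (LINT t:J|lebesgue. \<theta> t * (?r *
          (C1 * fourier (u t) k + C2 * fourier (\<lambda>x. of_real ((cmod (u t x))\<^sup>2) * u t x) k)))"
    by (simp only: Q_def V_def)
  have "set_integrable lebesgue J (\<lambda>t. \<theta> t * (?r * fourier (Q t) k))" by (rule SQ(2))
  then show "set_integrable lebesgue J (\<lambda>t. \<theta> t * (?r *
          (C1 * fourier (u t) k + C2 * fourier (\<lambda>x. of_real ((cmod (u t x))\<^sup>2) * u t x) k)))"
    by (rule iffD1[OF set_integrable_cong[OF refl refl eq], rotated])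
qed

context raman
begin

text \<open>Space derivatives act on the test function as powers of -ik, so the linear terms give i
  \<open>om k\<close> and the cubic ones the coefficient C2. By \<open>nl_fourier\<close> the Raman
  term is \<open>nl\<close> minus C2 times the cubic coefficient; adding up leaves
  \<open>nl\<close>.\<close>

lemma weak_identity_fourier:
  assumes \<sigma>: "\<sigma> = 1 \<or> \<sigma> = - 1" and \<delta>: "0 < \<delta>" and c: "0 < c" "c < T"
    and um: "set_borel_measurable lebesgue (time_interval \<sigma> T \<times> {0..2 * pi}) (\<lambda>(t, x). u t x)"
    and id: "weak_identity \<alpha>\<^sub>1 \<alpha>\<^sub>2 \<gamma>\<^sub>1 \<gamma>\<^sub>2 \<Gamma> \<sigma> (time_interval \<sigma> T) u\<^sub>0 u (test_bump \<delta> c \<sigma> k)"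
    and sq: "\<And>t. t \<in> time_segment \<sigma> c \<Longrightarrow> square_integrable (u t) \<and> h_bounded 1 R (fourier (u t))"
    and cont: "\<And>k. continuous_on (time_segment \<sigma> c) (\<lambda>t. fourier (u t) k)"
  shows "of_real \<sigma> * integral {0..c} (\<lambda>s. of_real (bump \<delta> 1 (c - s)) * fourier (u (\<sigma> * s)) k)
      - of_real \<sigma> * (of_real (bump \<delta> 0 c) * fourier u\<^sub>0 k)
    = integral {0..c} (\<lambda>s. of_real (bump \<delta> 0 (c - s)) *
        (\<i> * of_real (om k) * fourier (u (\<sigma> * s)) k + nl (fourier (u (\<sigma> * s))) k))"
proof -
  define J where "J = time_interval \<sigma> T"
  define I where "I = time_segment \<sigma> c"
  let ?r = "of_real (sqrt (2 * pi)) :: complex"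
  define \<theta> where "\<theta> = (\<lambda>t. complex_of_real (bump \<delta> 0 (c - \<sigma> * t)))"
  define \<theta>1 where "\<theta>1 = (\<lambda>t. complex_of_real (- \<sigma> * bump \<delta> 1 (c - \<sigma> * t)))"
  define \<phi> where "\<phi> = test_bump \<delta> c \<sigma> k"
  have \<phi>: "\<phi> t x = \<theta> t * ek (- k) x" for t x by (simp add: \<phi>_def test_bump_def \<theta>_def)
  have I: "compact I" "I \<subseteq> J" "I \<in> sets borel" "J \<in> sets borel"
    using compact_time_segment[OF \<sigma>] time_segment_subset[OF \<sigma> c(2)] time_sets[OF \<sigma>] by (auto simp: I_def J_def)
  have \<theta>c: "continuous_on A \<theta>" "continuous_on A \<theta>1" for A
    unfolding \<theta>_def \<theta>1_def by (intro continuous_intros continuous_on_compose2[OF bump_continuous[OF \<delta>, of UNIV]], auto)+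
  have \<theta>z: "\<theta> t = 0" "\<theta>1 t = 0" if "t \<in> J - I" for t
    using that by (auto simp: \<theta>_def \<theta>1_def bump_def J_def I_def time_interval_def time_segment_def)
  have sq': "square_integrable (u t)" "h_bounded 1 R (fourier (u t))" "wiener (u t)" if "t \<in> I" for t
    using sq that wienerI by (auto simp: I_def)
  define a where "a = (\<lambda>t k. fourier (u t) k)"
  define V where "V = (\<lambda>t x. of_real ((cmod (u t x))\<^sup>2) * u t x)"
  define C1 C2 where "C1 = \<i> * of_real (om k)" and "C2 = \<i> * of_real \<gamma>\<^sub>1 + \<i> * of_real \<gamma>\<^sub>2 * of_int k"
  have lin: "spacetime_integral J (\<lambda>t x. (A1 * u t x + A2 * V t x) * (\<eta> t * ek (- k) x))
      = (LINT t:J|lebesgue. \<eta> t * (?r * (A1 * a t k + A2 * fourier (V t) k)))"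
    "set_integrable lebesgue J (\<lambda>t. \<eta> t * (?r * (A1 * a t k + A2 * fourier (V t) k)))"
    if "continuous_on UNIV \<eta>" "\<And>t. t \<in> J - I \<Longrightarrow> \<eta> t = 0" for A1 A2 \<eta>
    unfolding V_def a_def
    by (rule spacetime_integral_nonlinear[OF I(1,2,4) um[folded J_def] sq'(1,2) cont[folded I_def] that]; blast)+
  have a_cont: "continuous_on I (\<lambda>t. a t j)" for j using cont by (simp add: a_def I_def)
  have nl_cont: "continuous_on I (\<lambda>t. nl (a t) k)"
    using continuous_on_nl[of I R a, OF _ a_cont] sq'(2) by (auto simp: a_def)
  have S1: "spacetime_integral J (\<lambda>t x. u t x * dt J \<phi> t x) = ?r * (LINT t:J|lebesgue. \<theta>1 t * a t k)"
  proof -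
    have "spacetime_integral J (\<lambda>t x. u t x * dt J \<phi> t x) = spacetime_integral J (\<lambda>t x. u t x * (\<theta>1 t * ek (- k) x))"
      using dt_test_bump[OF \<sigma> \<delta>, of T _ c k] c
      by (intro spacetime_integral_cong I) (auto simp: \<phi>_def J_def \<theta>1_def)
    also have "\<dots> = (LINT t:J|lebesgue. ?r * (\<theta>1 t * a t k))"
      using lin(1)[OF \<theta>c(2) \<theta>z(2), of 1 0] by (simp add: mult.left_commute)
    finally show ?thesis by simp
  qed
  have S0: "torus_integral (\<lambda>x. u\<^sub>0 x * \<phi> 0 x) = ?r * (of_real (bump \<delta> 0 c) * fourier u\<^sub>0 k)"
  proof -
    have "torus_integral (\<lambda>x. u\<^sub>0 x * \<phi> 0 x) = (\<integral>x. \<theta> 0 * (ek (- k) x * u\<^sub>0 x) \<partial>torus_measure)"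
      unfolding torus_integral_eq by (simp add: \<phi> mult_ac)
    then show ?thesis by (simp add: fourier_eq \<theta>_def)
  qed
  have S2: "spacetime_integral J (\<lambda>t x.
         u t x * (- of_real \<alpha>\<^sub>1 * (dx ^^ 3) \<phi> t x + \<i> * of_real \<alpha>\<^sub>2 * (dx ^^ 2) \<phi> t x)
         + of_real ((cmod (u t x))\<^sup>2) * u t x * (\<i> * of_real \<gamma>\<^sub>1 * \<phi> t x - of_real \<gamma>\<^sub>2 * dx \<phi> t x))
     = (LINT t:J|lebesgue. \<theta> t * (?r * (C1 * a t k + C2 * fourier (V t) k)))"
  proof -
    have d: "dx \<phi> t x = (- \<i> * of_int k) * \<phi> t x" "(dx ^^ 2) \<phi> t x = (- \<i> * of_int k) ^ 2 * \<phi> t x"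
      "(dx ^^ 3) \<phi> t x = (- \<i> * of_int k) ^ 3 * \<phi> t x" for t x
      using dx_power_test_bump[OF \<sigma>, of 1 \<delta> c k] dx_power_test_bump[OF \<sigma>, of 2 \<delta> c k] dx_power_test_bump[OF \<sigma>, of 3 \<delta> c k]
      by (auto simp: \<phi>_def fun_eq_iff)
    have "(\<lambda>t x. u t x * (- of_real \<alpha>\<^sub>1 * (dx ^^ 3) \<phi> t x + \<i> * of_real \<alpha>\<^sub>2 * (dx ^^ 2) \<phi> t x)
         + of_real ((cmod (u t x))\<^sup>2) * u t x * (\<i> * of_real \<gamma>\<^sub>1 * \<phi> t x - of_real \<gamma>\<^sub>2 * dx \<phi> t x))
      = (\<lambda>t x. (C1 * u t x + C2 * V t x) * (\<theta> t * ek (- k) x))"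
    proof (intro ext)
      fix t x
      have i3: "(- \<i> * of_int k) ^ 3 = \<i> * of_int k ^ 3" "(- \<i> * of_int k) ^ 2 = - (of_int k ^ 2)"
        unfolding power_mult_distrib by (simp_all add: power2_eq_square power3_eq_cube)
      show "u t x * (- of_real \<alpha>\<^sub>1 * (dx ^^ 3) \<phi> t x + \<i> * of_real \<alpha>\<^sub>2 * (dx ^^ 2) \<phi> t x)
         + of_real ((cmod (u t x))\<^sup>2) * u t x * (\<i> * of_real \<gamma>\<^sub>1 * \<phi> t x - of_real \<gamma>\<^sub>2 * dx \<phi> t x)
         = (C1 * u t x + C2 * V t x) * (\<theta> t * ek (- k) x)"
        unfolding d i3 \<phi> V_def C1_def C2_def om_def by (simp add: algebra_simps)
    qed
    then show ?thesis using lin(1)[OF \<theta>c(1) \<theta>z(1), of C1 C2] by (simp only:)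
  qed
  \<comment> \<open>Expressing the pairing through \<open>nl\<close> also settles its integrability
    in time: \<open>nl\<close> is continuous in t, and the cubic coefficient is integrable by
    Fubini.\<close>
  have S3: "- \<i> * of_real \<Gamma> * pairing (dx_abs_sq (u t)) (\<lambda>x. u t x * \<phi> t x)
     = \<theta> t * (?r * (nl (a t) k - C2 * fourier (V t) k))" if "t \<in> J" for t
  proof (cases "t \<in> I")
    case True
    have "pairing (dx_abs_sq (u t)) (\<lambda>x. u t x * \<phi> t x) = \<theta> t * pairing (dx_abs_sq (u t)) (\<lambda>x. u t x * ek (- k) x)"
      unfolding \<phi> pairing_cmult[symmetric] by (simp add: mult.left_commute)
    moreover have n: "nl (a t) k = C2 * fourier (V t) k - \<i> * of_real \<Gamma> * pairing (dx_abs_sq (u t)) (\<lambda>x. u t x * ek (- k) x) / ?r"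
      unfolding a_def C2_def V_def using nl_fourier[OF sq'(1,2)[OF True], of k] by simp
    moreover have "?r * (nl (a t) k - C2 * fourier (V t) k) = - \<i> * of_real \<Gamma> * pairing (dx_abs_sq (u t)) (\<lambda>x. u t x * ek (- k) x)"
      unfolding n by simp
    ultimately show ?thesis by simp
  next
    case False
    then have "\<theta> t = 0" using \<theta>z that by simp
    moreover from this have "pairing (dx_abs_sq (u t)) (\<lambda>x. u t x * \<phi> t x) = 0"
      by (simp add: \<phi> pairing_def fourier_eq)
    ultimately show ?thesis by simp
  qed
  have nl_int: "set_integrable lebesgue J (\<lambda>t. \<theta> t * (?r * nl (a t) k))"
    unfolding J_def by (rule time_integral_eq(2)[OF \<sigma> c])
      (use \<theta>z in \<open>auto simp: I_def[symmetric] J_def[symmetric] intro!: continuous_intros \<theta>c nl_cont\<close>)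
  have V_int: "set_integrable lebesgue J (\<lambda>t. \<theta> t * (?r * fourier (V t) k))"
    using lin(2)[OF \<theta>c(1) \<theta>z(1), of 0 1] by simp
  have Q_int: "set_integrable lebesgue J (\<lambda>t. \<theta> t * (?r * (C1 * a t k + C2 * fourier (V t) k)))"
    by (rule lin(2)[OF \<theta>c(1) \<theta>z(1)])
  have nlV_int: "set_integrable lebesgue J (\<lambda>t. \<theta> t * (?r * (nl (a t) k - C2 * fourier (V t) k)))"
    using set_integral_diff(1)[OF nl_int set_integrable_mult_right[of C2, OF V_int]]
    by (simp add: right_diff_distrib mult.left_commute)
  have S3': "- \<i> * of_real \<Gamma> * (LINT t:J|lebesgue. pairing (dx_abs_sq (u t)) (\<lambda>x. u t x * \<phi> t x))
     = (LINT t:J|lebesgue. \<theta> t * (?r * (nl (a t) k - C2 * fourier (V t) k)))"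
    unfolding set_integral_mult_right[symmetric] using S3 I(4)
    by (intro set_lebesgue_integral_cong) auto
  have "- spacetime_integral J (\<lambda>t x. u t x * dt J \<phi> t x) - of_real \<sigma> * torus_integral (\<lambda>x. u\<^sub>0 x * \<phi> 0 x)
     = spacetime_integral J (\<lambda>t x.
         u t x * (- of_real \<alpha>\<^sub>1 * (dx ^^ 3) \<phi> t x + \<i> * of_real \<alpha>\<^sub>2 * (dx ^^ 2) \<phi> t x)
         + of_real ((cmod (u t x))\<^sup>2) * u t x * (\<i> * of_real \<gamma>\<^sub>1 * \<phi> t x - of_real \<gamma>\<^sub>2 * dx \<phi> t x))
       + - \<i> * of_real \<Gamma> * (LINT t:J|lebesgue. pairing (dx_abs_sq (u t)) (\<lambda>x. u t x * \<phi> t x))"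
    using id unfolding weak_identity_def J_def[symmetric] \<phi>_def[symmetric] by simp
  then have "- (?r * (LINT t:J|lebesgue. \<theta>1 t * a t k)) - of_real \<sigma> * (?r * (of_real (bump \<delta> 0 c) * fourier u\<^sub>0 k))
     = (LINT t:J|lebesgue. \<theta> t * (?r * (C1 * a t k + C2 * fourier (V t) k)))
      + (LINT t:J|lebesgue. \<theta> t * (?r * (nl (a t) k - C2 * fourier (V t) k)))"
    unfolding S1 S0 S2 S3' .
  also have "\<dots> = (LINT t:J|lebesgue. \<theta> t * (?r * (C1 * a t k + C2 * fourier (V t) k)) + \<theta> t * (?r * (nl (a t) k - C2 * fourier (V t) k)))"
    by (rule set_integral_add(2)[OF Q_int nlV_int, symmetric])
  also have "\<dots> = (LINT t:J|lebesgue. ?r * (\<theta> t * (C1 * a t k + nl (a t) k)))"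
    by (intro arg_cong[of _ _ "set_lebesgue_integral lebesgue J"]) (simp add: fun_eq_iff algebra_simps)
  also have "\<dots> = ?r * (LINT t:J|lebesgue. \<theta> t * (C1 * a t k + nl (a t) k))" by simp
  finally have "?r * (- (LINT t:J|lebesgue. \<theta>1 t * a t k) - of_real \<sigma> * (of_real (bump \<delta> 0 c) * fourier u\<^sub>0 k))
     = ?r * (LINT t:J|lebesgue. \<theta> t * (C1 * a t k + nl (a t) k))"
    by (simp only: right_diff_distrib mult_minus_right mult.left_commute)
  then have main: "- (LINT t:J|lebesgue. \<theta>1 t * a t k) - of_real \<sigma> * (of_real (bump \<delta> 0 c) * fourier u\<^sub>0 k)
     = (LINT t:J|lebesgue. \<theta> t * (C1 * a t k + nl (a t) k))"
    by (subst (asm) mult_cancel_left) simp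
  have "(LINT t:J|lebesgue. \<theta>1 t * a t k) = integral {0..c} (\<lambda>s. \<theta>1 (\<sigma> * s) * a (\<sigma> * s) k)"
    unfolding J_def by (rule time_integral_eq(1)[OF \<sigma> c])
      (use \<theta>z in \<open>auto simp: I_def[symmetric] J_def[symmetric] intro!: continuous_intros \<theta>c a_cont\<close>)
  moreover have "(LINT t:J|lebesgue. \<theta> t * (C1 * a t k + nl (a t) k))
      = integral {0..c} (\<lambda>s. \<theta> (\<sigma> * s) * (C1 * a (\<sigma> * s) k + nl (a (\<sigma> * s)) k))"
    unfolding J_def by (rule time_integral_eq(1)[OF \<sigma> c])
      (use \<theta>z in \<open>auto simp: I_def[symmetric] J_def[symmetric] intro!: continuous_intros \<theta>c a_cont nl_cont\<close>)
  moreover have \<sigma>\<sigma>: "\<sigma> * (\<sigma> * s) = s" for s using \<sigma> by auto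
  moreover have "- integral {0..c} (\<lambda>s. \<theta>1 (\<sigma> * s) * a (\<sigma> * s) k)
      = of_real \<sigma> * integral {0..c} (\<lambda>s. of_real (bump \<delta> 1 (c - s)) * fourier (u (\<sigma> * s)) k)"
    unfolding \<theta>1_def \<sigma>\<sigma> a_def integral_mult_right[symmetric] Henstock_Kurzweil_Integration.integral_neg[symmetric]
    by (intro Henstock_Kurzweil_Integration.integral_cong) simp
  ultimately show ?thesis using main unfolding C1_def \<theta>_def a_def \<sigma>\<sigma> by simp
qed

end

lemma time_scaling:
  assumes "\<sigma> = 1 \<or> \<sigma> = - 1"
  shows "(\<lambda>t. \<sigma> * t) ` time_segment \<sigma> c = {0..c}" "\<sigma> * (\<sigma> * t) = t"
    "s \<in> {0..c} \<Longrightarrow> \<sigma> * s \<in> time_segment \<sigma> c" "t \<in> time_segment \<sigma> c \<Longrightarrow> \<sigma> * t \<in> {0..c}"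
  using assms by (auto simp: time_segment_simps image_iff intro: bexI[of _ "- _"])

lemma has_vector_derivative_within_union:
  assumes "(f has_vector_derivative f') (at x within S)" "(f has_vector_derivative f') (at x within T)"
  shows "(f has_vector_derivative f') (at x within (S \<union> T))"
  using assms unfolding has_vector_derivative_def has_derivative_within by (simp add: Lim_within_Un)

text \<open>The within-filter is trivial off a closed set, so in \<open>fsol_union\<close> the rule
  for unions applies at every time, not just at 0.\<close>

lemma has_vector_derivative_within_closed:
  fixes f :: "real \<Rightarrow> 'a :: real_normed_vector"
  assumes "closed S" "x \<notin> S"
  shows "(f has_vector_derivative f') (at x within S)"
proof -
  have "\<not> x islimpt S" using assms closed_limpt by blast
  then have "at x within S = bot" by (simp add: trivial_limit_within)
  then show ?thesis unfolding has_vector_derivative_def has_derivative_within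
    by (simp add: bounded_linear_scaleR_left)
qed

context raman
begin

lemma fsol_union:
  assumes "fsol {- \<tau>..0} a" "fsol {0..\<tau>} a"
  shows "fsol {- \<tau>..\<tau>} a"
  unfolding fsol_def
proof (intro ballI allI)
  fix t k assume t: "t \<in> {- \<tau>..\<tau>}"
  have eq: "{- \<tau>..\<tau>} = {- \<tau>..0} \<union> {0..\<tau>}" using t by auto
  show "((\<lambda>t. a t k) has_vector_derivative \<i> * of_real (om k) * a t k + nl (a t) k) (at t within {- \<tau>..\<tau>})"
    unfolding eq
    by (rule has_vector_derivative_within_union)
      (use assms t in \<open>auto simp: fsol_def intro: has_vector_derivative_within_closed
        dest!: bspec[of _ _ t] cong: conj_cong\<close>)
qed

text \<open>Letting the cutoff parameter tend to 0 gives the integrated equation, which the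
  fundamental theorem of calculus differentiates. Although the weak identity sees u only up to null
  sets, continuity of the coefficients fixes their values, and c = 0 identifies u(0) with the
  datum.\<close>

lemma weak_solution_fsol:
  assumes \<sigma>: "\<sigma> = 1 \<or> \<sigma> = - 1" and \<tau>: "0 < \<tau>" "\<tau> \<le> T"
    and weak: "weak_solution \<alpha>\<^sub>1 \<alpha>\<^sub>2 \<gamma>\<^sub>1 \<gamma>\<^sub>2 \<Gamma> \<sigma> (time_interval \<sigma> T) s u\<^sub>0 u"
    and sq: "\<And>t. t \<in> time_segment \<sigma> \<tau> \<Longrightarrow> square_integrable (u t) \<and> h_bounded 1 R (fourier (u t))"
    and cont: "\<And>k. continuous_on (time_segment \<sigma> \<tau>) (\<lambda>t. fourier (u t) k)"
  shows "fsol (time_segment \<sigma> \<tau>) (\<lambda>t. fourier (u t))" and "fourier (u 0) k = fourier u\<^sub>0 k"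
proof -
  note sc = time_scaling[OF \<sigma>]
  define A where "A = (\<lambda>k s. fourier (u (\<sigma> * s)) k)"
  define g where "g = (\<lambda>k s. \<i> * of_real (om k) * A k s + nl (fourier (u (\<sigma> * s))) k)"
  have Ac: "continuous_on {0..\<tau>} (A k)" for k
    unfolding A_def by (rule continuous_on_compose2[OF cont]) (auto intro!: continuous_intros sc)
  have gc: "continuous_on {0..\<tau>} (g k)" for k
  proof -
    have "continuous_on (time_segment \<sigma> \<tau>) (\<lambda>t. nl (fourier (u t)) k)"
      by (rule continuous_on_nl[where R = R]) (use sq cont in auto)
    then have "continuous_on {0..\<tau>} (\<lambda>s. nl (fourier (u (\<sigma> * s))) k)"
      by (rule continuous_on_compose2) (auto intro!: continuous_intros sc)
    then show ?thesis unfolding g_def by (intro continuous_intros Ac)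
  qed
  have step: "of_real \<sigma> * A k c - of_real \<sigma> * fourier u\<^sub>0 k = integral {0..c} (g k)" if c: "0 < c" "c < \<tau>" for c k
  proof -
    have Ac': "continuous_on {0..c} (A k)" and gc': "continuous_on {0..c} (g k)"
      using c by (auto intro: continuous_on_subset[OF Ac] continuous_on_subset[OF gc])
    have "(\<lambda>n. of_real \<sigma> * integral {0..c} (\<lambda>s. of_real (bump (1 / real (Suc n)) 1 (c - s)) * A k s)
        - of_real \<sigma> * (of_real (bump (1 / real (Suc n)) 0 c) * fourier u\<^sub>0 k))
      \<longlonglongrightarrow> of_real \<sigma> * A k c - of_real \<sigma> * (of_real 1 * fourier u\<^sub>0 k)"
      by (intro tendsto_intros bump_approx_delta[OF c(1) Ac'] bump_limit c)
    moreover have "of_real \<sigma> * integral {0..c} (\<lambda>s. of_real (bump (1 / real (Suc n)) 1 (c - s)) * A k s)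
        - of_real \<sigma> * (of_real (bump (1 / real (Suc n)) 0 c) * fourier u\<^sub>0 k)
      = integral {0..c} (\<lambda>s. of_real (bump (1 / real (Suc n)) 0 (c - s)) * g k s)" for n
      unfolding A_def g_def
    proof (rule weak_identity_fourier[OF \<sigma> _ c(1), where T = T and R = R])
      show "c < T" using c \<tau> by simp
      have seg: "time_segment \<sigma> c \<subseteq> time_segment \<sigma> \<tau>" using c by (auto simp: time_segment_def)
      show "set_borel_measurable lebesgue (time_interval \<sigma> T \<times> {0..2 * pi}) (\<lambda>(t, x). u t x)"
        using weak by (simp add: weak_solution_def L3_loc_def)
      have "test_function (time_interval \<sigma> T) (test_bump (1 / real (Suc n)) c \<sigma> k)"
        using c \<tau> by (intro test_function_test_bump \<sigma>) auto
      then show "weak_identity \<alpha>\<^sub>1 \<alpha>\<^sub>2 \<gamma>\<^sub>1 \<gamma>\<^sub>2 \<Gamma> \<sigma> (time_interval \<sigma> T) u\<^sub>0 u (test_bump (1 / real (Suc n)) c \<sigma> k)"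
        using weak by (simp add: weak_solution_def)
      show "square_integrable (u t) \<and> h_bounded 1 R (fourier (u t))" if "t \<in> time_segment \<sigma> c" for t
        using sq that seg by blast
      show "continuous_on (time_segment \<sigma> c) (\<lambda>t. fourier (u t) k)" for k
        using cont seg by (rule continuous_on_subset)
    qed simp
    ultimately have "(\<lambda>n. integral {0..c} (\<lambda>s. of_real (bump (1 / real (Suc n)) 0 (c - s)) * g k s))
      \<longlonglongrightarrow> of_real \<sigma> * A k c - of_real \<sigma> * (of_real 1 * fourier u\<^sub>0 k)" by simp
    from LIMSEQ_unique[OF this bump_approx_integral[OF c(1) gc']] show ?thesis by simp
  qed
  \<comment> \<open>The test functions have to vanish before T, and \<tau> = T is possible; so both
    end points are added by continuity.\<close>
  have eqn: "A k c = fourier u\<^sub>0 k + of_real \<sigma> * integral {0..c} (g k)" if "c \<in> {0..\<tau>}" for c k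
  proof -
    have "continuous_on {0..\<tau>} (\<lambda>c. integral {0..c} (g k))"
      by (intro indefinite_integral_continuous_1 integrable_continuous_real gc)
    then have "continuous_on (closure {0<..<\<tau>}) (\<lambda>c. A k c - fourier u\<^sub>0 k - of_real \<sigma> * integral {0..c} (g k))"
      using \<tau> by (auto intro!: continuous_intros Ac)
    moreover have "A k c - fourier u\<^sub>0 k - of_real \<sigma> * integral {0..c} (g k) = 0" if "c \<in> {0<..<\<tau>}" for c
    proof -
      have "of_real \<sigma> * (of_real \<sigma> * A k c - of_real \<sigma> * fourier u\<^sub>0 k) = A k c - fourier u\<^sub>0 k"
        using \<sigma> by auto
      then show ?thesis using step[of c k] that by simp
    qed
    ultimately have "A k c - fourier u\<^sub>0 k - of_real \<sigma> * integral {0..c} (g k) = 0"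
      by (rule continuous_constant_on_closure) (use that \<tau> in auto)
    then show ?thesis by (simp add: algebra_simps)
  qed
  show "fourier (u 0) k = fourier u\<^sub>0 k" using eqn[of 0 k] \<tau> by (simp add: A_def)
  show "fsol (time_segment \<sigma> \<tau>) (\<lambda>t. fourier (u t))"
    unfolding fsol_def
  proof (intro ballI allI)
    fix t k assume t: "t \<in> time_segment \<sigma> \<tau>"
    then have t': "\<sigma> * t \<in> {0..\<tau>}" by (rule sc(4))
    have "((\<lambda>c. fourier u\<^sub>0 k + of_real \<sigma> * integral {0..c} (g k)) has_vector_derivative 0 + of_real \<sigma> * g k (\<sigma> * t)) (at (\<sigma> * t) within {0..\<tau>})"
      by (intro has_vector_derivative_add has_vector_derivative_const has_vector_derivative_mult_right
          integral_has_vector_derivative gc t')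
    then have "(A k has_vector_derivative of_real \<sigma> * g k (\<sigma> * t)) (at (\<sigma> * t) within {0..\<tau>})"
      using eqn t' by (intro has_vector_derivative_transform[of _ _ "A k"]) auto
    moreover have "((\<lambda>t. \<sigma> * t) has_vector_derivative \<sigma>) (at t within time_segment \<sigma> \<tau>)"
      by (auto intro!: derivative_eq_intros)
    ultimately have "(A k \<circ> (\<lambda>t. \<sigma> * t) has_vector_derivative \<sigma> *\<^sub>R (of_real \<sigma> * g k (\<sigma> * t))) (at t within time_segment \<sigma> \<tau>)"
      by (intro vector_diff_chain_within) (simp_all add: sc(1))
    moreover have "\<sigma> *\<^sub>R (of_real \<sigma> * g k (\<sigma> * t)) = g k (\<sigma> * t)" using \<sigma> by (auto simp: scaleR_conv_of_real)
    ultimately show "((\<lambda>t. fourier (u t) k) has_vector_derivative \<i> * of_real (om k) * fourier (u t) k + nl (fourier (u t)) k)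
       (at t within time_segment \<sigma> \<tau>)"
      by (simp add: A_def g_def o_def sc(2))
  qed
qed

end

section \<open>Norm inflation\<close>

lemma weighted_norm_h_bounded:
  assumes "weighted_norm s c \<le> ennreal R" "0 \<le> R"
  shows "h_bounded s R c"
proof -
  have br: "bracket (of_int k) = jp k" for k by (simp add: bracket_def jp_def)
  have sm: "(\<lambda>k. (jp k powr s * cmod (c k))\<^sup>2) summable_on UNIV"
    using assms by (auto simp: weighted_norm_def br top_unique split: if_splits)
  then have "ennreal (sqrt (\<Sum>\<^sub>\<infinity>k. (jp k powr s * cmod (c k))\<^sup>2)) \<le> ennreal R"
    using assms by (simp add: weighted_norm_def br)
  then have "sqrt (\<Sum>\<^sub>\<infinity>k. (jp k powr s * cmod (c k))\<^sup>2) \<le> R" using assms by (simp add: ennreal_le_iff)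
  then have le: "(\<Sum>\<^sub>\<infinity>k. (jp k powr s * cmod (c k))\<^sup>2) \<le> R\<^sup>2" by (rule sqrt_le_D)
  show ?thesis
    unfolding h_bounded_def l2_bounded_def
  proof (intro conjI allI impI)
    fix X :: "int set" assume "finite X"
    then have "(\<Sum>k\<in>X. (jp k powr s * cmod (c k))\<^sup>2) \<le> (\<Sum>\<^sub>\<infinity>k. (jp k powr s * cmod (c k))\<^sup>2)"
      by (intro finite_sum_le_infsum sm) auto
    with le show "(\<Sum>k\<in>X. (jp k powr s * cmod (c k))\<^sup>2) \<le> R\<^sup>2" by simp
  qed (use assms in auto)
qed

lemma sobolev_norm_h_bounded:
  assumes "sobolev_norm s f \<le> ennreal R" "0 \<le> R"
  shows "square_integrable f" "h_bounded s R (fourier f)"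
  using assms weighted_norm_h_bounded[of s "fourier f" R]
  by (auto simp: sobolev_norm_def top_unique split: if_splits)

lemma h_bounded_weighted_norm:
  assumes "h_bounded s R c"
  shows "weighted_norm s c \<le> ennreal R"
proof -
  have br: "bracket (of_int k) = jp k" for k by (simp add: bracket_def jp_def)
  note b = l2_bounded_summable[OF assms[unfolded h_bounded_def], of UNIV]
  have "sqrt (\<Sum>\<^sub>\<infinity>k. (jp k powr s * cmod (c k))\<^sup>2) \<le> R"
    using b(2) h_bounded_nonneg[OF assms] by (intro real_le_lsqrt) (auto intro: infsum_nonneg)
  then show ?thesis using b(1) by (simp add: weighted_norm_def br ennreal_leI)
qed

lemma h_bounded_add:
  assumes "h_bounded s R a" "h_bounded s R b"
  shows "h_bounded s (2 * R) (\<lambda>k. a k + b k)"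
  unfolding h_bounded_def l2_bounded_def
proof (intro conjI allI impI)
  fix X :: "int set" assume X: "finite X"
  have "(\<Sum>k\<in>X. (jp k powr s * cmod (a k + b k))\<^sup>2)
      \<le> (\<Sum>k\<in>X. 2 * (jp k powr s * cmod (a k))\<^sup>2 + 2 * (jp k powr s * cmod (b k))\<^sup>2)"
  proof (rule sum_mono)
    fix k
    have "jp k powr s * cmod (a k + b k) \<le> jp k powr s * cmod (a k) + jp k powr s * cmod (b k)"
      unfolding distrib_left[symmetric] by (intro mult_left_mono norm_triangle_ineq) auto
    then have "(jp k powr s * cmod (a k + b k))\<^sup>2 \<le> (jp k powr s * cmod (a k) + jp k powr s * cmod (b k))\<^sup>2"
      by (intro power_mono) auto
    also have "\<dots> \<le> 2 * (jp k powr s * cmod (a k))\<^sup>2 + 2 * (jp k powr s * cmod (b k))\<^sup>2"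
    proof -
      have "(x + y)\<^sup>2 \<le> 2 * x\<^sup>2 + 2 * y\<^sup>2" for x y :: real
        using zero_le_power2[of "x - y"] by (simp add: power2_sum power2_diff)
      then show ?thesis .
    qed
    finally show "(jp k powr s * cmod (a k + b k))\<^sup>2
      \<le> 2 * (jp k powr s * cmod (a k))\<^sup>2 + 2 * (jp k powr s * cmod (b k))\<^sup>2" .
  qed
  also have "\<dots> \<le> 2 * R\<^sup>2 + 2 * R\<^sup>2"
    using assms X unfolding sum.distrib sum_distrib_left[symmetric] h_bounded_def l2_bounded_def
    by (intro add_mono mult_left_mono) auto
  finally show "(\<Sum>k\<in>X. (jp k powr s * cmod (a k + b k))\<^sup>2) \<le> (2 * R)\<^sup>2"
    by (simp add: power_mult_distrib)
qed (use h_bounded_nonneg[OF assms(1)] in auto)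

text \<open>For s \<ge> 0 a single coefficient is bounded by the H^s norm, so continuity in norm
  passes to every coefficient.\<close>

lemma continuous_sobolev_fourier:
  assumes c: "continuous_sobolev I s u" and s: "0 \<le> s"
  shows "continuous_on I (\<lambda>t. fourier (u t) k)" "t \<in> I \<Longrightarrow> square_integrable (u t)"
proof -
  have sq: "square_integrable (u t)" if "t \<in> I" for t
    using c that by (auto simp: continuous_sobolev_def sobolev_def sobolev_norm_def split: if_splits)
  then show "t \<in> I \<Longrightarrow> square_integrable (u t)" .
  show "continuous_on I (\<lambda>t. fourier (u t) k)"
    unfolding continuous_on_def
  proof
    fix t0 assume t0: "t0 \<in> I"
    have le: "ennreal (cmod (fourier (u t) k - fourier (u t0) k)) \<le> sobolev_norm s (\<lambda>x. u t x - u t0 x)"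
      if t: "t \<in> I" for t
    proof (cases "sobolev_norm s (\<lambda>x. u t x - u t0 x) = \<infinity>")
      case False
      define R where "R = enn2real (sobolev_norm s (\<lambda>x. u t x - u t0 x))"
      have R: "sobolev_norm s (\<lambda>x. u t x - u t0 x) = ennreal R" "0 \<le> R"
        using False by (auto simp: R_def ennreal_enn2real_if)
      have "cmod (fourier (\<lambda>x. u t x - u t0 x) k) \<le> R"
        by (rule h_bounded_coeff[OF sobolev_norm_h_bounded(2) s]) (use R in auto)
      also have "fourier (\<lambda>x. u t x - u t0 x) k = fourier (u t) k - fourier (u t0) k"
        using sq t t0 by (intro fourier_diff square_integrable_integrable) auto
      finally show ?thesis using R by (simp add: ennreal_leI)
    qed simp
    have "((\<lambda>t. sobolev_norm s (\<lambda>x. u t x - u t0 x)) \<longlongrightarrow> 0) (at t0 within I)"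
      using c t0 by (simp add: continuous_sobolev_def)
    then have "((\<lambda>t. ennreal (cmod (fourier (u t) k - fourier (u t0) k))) \<longlongrightarrow> 0) (at t0 within I)"
    proof (rule tendsto_sandwich[rotated 3])
      show "\<forall>\<^sub>F t in at t0 within I. ennreal (cmod (fourier (u t) k - fourier (u t0) k)) \<le> sobolev_norm s (\<lambda>x. u t x - u t0 x)"
        using le by (auto simp: eventually_at_filter)
    qed auto
    then have "((\<lambda>t. cmod (fourier (u t) k - fourier (u t0) k)) \<longlongrightarrow> 0) (at t0 within I)"
      by (simp add: tendsto_ennreal_iff flip: ennreal_0)
    then have "((\<lambda>t. fourier (u t) k - fourier (u t0) k) \<longlongrightarrow> 0) (at t0 within I)"
      by (rule tendsto_norm_zero_cancel)
    then show "((\<lambda>t. fourier (u t) k) \<longlongrightarrow> fourier (u t0) k) (at t0 within I)"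
      by (rule LIM_zero_cancel)
  qed
qed

text \<open>The constant keeps the mass away from \<open>0\<close> even if the unperturbed data vanish; the mode \<open>N\<close> violates
  the decay that bounded solutions must have.\<close>

definition pert :: "real \<Rightarrow> real \<Rightarrow> int \<Rightarrow> real \<Rightarrow> complex" where
  "pert \<epsilon> s N x = of_real (\<epsilon> / 4) * (1 + of_real (jp N powr (- s)) * ek N x)"

lemma continuous_pert: "continuous_on A (pert \<epsilon> s N)"
  unfolding pert_def by (intro continuous_intros continuous_ek)

lemma pert_square_integrable: "square_integrable (pert \<epsilon> s N)"
  unfolding square_integrable_def
proof
  show "set_borel_measurable lebesgue {0..2 * pi} (pert \<epsilon> s N)"
    unfolding set_borel_measurable_torus_iff by (rule continuous_measurable_torus[OF continuous_pert])
  show "set_integrable lebesgue {0..2 * pi} (\<lambda>x. (cmod (pert \<epsilon> s N x))\<^sup>2)"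
    by (intro absolutely_integrable_continuous_real continuous_intros continuous_pert)
qed

lemma fourier_pert:
  assumes "N \<noteq> 0"
  shows "fourier (pert \<epsilon> s N) k = (if k = 0 then of_real (\<epsilon> / 4 * sqrt (2 * pi))
    else if k = N then of_real (\<epsilon> / 4 * sqrt (2 * pi) * jp N powr (- s)) else 0)"
proof -
  interpret finite_measure torus_measure by (rule finite_measure_torus)
  have i: "integrable torus_measure (ek j)" for j
    using integrable_ek_mult[of "\<lambda>_. 1" j] by simp
  have "pert \<epsilon> s N = (\<lambda>x. of_real (\<epsilon> / 4) * (ek 0 x + of_real (jp N powr (- s)) * ek N x))"
    by (simp add: pert_def fun_eq_iff)
  then have "fourier (pert \<epsilon> s N) k = of_real (\<epsilon> / 4) * (fourier (ek 0) k + of_real (jp N powr (- s)) * fourier (ek N) k)"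
    by (simp only: fourier_cmult) (subst fourier_add, use i in \<open>auto simp: fourier_cmult\<close>)
  then show ?thesis unfolding fourier_ek using assms by auto
qed

lemma norm_fourier_pert:
  assumes N: "N \<noteq> 0" and \<epsilon>: "0 \<le> \<epsilon>"
  shows "cmod (fourier (pert \<epsilon> s N) 0) = \<epsilon> / 4 * sqrt (2 * pi)"
    "cmod (fourier (pert \<epsilon> s N) N) = \<epsilon> / 4 * sqrt (2 * pi) * jp N powr (- s)"
proof -
  have "fourier (pert \<epsilon> s N) 0 = of_real (\<epsilon> / 4 * sqrt (2 * pi))"
    "fourier (pert \<epsilon> s N) N = of_real (\<epsilon> / 4 * sqrt (2 * pi) * jp N powr (- s))"
    using fourier_pert[OF N, of \<epsilon> s] N by presburger+
  then show "cmod (fourier (pert \<epsilon> s N) 0) = \<epsilon> / 4 * sqrt (2 * pi)"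
    "cmod (fourier (pert \<epsilon> s N) N) = \<epsilon> / 4 * sqrt (2 * pi) * jp N powr (- s)"
    using \<epsilon> by (simp_all only: norm_of_real) (auto simp: abs_mult)
qed

lemma pert_h_bounded:
  assumes N: "N \<noteq> 0" and \<epsilon>: "0 \<le> \<epsilon>"
  shows "h_bounded s \<epsilon> (fourier (pert \<epsilon> s N))"
  unfolding h_bounded_def l2_bounded_def
proof (intro conjI allI impI)
  fix X :: "int set" assume X: "finite X"
  define f where "f = (\<lambda>k. (jp k powr s * cmod (fourier (pert \<epsilon> s N) k))\<^sup>2)"
  have "sum f X = sum f (X \<inter> {0, N})"
    using X by (intro sum.mono_neutral_right) (auto simp: f_def fourier_pert[OF N])
  also have "\<dots> \<le> sum f {0, N}" by (intro sum_mono2) (auto simp: f_def)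
  also have "\<dots> = f 0 + f N" using N by simp
  \<comment> \<open>Each of the two modes contributes \<epsilon>^2 (1/4)^2 * 2 pi = \<epsilon>^2
    pi/8. The sum is below \<epsilon>^2 because pi < 4; this is the origin of \<epsilon>/4 in
    \<open>pert\<close>.\<close>
  also have "f 0 = \<epsilon>\<^sup>2 * (pi / 8)"
    unfolding f_def norm_fourier_pert[OF assms] by (simp add: jp_def power_mult_distrib power_divide)
  also have "f N = \<epsilon>\<^sup>2 * (pi / 8)"
  proof -
    have "jp N powr s * cmod (fourier (pert \<epsilon> s N) N) = \<epsilon> / 4 * sqrt (2 * pi)"
      unfolding norm_fourier_pert[OF assms] by (simp add: powr_minus field_simps)
    then have "f N = (\<epsilon> / 4 * sqrt (2 * pi))\<^sup>2" unfolding f_def by (rule arg_cong)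
    then show ?thesis by (simp add: power_mult_distrib power_divide)
  qed
  also have "\<epsilon>\<^sup>2 * (pi / 8) + \<epsilon>\<^sup>2 * (pi / 8) = \<epsilon>\<^sup>2 * (pi / 4)" by (simp add: field_simps)
  also have "\<dots> \<le> \<epsilon>\<^sup>2 * 1" using pi_less_4 by (intro mult_left_mono) auto
  finally show "(\<Sum>k\<in>X. (jp k powr s * cmod (fourier (pert \<epsilon> s N) k))\<^sup>2) \<le> \<epsilon>\<^sup>2" by (simp add: f_def)
qed (use \<epsilon> in auto)

lemma pert_sobolev_norm: "N \<noteq> 0 \<Longrightarrow> 0 \<le> \<epsilon> \<Longrightarrow> sobolev_norm s (pert \<epsilon> s N) \<le> ennreal \<epsilon>"
  using h_bounded_weighted_norm[OF pert_h_bounded] by (simp add: sobolev_norm_def pert_square_integrable)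

lemma pert_analytic: "real_analytic_torus (pert \<epsilon> s N)"
  unfolding real_analytic_torus_def
proof (intro conjI allI)
  show "periodic (pert \<epsilon> s N)" by (simp add: periodic_def pert_def ek_periodic)
  fix x0
  \<comment> \<open>Taylor coefficients at x0 of an entire function, so any radius can be chosen
    below.\<close>
  define a where "a = (\<lambda>n. of_real (\<epsilon> / 4) * ((if n = 0 then 1 else 0)
    + of_real (jp N powr (- s)) * (ek N x0 * ((\<i> * of_int N) ^ n / fact n))))"
  show "\<exists>a r. 0 < r \<and> (\<forall>x. \<bar>x - x0\<bar> < r \<longrightarrow> (\<lambda>n. a n * of_real ((x - x0) ^ n)) sums pert \<epsilon> s N x)"
  proof (intro exI[of _ a] exI[of _ 1] conjI allI impI)
    fix x
    have e: "ek N x = ek N x0 * exp (\<i> * of_int N * of_real (x - x0))"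
      by (simp add: ek_def exp_add[symmetric] right_diff_distrib)
    have "(\<lambda>n. ek N x0 * ((\<i> * of_int N * of_real (x - x0)) ^ n /\<^sub>R fact n)) sums ek N x"
      unfolding e by (intro sums_mult exp_converges)
    then have "(\<lambda>n. of_real (\<epsilon> / 4) * ((if n = 0 then 1 else 0) + of_real (jp N powr (- s)) *
        (ek N x0 * ((\<i> * of_int N * of_real (x - x0)) ^ n /\<^sub>R fact n)))) sums pert \<epsilon> s N x"
      unfolding pert_def by (intro sums_mult sums_add sums_single[of 0 "\<lambda>_. 1"])
    moreover have "of_real (\<epsilon> / 4) * ((if n = 0 then 1 else 0) + of_real (jp N powr (- s)) *
        (ek N x0 * ((\<i> * of_int N * of_real (x - x0)) ^ n /\<^sub>R fact n))) = a n * of_real ((x - x0) ^ n)" for n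
    proof -
      define y where "y = x - x0"
      define z where "z = \<i> * of_int N"
      have "(z * of_real y) ^ n /\<^sub>R fact n = z ^ n / fact n * of_real (y ^ n)"
        by (simp add: power_mult_distrib scaleR_conv_of_real divide_inverse mult.assoc mult.commute)
      then show ?thesis
        unfolding a_def y_def[symmetric] z_def[symmetric] by (simp only: distrib_left distrib_right mult.assoc) simp
    qed
    ultimately show "(\<lambda>n. a n * of_real ((x - x0) ^ n)) sums pert \<epsilon> s N x" by simp
  qed simp
qed

lemma jp_powr_unbounded:
  assumes "0 < d"
  shows "\<exists>N\<ge>1. C < jp N powr d"
proof -
  define N where "N = max 1 \<lceil>(\<bar>C\<bar> + 1) powr (1 / d)\<rceil>"
  have "(\<bar>C\<bar> + 1) powr (1 / d) \<le> of_int N" unfolding N_def by linarith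
  also have "\<dots> \<le> jp N" by (simp add: jp_def)
  finally have "((\<bar>C\<bar> + 1) powr (1 / d)) powr d \<le> jp N powr d"
    using assms by (intro powr_mono2) auto
  then have "C < jp N powr d" using assms by (simp add: powr_powr)
  moreover have "1 \<le> N" by (simp add: N_def)
  ultimately show ?thesis by blast
qed

text \<open>From |b|^2 \<le> 2 |a|^2 + 2 |d|^2. The threshold \<epsilon>^2/4 is the one that can
  also be met when the unperturbed data vanish.\<close>

lemma mass_add_lower:
  assumes a: "\<And>k. a k = b k + d k" and b: "h_bounded s R b" and d: "h_bounded s \<epsilon> d" and s: "0 \<le> s"
    and mb: "4 * \<epsilon>\<^sup>2 \<le> mass b"
  shows "\<epsilon>\<^sup>2 / 4 \<le> mass a"
proof -
  define R' where "R' = max R \<epsilon>"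
  have b': "h_bounded s R' b" "h_bounded s R' d"
    using b d l2_bounded_mono_const unfolding h_bounded_def R'_def by (meson max.cobounded1 max.cobounded2)+
  have ha: "h_bounded s (2 * R') a"
  proof -
    have "a = (\<lambda>k. b k + d k)" by (rule ext) (rule a)
    then show ?thesis using h_bounded_add[OF b'] by (simp only:)
  qed
  note sb = h_bounded_mass[OF b s, of UNIV] and sd = h_bounded_mass[OF d s, of UNIV] and sa = h_bounded_mass[OF ha s, of UNIV]
  have "mass b \<le> (\<Sum>\<^sub>\<infinity>k. 2 * (cmod (a k))\<^sup>2 + 2 * (cmod (d k))\<^sup>2)"
    unfolding mass_def
  proof (rule infsum_mono[OF sb(1)])
    show "(\<lambda>k. 2 * (cmod (a k))\<^sup>2 + 2 * (cmod (d k))\<^sup>2) summable_on UNIV"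
      by (intro summable_on_add summable_on_cmult_right sa sd)
    fix k
    have "cmod (b k) \<le> cmod (a k) + cmod (d k)" using norm_triangle_ineq4[of "a k" "d k"] a[of k] by simp
    then have "(cmod (b k))\<^sup>2 \<le> (cmod (a k) + cmod (d k))\<^sup>2" by (intro power_mono) auto
    also have "\<dots> \<le> 2 * (cmod (a k))\<^sup>2 + 2 * (cmod (d k))\<^sup>2"
      using zero_le_power2[of "cmod (a k) - cmod (d k)"] by (simp add: power2_sum power2_diff)
    finally show "(cmod (b k))\<^sup>2 \<le> 2 * (cmod (a k))\<^sup>2 + 2 * (cmod (d k))\<^sup>2" .
  qed
  also have "\<dots> = 2 * mass a + 2 * (\<Sum>\<^sub>\<infinity>k. (cmod (d k))\<^sup>2)"
    unfolding mass_def infsum_cmult_right'[symmetric]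
    by (intro infsum_add summable_on_cmult_right sa sd)
  also have "\<dots> \<le> 2 * mass a + 2 * \<epsilon>\<^sup>2" using sd(2) by simp
  finally show ?thesis using mb zero_le_power2[of \<epsilon>] by linarith
qed

context raman
begin

section \<open>Decay against the planted mode\<close>

text \<open>On a shorter interval the mass stays above \<epsilon>^2/16 by
  \<open>mass_persists\<close>, so \<open>decay_forward\<close> applies. N is so large that decay of
  order \<open>s\<^sub>1\<close> + 1 beats (\<epsilon>/8) N^(-s), and it is fixed before the
  solution.\<close>

lemma inflation_forward:
  assumes s: "1 \<le> s\<^sub>1" "s < s\<^sub>1 + 1" and \<epsilon>: "0 < \<epsilon>" and \<tau>: "0 < \<tau>"
  shows "\<exists>N\<ge>1. \<forall>a. fsol {0..\<tau>} a \<longrightarrow> (\<forall>t\<in>{0..\<tau>}. h_bounded s\<^sub>1 (2 / \<epsilon>) (a t)) \<longrightarrow>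
    \<epsilon>\<^sup>2 / 4 \<le> mass (a 0) \<longrightarrow> cmod (a 0 N) < \<epsilon> / 8 * jp N powr (- s)"
proof -
  obtain \<theta> where \<theta>: "0 < \<theta>" and mp: "\<And>a T t. fsol {0..T} a \<Longrightarrow> \<forall>t\<in>{0..T}. h_bounded 1 (2 / \<epsilon>) (a t) \<Longrightarrow>
      \<epsilon>\<^sup>2 / 4 \<le> mass (a 0) \<Longrightarrow> t \<in> {0..T} \<Longrightarrow> t \<le> \<theta> \<Longrightarrow> \<epsilon>\<^sup>2 / 4 / 4 \<le> mass (a t)"
    using mass_persists[of "\<epsilon>\<^sup>2 / 4" "2 / \<epsilon>"] \<epsilon> by auto
  define \<tau>' where "\<tau>' = min \<tau> \<theta>"
  have \<tau>': "0 < \<tau>'" "\<tau>' \<le> \<tau>" "\<tau>' \<le> \<theta>" using \<tau> \<theta> by (auto simp: \<tau>'_def)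
  have "0 < \<epsilon>\<^sup>2 / 4 / 4" "0 \<le> 2 / \<epsilon>" using \<epsilon> by auto
  from decay_forward[OF s(1) this(1) \<tau>'(1) this(2)] obtain C where C: "0 \<le> C" and dec:
    "\<forall>a. fsol {0..\<tau>'} a \<longrightarrow> (\<forall>t\<in>{0..\<tau>'}. h_bounded s\<^sub>1 (2 / \<epsilon>) (a t) \<and> \<epsilon>\<^sup>2 / 4 / 4 \<le> mass (a t)) \<longrightarrow>
    (\<forall>k\<ge>1. jp k powr (s\<^sub>1 + 1) * cmod (a 0 k) \<le> C)" by (elim exE conjE)
  obtain N where N: "1 \<le> N" "C / (\<epsilon> / 8) < jp N powr (s\<^sub>1 + 1 - s)"
    using jp_powr_unbounded[of "s\<^sub>1 + 1 - s" "C / (\<epsilon> / 8)"] s by auto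
  have "cmod (a 0 N) < \<epsilon> / 8 * jp N powr (- s)"
    if sol: "fsol {0..\<tau>} a" and b: "\<forall>t\<in>{0..\<tau>}. h_bounded s\<^sub>1 (2 / \<epsilon>) (a t)" and m: "\<epsilon>\<^sup>2 / 4 \<le> mass (a 0)" for a
  proof -
    have b1: "\<forall>t\<in>{0..\<tau>}. h_bounded 1 (2 / \<epsilon>) (a t)" using b h_bounded_mono s(1) by blast
    have "jp N powr (s\<^sub>1 + 1) * cmod (a 0 N) \<le> C"
    proof (rule dec[rule_format, OF _ _ N(1)])
      show "fsol {0..\<tau>'} a" using sol \<tau>' by (intro fsol_subset[OF sol]) auto
      show "h_bounded s\<^sub>1 (2 / \<epsilon>) (a t) \<and> \<epsilon>\<^sup>2 / 4 / 4 \<le> mass (a t)" if "t \<in> {0..\<tau>'}" for t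
        using b that \<tau>' mp[OF sol b1 m, of t] by auto
    qed
    also have "C < \<epsilon> / 8 * jp N powr (s\<^sub>1 + 1 - s)" using N \<epsilon> by (simp add: field_simps)
    also have "\<dots> = jp N powr (s\<^sub>1 + 1) * (\<epsilon> / 8 * jp N powr (- s))" by (simp add: powr_diff powr_minus field_simps)
    finally show ?thesis by (subst (asm) mult_less_cancel_left_pos) auto
  qed
  with N(1) show ?thesis by blast
qed

text \<open>Backwards in time the negative modes grow, so there the planted mode is -N, obtained
  through the reflection.\<close>

lemma inflation_one_sided:
  assumes \<sigma>: "\<sigma> = 1 \<or> \<sigma> = - 1" and s: "1 \<le> s\<^sub>1" "s < s\<^sub>1 + 1" and \<epsilon>: "0 < \<epsilon>" and \<tau>: "0 < \<tau>"
  shows "\<exists>N. N \<noteq> 0 \<and> (\<forall>a. fsol (time_segment \<sigma> \<tau>) a \<longrightarrow> (\<forall>t\<in>time_segment \<sigma> \<tau>. h_bounded s\<^sub>1 (2 / \<epsilon>) (a t)) \<longrightarrow>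
    \<epsilon>\<^sup>2 / 4 \<le> mass (a 0) \<longrightarrow> cmod (a 0 N) < \<epsilon> / 8 * jp N powr (- s))"
  using \<sigma>
proof
  assume "\<sigma> = 1"
  moreover from inflation_forward[OF s \<epsilon> \<tau>] obtain N where "1 \<le> N" "\<forall>a. fsol {0..\<tau>} a \<longrightarrow> (\<forall>t\<in>{0..\<tau>}. h_bounded s\<^sub>1 (2 / \<epsilon>) (a t)) \<longrightarrow>
    \<epsilon>\<^sup>2 / 4 \<le> mass (a 0) \<longrightarrow> cmod (a 0 N) < \<epsilon> / 8 * jp N powr (- s)" by (elim exE conjE)
  ultimately show ?thesis by (intro exI[of _ N]) (simp add: time_segment_simps)
next
  assume \<sigma>1: "\<sigma> = - 1"
  have par: "raman \<alpha>\<^sub>1 \<alpha>\<^sub>2 \<Gamma>" by unfold_locales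
  interpret B: raman \<alpha>\<^sub>1 "- \<alpha>\<^sub>2" "- \<gamma>\<^sub>1" \<gamma>\<^sub>2 \<Gamma> by (rule raman_reflect[OF par])
  from B.inflation_forward[OF s \<epsilon> \<tau>] obtain N where N: "1 \<le> N" and *: "\<forall>a. B.fsol {0..\<tau>} a \<longrightarrow> (\<forall>t\<in>{0..\<tau>}. h_bounded s\<^sub>1 (2 / \<epsilon>) (a t)) \<longrightarrow>
    \<epsilon>\<^sup>2 / 4 \<le> mass (a 0) \<longrightarrow> cmod (a 0 N) < \<epsilon> / 8 * jp N powr (- s)" by (elim exE conjE)
  have "cmod (a 0 (- N)) < \<epsilon> / 8 * jp (- N) powr (- s)"
    if sol: "fsol {- \<tau>..0} a" and b: "\<forall>t\<in>{- \<tau>..0}. h_bounded s\<^sub>1 (2 / \<epsilon>) (a t)" and m: "\<epsilon>\<^sup>2 / 4 \<le> mass (a 0)" for a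
  proof -
    have "B.fsol {0..\<tau>} (\<lambda>t k. a (- t) (- k))" using fsol_reflect[OF par sol] by simp
    moreover have "\<forall>t\<in>{0..\<tau>}. h_bounded s\<^sub>1 (2 / \<epsilon>) (\<lambda>k. a (- t) (- k))"
      using b by (auto intro: h_bounded_reflect)
    moreover have "\<epsilon>\<^sup>2 / 4 \<le> mass (\<lambda>k. a (- 0) (- k))" using m by (simp add: mass_reflect)
    ultimately have "cmod (a (- 0) (- N)) < \<epsilon> / 8 * jp N powr (- s)" using * by blast
    then show ?thesis by simp
  qed
  then show ?thesis using N \<sigma>1 by (intro exI[of _ "- N"]) (simp add: time_segment_simps)
qed

text \<open>Existence on both sides of 0 permits smoothing of any order, so every s is admissible
  for solutions bounded in H^1. The mass is kept from below in each direction separately, backwards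
  by reflection.\<close>

lemma inflation_two_sided:
  assumes \<epsilon>: "0 < \<epsilon>" and \<tau>: "0 < \<tau>"
  shows "\<exists>N. N \<noteq> 0 \<and> (\<forall>a. fsol {- \<tau>..\<tau>} a \<longrightarrow> (\<forall>t\<in>{- \<tau>..\<tau>}. h_bounded 1 (2 / \<epsilon>) (a t)) \<longrightarrow>
    \<epsilon>\<^sup>2 / 4 \<le> mass (a 0) \<longrightarrow> cmod (a 0 N) < \<epsilon> / 8 * jp N powr (- s))"
proof -
  have par: "raman \<alpha>\<^sub>1 \<alpha>\<^sub>2 \<Gamma>" by unfold_locales
  interpret B: raman \<alpha>\<^sub>1 "- \<alpha>\<^sub>2" "- \<gamma>\<^sub>1" \<gamma>\<^sub>2 \<Gamma> by (rule raman_reflect[OF par])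
  obtain \<theta>1 where \<theta>1: "0 < \<theta>1" and mp1: "\<And>a T t. fsol {0..T} a \<Longrightarrow> \<forall>t\<in>{0..T}. h_bounded 1 (2 / \<epsilon>) (a t) \<Longrightarrow>
      \<epsilon>\<^sup>2 / 4 \<le> mass (a 0) \<Longrightarrow> t \<in> {0..T} \<Longrightarrow> t \<le> \<theta>1 \<Longrightarrow> \<epsilon>\<^sup>2 / 4 / 4 \<le> mass (a t)"
    using mass_persists[of "\<epsilon>\<^sup>2 / 4" "2 / \<epsilon>"] \<epsilon> by auto
  obtain \<theta>2 where \<theta>2: "0 < \<theta>2" and mp2: "\<And>a T t. B.fsol {0..T} a \<Longrightarrow> \<forall>t\<in>{0..T}. h_bounded 1 (2 / \<epsilon>) (a t) \<Longrightarrow>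
      \<epsilon>\<^sup>2 / 4 \<le> mass (a 0) \<Longrightarrow> t \<in> {0..T} \<Longrightarrow> t \<le> \<theta>2 \<Longrightarrow> \<epsilon>\<^sup>2 / 4 / 4 \<le> mass (a t)"
    using B.mass_persists[of "\<epsilon>\<^sup>2 / 4" "2 / \<epsilon>"] \<epsilon> by auto
  define \<tau>' where "\<tau>' = min \<tau> (min \<theta>1 \<theta>2)"
  have \<tau>': "0 < \<tau>'" "\<tau>' \<le> \<tau>" "\<tau>' \<le> \<theta>1" "\<tau>' \<le> \<theta>2" using \<tau> \<theta>1 \<theta>2 by (auto simp: \<tau>'_def)
  \<comment> \<open>Enough gains of 1/4 to reach H^(s+1), one derivative above the weight of the
    planted mode.\<close>
  define n where "n = nat \<lceil>4 * \<bar>s\<bar>\<rceil>"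
  have n: "s + 1 \<le> 1 + real n / 4" unfolding n_def by linarith
  have "0 < \<epsilon>\<^sup>2 / 4 / 4" "0 \<le> 2 / \<epsilon>" using \<epsilon> by auto
  from smoothing[OF this(1) \<tau>'(1) this(2), of n] obtain R where R: "0 \<le> R" and sm:
    "\<forall>a. fsol {- \<tau>'..\<tau>'} a \<longrightarrow> (\<forall>t\<in>{- \<tau>'..\<tau>'}. h_bounded 1 (2 / \<epsilon>) (a t) \<and> \<epsilon>\<^sup>2 / 4 / 4 \<le> mass (a t)) \<longrightarrow>
    (\<forall>t\<in>{- (\<tau>' / 2 ^ n)..\<tau>' / 2 ^ n}. h_bounded (1 + real n / 4) R (a t))" by (elim exE conjE)
  obtain N where N: "1 \<le> N" "R / (\<epsilon> / 8) < jp N powr 1"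
    using jp_powr_unbounded[of 1 "R / (\<epsilon> / 8)"] by auto
  have "cmod (a 0 N) < \<epsilon> / 8 * jp N powr (- s)"
    if sol: "fsol {- \<tau>..\<tau>} a" and b: "\<forall>t\<in>{- \<tau>..\<tau>}. h_bounded 1 (2 / \<epsilon>) (a t)" and m: "\<epsilon>\<^sup>2 / 4 \<le> mass (a 0)" for a
  proof -
    have m1: "\<epsilon>\<^sup>2 / 4 / 4 \<le> mass (a t)" if "t \<in> {- \<tau>'..\<tau>'}" for t
    proof (cases "0 \<le> t")
      case True
      have "fsol {0..\<tau>} a" by (rule fsol_subset[OF sol]) (use \<tau> in auto)
      then show ?thesis using mp1[of \<tau> a t] b m that True \<tau>' by auto
    next
      case False
      have "fsol {- \<tau>..0} a" by (rule fsol_subset[OF sol]) (use \<tau> in auto)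
      then have "B.fsol {0..\<tau>} (\<lambda>t k. a (- t) (- k))" using fsol_reflect[OF par, of _ _ "{- \<tau>..0}" a] by simp
      moreover have "\<forall>t\<in>{0..\<tau>}. h_bounded 1 (2 / \<epsilon>) (\<lambda>k. a (- t) (- k))"
        using b by (auto intro: h_bounded_reflect)
      ultimately have "\<epsilon>\<^sup>2 / 4 / 4 \<le> mass (\<lambda>k. a (- (- t)) (- k))"
        by (rule mp2) (use m that False \<tau>' in \<open>auto simp: mass_reflect\<close>)
      then show ?thesis by (simp add: mass_reflect)
    qed
    have "h_bounded (1 + real n / 4) R (a 0)"
    proof (rule sm[rule_format])
      show "fsol {- \<tau>'..\<tau>'} a" by (rule fsol_subset[OF sol]) (use \<tau>' in auto)
      show "h_bounded 1 (2 / \<epsilon>) (a t) \<and> \<epsilon>\<^sup>2 / 4 / 4 \<le> mass (a t)" if "t \<in> {- \<tau>'..\<tau>'}" for t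
        using b m1[OF that] that \<tau>' by auto
    qed (use \<tau>' in auto)
    then have "h_bounded (s + 1) R (a 0)" using n by (rule h_bounded_mono)
    then have "jp N powr (s + 1) * cmod (a 0 N) \<le> R"
      unfolding h_bounded_def by (rule l2_bounded_le)
    also have "R < \<epsilon> / 8 * jp N powr 1" using N \<epsilon> by (simp add: field_simps)
    also have "\<dots> = jp N powr (s + 1) * (\<epsilon> / 8 * jp N powr (- s))" by (simp add: powr_add powr_minus field_simps)
    finally show ?thesis by (subst (asm) mult_less_cancel_left_pos) auto
  qed
  with N(1) show ?thesis by (intro exI[of _ N]) auto
qed

text \<open>Both u(0) and v(0) would be below (\<epsilon>/8) N^(-s) at mode N, but they differ there
  by the planted coefficient, which is at least (\<epsilon>/4) N^(-s).\<close>

lemma inflation_contradiction: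
  assumes N: "N \<noteq> 0" and \<epsilon>: "0 < \<epsilon>" and s: "1 \<le> s\<^sub>1" "s\<^sub>1 \<le> s" and I: "0 \<in> I"
    and small: "\<And>a. fsol I a \<Longrightarrow> (\<And>t. t \<in> I \<Longrightarrow> h_bounded s\<^sub>1 (2 / \<epsilon>) (a t)) \<Longrightarrow> \<epsilon>\<^sup>2 / 4 \<le> mass (a 0) \<Longrightarrow>
      cmod (a 0 N) < \<epsilon> / 8 * jp N powr (- s)"
    and v: "fsol I (\<lambda>t. fourier (v t))" "\<And>t. t \<in> I \<Longrightarrow> h_bounded s\<^sub>1 (1 / \<epsilon>) (fourier (v t))" "square_integrable (v 0)"
    and u: "fsol I (\<lambda>t. fourier (u t))" "\<And>t. t \<in> I \<Longrightarrow> h_bounded s\<^sub>1 (2 / \<epsilon>) (fourier (u t))"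
    and u0: "\<And>k. fourier (u 0) k = fourier (\<lambda>x. v 0 x + pert \<epsilon> s N x) k"
    and L2: "\<not> (AE x in lebesgue. v 0 x = 0) \<longrightarrow> 2 * \<epsilon> \<le> L2_norm (v 0)"
  shows False
proof -
  define d where "d = fourier (pert \<epsilon> s N)"
  have split: "fourier (u 0) k = fourier (v 0) k + d k" for k
    unfolding u0 d_def using v(3) pert_square_integrable
    by (intro fourier_add square_integrable_integrable)
  have hv: "h_bounded s\<^sub>1 (1 / \<epsilon>) (fourier (v 0))" using v(2) I by simp
  have hd: "h_bounded s \<epsilon> d" unfolding d_def using N \<epsilon> by (intro pert_h_bounded) auto
  have v2: "h_bounded s\<^sub>1 (2 / \<epsilon>) (fourier (v t))" if "t \<in> I" for t
    using v(2)[OF that] \<epsilon> unfolding h_bounded_def by (elim l2_bounded_mono_const) (simp add: divide_right_mono)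
  have dN: "cmod (d N) = \<epsilon> / 4 * sqrt (2 * pi) * jp N powr (- s)"
    unfolding d_def using N \<epsilon> by (intro norm_fourier_pert) auto
  have pos: "0 < \<epsilon> / 8 * jp N powr (- s)" using \<epsilon> by simp
  have small_v: "cmod (fourier (v 0) N) < \<epsilon> / 8 * jp N powr (- s)" and mass_u: "\<epsilon>\<^sup>2 / 4 \<le> mass (fourier (u 0))"
  proof -
    have "cmod (fourier (v 0) N) < \<epsilon> / 8 * jp N powr (- s) \<and> \<epsilon>\<^sup>2 / 4 \<le> mass (fourier (u 0))"
    \<comment> \<open>If v(0) vanishes it has no mass for \<open>small\<close>, but its coefficient
      at N is 0, and the mass of u(0) comes from the constant in \<open>pert\<close>. Otherwise the
      lower bound 2 \<epsilon> on the L2 norm provides mass for both.\<close>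
    proof (cases "AE x in lebesgue. v 0 x = 0")
      case True
      have "fourier (v 0) k = fourier (\<lambda>_. 0) k" for k
      proof (rule fourier_cong_AE)
        show "v 0 \<in> borel_measurable torus_measure" using v(3) by (simp add: square_integrable_iff)
        show "AE x in torus_measure. v 0 x = 0" using True by (auto simp: AE_torus_iff elim: eventually_mono)
      qed simp
      then have z: "fourier (v 0) k = 0" for k by (simp add: fourier_eq)
      have "\<epsilon>\<^sup>2 / 4 \<le> (cmod (d 0))\<^sup>2"
      proof -
        have "(cmod (d 0))\<^sup>2 = \<epsilon>\<^sup>2 * (pi / 8)"
          unfolding d_def norm_fourier_pert(1)[OF N less_imp_le[OF \<epsilon>]] by (simp add: power_mult_distrib power_divide)
        moreover have "\<epsilon>\<^sup>2 * (2 / 8) \<le> \<epsilon>\<^sup>2 * (pi / 8)" using pi_ge_two by (intro mult_left_mono) auto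
        ultimately show ?thesis by simp
      qed
      also have "(cmod (d 0))\<^sup>2 = (\<Sum>k\<in>{0}. (cmod (d k))\<^sup>2)" by simp
      also have "\<dots> \<le> mass d" unfolding mass_def
        using h_bounded_mass(1)[OF hd, of UNIV] s by (intro finite_sum_le_infsum) auto
      also have "d = fourier (u 0)" using split z by (simp add: fun_eq_iff)
      finally show ?thesis using z pos by simp
    next
      case False
      have w: "wiener (v 0)" using v(3) h_bounded_mono[OF hv s(1)] by (rule wienerI)
      have "2 * \<epsilon> \<le> sqrt (mass (fourier (v 0)))" using L2 False parseval[OF w] by simp
      then have "(2 * \<epsilon>)\<^sup>2 \<le> (sqrt (mass (fourier (v 0))))\<^sup>2" using \<epsilon> by (intro power_mono) auto
      also have "\<dots> = mass (fourier (v 0))" by (simp add: mass_def infsum_nonneg)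
      finally have "(2 * \<epsilon>)\<^sup>2 \<le> mass (fourier (v 0))" .
      then have mv: "4 * \<epsilon>\<^sup>2 \<le> mass (fourier (v 0))" by (simp add: power_mult_distrib)
      have "\<epsilon>\<^sup>2 / 4 \<le> mass (fourier (u 0))"
        by (rule mass_add_lower[OF split hv h_bounded_mono[OF hd s(2)] _ mv]) (use s in auto)
      moreover have "cmod (fourier (v 0) N) < \<epsilon> / 8 * jp N powr (- s)"
      proof (rule small[OF v(1) v2])
        have "\<epsilon>\<^sup>2 / 4 \<le> 4 * \<epsilon>\<^sup>2" by simp
        then show "\<epsilon>\<^sup>2 / 4 \<le> mass (fourier (v 0))" using mv by linarith
      qed
      ultimately show ?thesis by blast
    qed
    then show "cmod (fourier (v 0) N) < \<epsilon> / 8 * jp N powr (- s)" "\<epsilon>\<^sup>2 / 4 \<le> mass (fourier (u 0))" by auto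
  qed
  have "cmod (fourier (u 0) N) < \<epsilon> / 8 * jp N powr (- s)" by (rule small[OF u mass_u])
  moreover have "cmod (d N) \<le> cmod (fourier (u 0) N) + cmod (fourier (v 0) N)"
    using norm_triangle_ineq4[of "fourier (u 0) N" "fourier (v 0) N"] by (simp add: split)
  moreover have "\<epsilon> / 8 * jp N powr (- s) + \<epsilon> / 8 * jp N powr (- s) \<le> cmod (d N)"
  proof -
    have "1 \<le> sqrt (2 * pi)" using pi_ge_two by (intro real_le_rsqrt) simp
    then have "\<epsilon> / 4 * 1 * jp N powr (- s) \<le> \<epsilon> / 4 * sqrt (2 * pi) * jp N powr (- s)"
      using \<epsilon> by (intro mult_right_mono mult_left_mono) auto
    then show ?thesis unfolding dN by simp
  qed
  ultimately show False using small_v by linarith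
qed

text \<open>The negated conclusion bounds u - v by 1/\<epsilon>; adding v gives the radius
  2/\<epsilon> used throughout.\<close>

lemma difference_bounds:
  assumes \<epsilon>: "0 < \<epsilon>"
    and v: "(SUP t\<in>I. sobolev_norm s (v t)) \<le> ennreal (1 / \<epsilon>)"
    and d: "\<not> ennreal (1 / \<epsilon>) \<le> (SUP t\<in>I. sobolev_norm s (\<lambda>x. u t x - v t x))"
    and u: "\<And>t. t \<in> I \<Longrightarrow> square_integrable (u t)" and t: "t \<in> I"
  shows "h_bounded s (1 / \<epsilon>) (fourier (v t))" "h_bounded s (2 / \<epsilon>) (fourier (u t))" "square_integrable (v t)"
proof -
  have "sobolev_norm s (v t) \<le> ennreal (1 / \<epsilon>)" using SUP_upper[OF t] v by (rule order_trans)
  then show hv: "h_bounded s (1 / \<epsilon>) (fourier (v t))" and sv: "square_integrable (v t)"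
    using sobolev_norm_h_bounded \<epsilon> by (auto intro: less_imp_le)
  have "sobolev_norm s (\<lambda>x. u t x - v t x) \<le> (SUP t\<in>I. sobolev_norm s (\<lambda>x. u t x - v t x))"
    using t by (rule SUP_upper)
  also have "\<dots> \<le> ennreal (1 / \<epsilon>)" using d by simp
  finally have hd: "h_bounded s (1 / \<epsilon>) (fourier (\<lambda>x. u t x - v t x))"
    using sobolev_norm_h_bounded \<epsilon> by (auto intro: less_imp_le)
  have "fourier (\<lambda>x. u t x - v t x) = (\<lambda>k. fourier (u t) k - fourier (v t) k)"
    using u[OF t] sv by (simp add: fun_eq_iff fourier_diff square_integrable_integrable)
  with h_bounded_add[OF hd hv] show "h_bounded s (2 / \<epsilon>) (fourier (u t))" by simp
qed

end

section \<open>The three claims\<close>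

text \<open>The common shape of the two-sided, forward and backward claims, with the time intervals
  and the notion of solution as parameters.\<close>

definition inflating_family ::
  "(real \<Rightarrow> real set) \<Rightarrow> (real \<Rightarrow> (real \<Rightarrow> complex) \<Rightarrow> (real \<Rightarrow> real \<Rightarrow> complex) \<Rightarrow> bool) \<Rightarrow>
   real \<Rightarrow> real \<Rightarrow> (real \<Rightarrow> real \<Rightarrow> real \<Rightarrow> complex) \<Rightarrow> bool" where
  "inflating_family I sol s\<^sub>1 s \<phi> \<longleftrightarrow>
     (\<forall>\<epsilon>>0. \<forall>\<tau>>0. real_analytic_torus (\<phi> \<epsilon> \<tau>) \<and> sobolev_norm s (\<phi> \<epsilon> \<tau>) \<le> ennreal \<epsilon>) \<and>
     (\<forall>T>0. \<forall>v. continuous_sobolev (I T) 1 v \<longrightarrow> (\<exists>v\<^sub>0. sol T v\<^sub>0 v) \<longrightarrow>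
        (\<forall>\<epsilon>>0. \<forall>\<tau>>0. \<tau> \<le> T \<longrightarrow>
           (SUP t\<in>I \<tau>. sobolev_norm s\<^sub>1 (v t)) \<le> ennreal (1 / \<epsilon>) \<longrightarrow>
           (\<not> (AE x in lebesgue. v 0 x = 0) \<longrightarrow> 2 * \<epsilon> \<le> L2_norm (v 0)) \<longrightarrow>
           (\<forall>u. continuous_sobolev (I \<tau>) s\<^sub>1 u \<longrightarrow> sol \<tau> (\<lambda>x. v 0 x + \<phi> \<epsilon> \<tau> x) u \<longrightarrow>
              (SUP t\<in>I \<tau>. sobolev_norm s\<^sub>1 (\<lambda>x. u t x - v t x)) \<ge> ennreal (1 / \<epsilon>))))"

context raman
begin

lemma inflating_family_exists:
  assumes s: "1 \<le> s\<^sub>1" "s\<^sub>1 \<le> s"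
    and I: "\<And>\<tau> T. \<tau> \<le> T \<Longrightarrow> I \<tau> \<subseteq> I T" "\<And>\<tau>. 0 < \<tau> \<Longrightarrow> 0 \<in> I \<tau>"
    and small: "\<And>\<epsilon> \<tau>. 0 < \<epsilon> \<Longrightarrow> 0 < \<tau> \<Longrightarrow> \<exists>N. N \<noteq> 0 \<and> (\<forall>a. fsol (I \<tau>) a \<longrightarrow>
      (\<forall>t\<in>I \<tau>. h_bounded s\<^sub>1 (2 / \<epsilon>) (a t)) \<longrightarrow> \<epsilon>\<^sup>2 / 4 \<le> mass (a 0) \<longrightarrow> cmod (a 0 N) < \<epsilon> / 8 * jp N powr (- s))"
    and sol: "\<And>T \<tau> R w w\<^sub>0 k. sol T w\<^sub>0 w \<Longrightarrow> 0 < \<tau> \<Longrightarrow> \<tau> \<le> T \<Longrightarrow>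
      (\<And>t. t \<in> I \<tau> \<Longrightarrow> square_integrable (w t) \<and> h_bounded 1 R (fourier (w t))) \<Longrightarrow>
      (\<And>k. continuous_on (I \<tau>) (\<lambda>t. fourier (w t) k)) \<Longrightarrow>
      fsol (I \<tau>) (\<lambda>t. fourier (w t)) \<and> fourier (w 0) k = fourier w\<^sub>0 k"
  shows "\<exists>\<phi>. inflating_family I sol s\<^sub>1 s \<phi>"
proof -
  define P where "P = (\<lambda>\<epsilon> \<tau> N. N \<noteq> 0 \<and> (\<forall>a. fsol (I \<tau>) a \<longrightarrow> (\<forall>t\<in>I \<tau>. h_bounded s\<^sub>1 (2 / \<epsilon>) (a t)) \<longrightarrow>
    \<epsilon>\<^sup>2 / 4 \<le> mass (a 0) \<longrightarrow> cmod (a 0 N) < \<epsilon> / 8 * jp N powr (- s)))"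
  \<comment> \<open>The mode is selected from \<epsilon> and \<tau> before T, v and u appear, as the
    order of quantifiers demands.\<close>
  define N where "N = (\<lambda>\<epsilon> \<tau>. SOME N. P \<epsilon> \<tau> N)"
  have N: "P \<epsilon> \<tau> (N \<epsilon> \<tau>)" if "0 < \<epsilon>" "0 < \<tau>" for \<epsilon> \<tau>
  proof -
    have "\<exists>N. P \<epsilon> \<tau> N" unfolding P_def by (rule small[OF that])
    from someI_ex[OF this] show ?thesis by (simp add: N_def)
  qed
  show ?thesis
    unfolding inflating_family_def
  proof (intro exI[of _ "\<lambda>\<epsilon> \<tau>. pert \<epsilon> s (N \<epsilon> \<tau>)"] conjI allI impI)
    fix \<epsilon> \<tau> :: real assume pos: "0 < \<epsilon>" "0 < \<tau>"
    show "real_analytic_torus (pert \<epsilon> s (N \<epsilon> \<tau>))" by (rule pert_analytic)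
    show "sobolev_norm s (pert \<epsilon> s (N \<epsilon> \<tau>)) \<le> ennreal \<epsilon>"
      using N[OF pos] pos by (intro pert_sobolev_norm) (auto simp: P_def)
  next
    fix T \<epsilon> \<tau> :: real and v u
    assume cv: "continuous_sobolev (I T) 1 v" and sv: "\<exists>v\<^sub>0. sol T v\<^sub>0 v"
      and pos: "0 < \<epsilon>" "0 < \<tau>" and \<tau>: "\<tau> \<le> T"
      and bv: "(SUP t\<in>I \<tau>. sobolev_norm s\<^sub>1 (v t)) \<le> ennreal (1 / \<epsilon>)"
      and L2: "\<not> (AE x in lebesgue. v 0 x = 0) \<longrightarrow> 2 * \<epsilon> \<le> L2_norm (v 0)"
      and cu: "continuous_sobolev (I \<tau>) s\<^sub>1 u" and su: "sol \<tau> (\<lambda>x. v 0 x + pert \<epsilon> s (N \<epsilon> \<tau>) x) u"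
    show "ennreal (1 / \<epsilon>) \<le> (SUP t\<in>I \<tau>. sobolev_norm s\<^sub>1 (\<lambda>x. u t x - v t x))"
    proof (rule ccontr)
      assume d: "\<not> ennreal (1 / \<epsilon>) \<le> (SUP t\<in>I \<tau>. sobolev_norm s\<^sub>1 (\<lambda>x. u t x - v t x))"
      have s0: "0 \<le> s\<^sub>1" using s by simp
      note cuf = continuous_sobolev_fourier[OF cu s0]
      have b: "h_bounded s\<^sub>1 (1 / \<epsilon>) (fourier (v t))" "h_bounded s\<^sub>1 (2 / \<epsilon>) (fourier (u t))" "square_integrable (v t)"
        if "t \<in> I \<tau>" for t
        by (rule difference_bounds[OF pos(1) bv d _ that], erule cuf(2))+
      have cvf: "continuous_on (I \<tau>) (\<lambda>t. fourier (v t) k)" for k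
        by (rule continuous_on_subset[OF continuous_sobolev_fourier(1)[OF cv] I(1)[OF \<tau>]]) simp
      obtain v0 where sv': "sol T v0 v" using sv by blast
      have fv: "fsol (I \<tau>) (\<lambda>t. fourier (v t))"
      proof (rule sol[OF sv' pos(2) \<tau> _ cvf, THEN conjunct1])
        show "square_integrable (v t) \<and> h_bounded 1 (1 / \<epsilon>) (fourier (v t))" if "t \<in> I \<tau>" for t
          using b(3)[OF that] h_bounded_mono[OF b(1)[OF that] s(1)] by blast
      qed
      have bu: "square_integrable (u t) \<and> h_bounded 1 (2 / \<epsilon>) (fourier (u t))" if "t \<in> I \<tau>" for t
        using cuf(2)[OF that] h_bounded_mono[OF b(2)[OF that] s(1)] by blast
      have fu: "fsol (I \<tau>) (\<lambda>t. fourier (u t)) \<and>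
        fourier (u 0) k = fourier (\<lambda>x. v 0 x + pert \<epsilon> s (N \<epsilon> \<tau>) x) k" for k
        by (rule sol[OF su pos(2) order_refl _ cuf(1)], erule bu)
      show False
        by (rule inflation_contradiction[where u = u and v = v and N = "N \<epsilon> \<tau>" and I = "I \<tau>" and s\<^sub>1 = s\<^sub>1 and s = s])
          (use N[OF pos] pos s I(2)[OF pos(2)] fv fu b L2 in \<open>auto simp: P_def\<close>)
    qed
  qed
qed

lemma one_sided_family:
  assumes \<sigma>: "\<sigma> = 1 \<or> \<sigma> = - 1" and s: "1 \<le> s\<^sub>1" "s\<^sub>1 \<le> s" "s < s\<^sub>1 + 1"
    and sol: "\<And>T w\<^sub>0 w. sol T w\<^sub>0 w \<Longrightarrow> \<exists>r. weak_solution \<alpha>\<^sub>1 \<alpha>\<^sub>2 \<gamma>\<^sub>1 \<gamma>\<^sub>2 \<Gamma> \<sigma> (time_interval \<sigma> T) r w\<^sub>0 w"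
  shows "\<exists>\<phi>. inflating_family (time_segment \<sigma>) sol s\<^sub>1 s \<phi>"
proof (rule inflating_family_exists[OF s(1,2)])
  fix T \<tau> R w w\<^sub>0 k
  assume w: "sol T w\<^sub>0 w" and \<tau>: "0 < \<tau>" "\<tau> \<le> T"
    and b: "\<And>t. t \<in> time_segment \<sigma> \<tau> \<Longrightarrow> square_integrable (w t) \<and> h_bounded 1 R (fourier (w t))"
    and c: "\<And>k. continuous_on (time_segment \<sigma> \<tau>) (\<lambda>t. fourier (w t) k)"
  obtain r where "weak_solution \<alpha>\<^sub>1 \<alpha>\<^sub>2 \<gamma>\<^sub>1 \<gamma>\<^sub>2 \<Gamma> \<sigma> (time_interval \<sigma> T) r w\<^sub>0 w" using sol[OF w] by blast
  from weak_solution_fsol[OF \<sigma> \<tau> this b c]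
  show "fsol (time_segment \<sigma> \<tau>) (\<lambda>t. fourier (w t)) \<and> fourier (w 0) k = fourier w\<^sub>0 k" by blast
qed (use inflation_one_sided[OF \<sigma> s(1,3)] in \<open>auto simp: time_segment_def\<close>)

text \<open>The weak identities on the two half intervals give the same one-sided equations at 0, so
  the coefficient equations glue across it.\<close>

lemma two_sided_family:
  assumes s: "1 \<le> s"
  shows "\<exists>\<phi>. inflating_family (\<lambda>T. {- T..T}) (solution_both \<alpha>\<^sub>1 \<alpha>\<^sub>2 \<gamma>\<^sub>1 \<gamma>\<^sub>2 \<Gamma>) 1 s \<phi>"
proof (rule inflating_family_exists[OF order_refl s])
  fix T \<tau> R w w\<^sub>0 k
  assume w: "solution_both \<alpha>\<^sub>1 \<alpha>\<^sub>2 \<gamma>\<^sub>1 \<gamma>\<^sub>2 \<Gamma> T w\<^sub>0 w" and \<tau>: "0 < \<tau>" "\<tau> \<le> T"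
    and b: "\<And>t. t \<in> {- \<tau>..\<tau>} \<Longrightarrow> square_integrable (w t) \<and> h_bounded 1 R (fourier (w t))"
    and c: "\<And>k. continuous_on {- \<tau>..\<tau>} (\<lambda>t. fourier (w t) k)"
  have side: "fsol (time_segment \<sigma> \<tau>) (\<lambda>t. fourier (w t)) \<and> fourier (w 0) k = fourier w\<^sub>0 k"
    if \<sigma>: "\<sigma> = 1 \<or> \<sigma> = - 1" for \<sigma>
  proof -
    have sub: "time_segment \<sigma> \<tau> \<subseteq> {- \<tau>..\<tau>}" using \<sigma> \<tau> by (auto simp: time_segment_simps)
    obtain r where "weak_solution \<alpha>\<^sub>1 \<alpha>\<^sub>2 \<gamma>\<^sub>1 \<gamma>\<^sub>2 \<Gamma> \<sigma> (time_interval \<sigma> T) r w\<^sub>0 w"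
      using w \<sigma> by (auto simp: solution_both_def solution_forward_def solution_backward_def time_interval_simps)
    note fs = weak_solution_fsol[OF \<sigma> \<tau> this _ continuous_on_subset[OF c sub], where R = R]
    have "square_integrable (w t) \<and> h_bounded 1 R (fourier (w t))" if "t \<in> time_segment \<sigma> \<tau>" for t
      using that sub b by blast
    from fs[OF this] show ?thesis by blast
  qed
  from side[of 1] side[of "- 1"] show "fsol {- \<tau>..\<tau>} (\<lambda>t. fourier (w t)) \<and> fourier (w 0) k = fourier w\<^sub>0 k"
    by (auto simp: time_segment_simps intro: fsol_union)
qed (use inflation_two_sided in auto)

end

theorem theorem3p2:
  fixes \<alpha>\<^sub>1 \<alpha>\<^sub>2 \<gamma>\<^sub>1 \<gamma>\<^sub>2 \<Gamma> :: real
  assumes "\<Gamma> > 0" and "\<alpha>\<^sub>1 \<noteq> 0" and "2 * \<alpha>\<^sub>2 / (3 * \<alpha>\<^sub>1) \<notin> \<int>"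
  shows
    "(\<forall>s\<ge>1.
       (\<exists>\<phi> :: real \<Rightarrow> real \<Rightarrow> real \<Rightarrow> complex.
          (\<forall>\<epsilon>>0. \<forall>\<tau>>0. real_analytic_torus (\<phi> \<epsilon> \<tau>) \<and> sobolev_norm s (\<phi> \<epsilon> \<tau>) \<le> ennreal \<epsilon>) \<and>
          (\<forall>T>0. \<forall>ustar. continuous_sobolev {-T..T} 1 ustar \<longrightarrow>
             (\<exists>u\<^sub>0. solution_both \<alpha>\<^sub>1 \<alpha>\<^sub>2 \<gamma>\<^sub>1 \<gamma>\<^sub>2 \<Gamma> T u\<^sub>0 ustar) \<longrightarrow>
             (\<forall>\<epsilon>>0. \<forall>\<tau>>0. \<tau> \<le> T \<longrightarrow>
                (SUP t\<in>{-\<tau>..\<tau>}. sobolev_norm 1 (ustar t)) \<le> ennreal (1 / \<epsilon>) \<longrightarrow>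
                (\<not> (AE x in lebesgue. ustar 0 x = 0) \<longrightarrow> 2 * \<epsilon> \<le> L2_norm (ustar 0)) \<longrightarrow>
                (\<forall>u. continuous_sobolev {-\<tau>..\<tau>} 1 u \<longrightarrow>
                   solution_both \<alpha>\<^sub>1 \<alpha>\<^sub>2 \<gamma>\<^sub>1 \<gamma>\<^sub>2 \<Gamma> \<tau> (\<lambda>x. ustar 0 x + \<phi> \<epsilon> \<tau> x) u \<longrightarrow>
                   (SUP t\<in>{-\<tau>..\<tau>}. sobolev_norm 1 (\<lambda>x. u t x - ustar t x)) \<ge> ennreal (1 / \<epsilon>))))))
     \<and>
     (\<forall>s\<^sub>1 s. 1 \<le> s\<^sub>1 \<and> s\<^sub>1 \<le> s \<and> s < s\<^sub>1 + 1 \<longrightarrow>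
       (\<exists>\<phi> :: real \<Rightarrow> real \<Rightarrow> real \<Rightarrow> complex.
          (\<forall>\<epsilon>>0. \<forall>\<tau>>0. real_analytic_torus (\<phi> \<epsilon> \<tau>) \<and> sobolev_norm s (\<phi> \<epsilon> \<tau>) \<le> ennreal \<epsilon>) \<and>
          (\<forall>T>0. \<forall>ustar. continuous_sobolev {0..T} 1 ustar \<longrightarrow>
             (\<exists>u\<^sub>0. solution_forward \<alpha>\<^sub>1 \<alpha>\<^sub>2 \<gamma>\<^sub>1 \<gamma>\<^sub>2 \<Gamma> T u\<^sub>0 ustar) \<longrightarrow>
             (\<forall>\<epsilon>>0. \<forall>\<tau>>0. \<tau> \<le> T \<longrightarrow>
                (SUP t\<in>{0..\<tau>}. sobolev_norm s\<^sub>1 (ustar t)) \<le> ennreal (1 / \<epsilon>) \<longrightarrow>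
                (\<not> (AE x in lebesgue. ustar 0 x = 0) \<longrightarrow> 2 * \<epsilon> \<le> L2_norm (ustar 0)) \<longrightarrow>
                (\<forall>u. continuous_sobolev {0..\<tau>} s\<^sub>1 u \<longrightarrow>
                   solution_forward \<alpha>\<^sub>1 \<alpha>\<^sub>2 \<gamma>\<^sub>1 \<gamma>\<^sub>2 \<Gamma> \<tau> (\<lambda>x. ustar 0 x + \<phi> \<epsilon> \<tau> x) u \<longrightarrow>
                   (SUP t\<in>{0..\<tau>}. sobolev_norm s\<^sub>1 (\<lambda>x. u t x - ustar t x)) \<ge> ennreal (1 / \<epsilon>))))))
     \<and>
     (\<forall>s\<^sub>1 s. 1 \<le> s\<^sub>1 \<and> s\<^sub>1 \<le> s \<and> s < s\<^sub>1 + 1 \<longrightarrow>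
       (\<exists>\<phi> :: real \<Rightarrow> real \<Rightarrow> real \<Rightarrow> complex.
          (\<forall>\<epsilon>>0. \<forall>\<tau>>0. real_analytic_torus (\<phi> \<epsilon> \<tau>) \<and> sobolev_norm s (\<phi> \<epsilon> \<tau>) \<le> ennreal \<epsilon>) \<and>
          (\<forall>T>0. \<forall>ustar. continuous_sobolev {-T..0} 1 ustar \<longrightarrow>
             (\<exists>u\<^sub>0. solution_backward \<alpha>\<^sub>1 \<alpha>\<^sub>2 \<gamma>\<^sub>1 \<gamma>\<^sub>2 \<Gamma> T u\<^sub>0 ustar) \<longrightarrow>
             (\<forall>\<epsilon>>0. \<forall>\<tau>>0. \<tau> \<le> T \<longrightarrow>
                (SUP t\<in>{-\<tau>..0}. sobolev_norm s\<^sub>1 (ustar t)) \<le> ennreal (1 / \<epsilon>) \<longrightarrow>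
                (\<not> (AE x in lebesgue. ustar 0 x = 0) \<longrightarrow> 2 * \<epsilon> \<le> L2_norm (ustar 0)) \<longrightarrow>
                (\<forall>u. continuous_sobolev {-\<tau>..0} s\<^sub>1 u \<longrightarrow>
                   solution_backward \<alpha>\<^sub>1 \<alpha>\<^sub>2 \<gamma>\<^sub>1 \<gamma>\<^sub>2 \<Gamma> \<tau> (\<lambda>x. ustar 0 x + \<phi> \<epsilon> \<tau> x) u \<longrightarrow>
                   (SUP t\<in>{-\<tau>..0}. sobolev_norm s\<^sub>1 (\<lambda>x. u t x - ustar t x)) \<ge> ennreal (1 / \<epsilon>))))))"
proof -
  interpret raman \<alpha>\<^sub>1 \<alpha>\<^sub>2 \<gamma>\<^sub>1 \<gamma>\<^sub>2 \<Gamma> using assms by unfold_locales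
  have "\<exists>\<phi>. inflating_family (\<lambda>T. {0..T}) (solution_forward \<alpha>\<^sub>1 \<alpha>\<^sub>2 \<gamma>\<^sub>1 \<gamma>\<^sub>2 \<Gamma>) s\<^sub>1 s \<phi>"
    "\<exists>\<phi>. inflating_family (\<lambda>T. {- T..0}) (solution_backward \<alpha>\<^sub>1 \<alpha>\<^sub>2 \<gamma>\<^sub>1 \<gamma>\<^sub>2 \<Gamma>) s\<^sub>1 s \<phi>"
    if "1 \<le> s\<^sub>1 \<and> s\<^sub>1 \<le> s \<and> s < s\<^sub>1 + 1" for s\<^sub>1 s
    using one_sided_family[of 1 s\<^sub>1 s "solution_forward \<alpha>\<^sub>1 \<alpha>\<^sub>2 \<gamma>\<^sub>1 \<gamma>\<^sub>2 \<Gamma>"]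
      one_sided_family[of "- 1" s\<^sub>1 s "solution_backward \<alpha>\<^sub>1 \<alpha>\<^sub>2 \<gamma>\<^sub>1 \<gamma>\<^sub>2 \<Gamma>"] that
    unfolding time_segment_simps time_interval_simps solution_forward_def solution_backward_def
    by blast+
  with two_sided_family show ?thesis
    unfolding inflating_family_def by (intro conjI allI impI)
qed

end
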